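(* Let $(G_1,\Phi_1,F_1)$ and $(G_2,\Phi_2,F_2)$ be multi-models over the same variety $\Theta$, with $G_1,G_2\in\Theta$, and suppose that the given models are finite (i.e. the algebras $G_1$ and $G_2$ are finite). Let $KB_1=KB(G_1,\Phi_1,F_1)$ and $KB_2=KB(G_2,\Phi_2,F_2)$ be the corresponding knowledge bases. Then $KB_1$ and $KB_2$ are informationally equivalent if and only if there exists a bijection $\alpha:F_1\to F_2$ such that for every $f\in F_1$ there is an isomorphism of Halmos algebras $\gamma_f:R_f\to R_{f^\alpha}$.
   Context: **Algebras.** $\Gamma$ is a finite set of sorts and $\Theta$ is a fixed variety of $\Gamma$-sorted algebras $G=(G_i,\ i\in\Gamma)$ with signature $\Omega$. Fix an infinite $\Gamma$-sorted set of variables $X^0=(X^0_i,\ i\in\Gamma)$, and let $\Gamma^0$ be the set of all finite $\Gamma$-sorted subsets $X=(X_i,\ i\in\Gamma)$ of $X^0$. $W(X)$ is the free algebra of $\Theta$ over $X$. $\Theta^0$ is the category of all $W(X)$, $X\in\Gamma^0$, with all homomorphisms $s:W(X)\to W(Y)$. $\mathrm{Hom}(W(X),G)$ is the set of homomorphisms $W(X)\to G$ ("points"). **Models.** $\Phi$ is a set of relation symbols; each $\varphi\in\Phi$ has a type $(i_1,\dots,i_n)$ with $i_j\in\Gamma$. A model $(G,\Phi,f)$ consists of $G\in\Theta$ and an interpretation $f$ of every $\varphi\in\Phi$ of type $(i_1,\dots,i_n)$ as a subset of $G_{i_1}\times\dots\times G_{i_n}$. A multi-model $(G,\Phi,F)$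 consists of $G\in\Theta$, $\Phi$, and a set $F$ of interpretations $f$ of $\Phi$ in $G$. **Halmos algebras.** An existential quantifier on a Boolean algebra $B$ is a map $\exists:B\to B$ with $\exists 0=0$, $a\le\exists a$, $\exists(a\wedge\exists b)=\exists a\wedge\exists b$. A quantifier $X$-algebra with equalities over $W(X)$ is a Boolean algebra with pairwise commuting existential quantifiers $\exists x$ ($x\in X$) and elements $w\equiv w'$ for all $w,w'\in W(X)$ of the same sort, such that $w\equiv w$ is the unit and $(w_1\equiv w_1')\wedge\dots\wedge(w_n\equiv w_n')\le (w_1\dots w_n\omega\equiv w_1'\dots w_n'\omega)$ for every $\omega\in\Omega$ (with matching sorts). A (multi-sorted) Halmos algebra is a family $H=(H(X),\ X\in\Gamma^0)$ where each $H(X)$ is a quantifier $X$-algebra with equalities over $W(X)$, together with a unary operation $s_*:H(X)\to H(Y)$ (also written $s$) for each $s:W(X)\to W(Y)$ in $\Theta^0$, such that: 1. $W(X)\mapsto H(X)$, $s\mapsto s_*$ is a covariant functor. 2. Each $s_*$ is a Boolean homomorphism. 3. $s_{1*}\exists x\,a=s_{2*}\exists x\,a$ for $a\in H(X)$ whenever $s_1y=s_2y$ for all $y\in X$, $y\ne x$; and $s_*\exists x\,a=\exists (sx)(s_*a)$ whenever $sx=y\in Y$ and the variable $y$ is not in the support of $sx'$ for any $x'\in X$, $x'\neq x$. 4. $s_*(w\equiv w')=(sw\equiv sw')$; and $(s^x_w)_*a\wedge(w\equiv w')\le (s^x_{w'})_*a$ for $a\in H(X)$, $x\in X$, and $w,w'\in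 W(X)$ of the same sort as $x$, where $s^x_w:W(X)\to W(X)$ sends $x\mapsto w$ and fixes every $y\in X$, $y\ne x$. All Halmos algebras form the variety $\mathrm{Hal}_\Theta$ of $\Gamma^0$-sorted algebras in the signature consisting of the operations $\vee,\wedge,\lnot,\exists x$, the nullary operations $w\equiv w'$, and the operations $s_*$; homomorphisms are families $\beta=(\beta_X,\ X\in\Gamma^0)$ preserving this signature. **The algebra $\mathrm{Hal}_\Theta(G)$.** $\mathrm{Hal}_\Theta(G)(X)$ is the Boolean algebra of all subsets of $\mathrm{Hom}(W(X),G)$. For a subset $A$ and $x\in X$, $\mu\in\exists xA$ iff there is $\nu\in A$ with $\mu(y)=\nu(y)$ for all $y\in X$, $y\ne x$. The element $w\equiv w'$ is $\{\mu:\mu(w)=\mu(w')\}$. For $s:W(X)\to W(Y)$, $s_*A=\{\nu\in\mathrm{Hom}(W(Y),G):\nu s\in A\}$. **The algebra $\mathrm{Hal}_\Theta(\Phi)$.** It is the quotient of the free algebra of $\mathrm{Hal}_\Theta$ generated by the atomic formulas $\varphi(w_1,\dots,w_n)$ of sort $X$ ($X\in\Gamma^0$, $\varphi\in\Phi$, $w_j\in W(X)$ of sorts matching the type of $\varphi$) by the relations $s_*\varphi(w_1,\dots,w_n)=\varphi(sw_1,\dots,sw_n)$ for all $s:W(X)\to W(Y)$ (the equalities $w\equiv w'$ are nullary operations of the signature). Write $\mathrm{Hal}_{\Phi\Theta}(X)$ for its component of sort $X$; its elements are called formulas. For a model $(G,\Phi,f)$, $\mathrm{Val}_f:\mathrm{Hal}_\Theta(\Phi)\to\mathrm{Hal}_\Theta(G)$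 is the homomorphism sending $\varphi(w_1,\dots,w_n)$ of sort $X$ to the set of $\mu\in\mathrm{Hom}(W(X),G)$ with $(\mu(w_1),\dots,\mu(w_n))\in f(\varphi)$. $R_f$ is the image of $\mathrm{Val}_f$, a Halmos subalgebra of $\mathrm{Hal}_\Theta(G)$. For $T\subset\mathrm{Hal}_{\Phi\Theta}(X)$ put $T^f=\bigcap_{u\in T}\mathrm{Val}_f(u)\subset\mathrm{Hom}(W(X),G)$. **Categories and functors.** - $L_\Theta(\Phi)$ (knowledge description): objects are pairs $(X,T)$, $X\in\Gamma^0$, $T\subset\mathrm{Hal}_{\Phi\Theta}(X)$; morphisms $(X,T_1)\to(Y,T_2)$ are the $s_*$ given by $s:W(X)\to W(Y)$ with $s_*(u)\in T_2$ for every $u\in T_1$ (morphisms are indexed by $s$). - $K_{\Phi\Theta}(f)$ (knowledge content): objects are pairs $(X,A)$ with $A=T^f$ for some $T\subset\mathrm{Hal}_{\Phi\Theta}(X)$; morphisms $(X,A)\to(Y,B)$ are the mappings $[s]:A\to B$, $\nu\mapsto\nu s$, induced by those $s:W(Y)\to W(X)$ for which $\nu s\in B$ for every $\nu\in A$. - $\mathrm{Ct}_f:L_\Theta(\Phi)\to K_{\Phi\Theta}(f)$ is the contravariant functor $(X,T)\mapsto(X,T^f)$, $s_*\mapsto[s]$. - A homomorphism $\beta:\mathrm{Hal}_\Theta(\Phi_1)\to\mathrm{Hal}_\Theta(\Phi_2)$ induces the functor $\widetilde\beta:L_\Theta(\Phi_1)\to L_\Theta(\Phi_2)$, $(X,T)\mapsto(X,T^\beta)$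 with $T^\beta=\{\beta_X(u):u\in T\}$, sending the morphism given by $s$ to the morphism given by the same $s$. **Knowledge bases.** The knowledge base $KB(G,\Phi,F)$ of a multi-model consists of the category $L_\Theta(\Phi)$ and the categories $K_{\Phi\Theta}(f)$, $f\in F$, related by the functors $\mathrm{Ct}_f$. **Informational equivalence.** Write $f^\alpha=\alpha(f)$. $KB(G_1,\Phi_1,F_1)$ and $KB(G_2,\Phi_2,F_2)$ are informationally equivalent if there is a bijection $\alpha:F_1\to F_2$ such that for every $f\in F_1$ there exist homomorphisms $\beta_f:\mathrm{Hal}_\Theta(\Phi_1)\to\mathrm{Hal}_\Theta(\Phi_2)$ and $\beta_f':\mathrm{Hal}_\Theta(\Phi_2)\to\mathrm{Hal}_\Theta(\Phi_1)$ and an isomorphism of categories $\widetilde\gamma_f:K_{\Phi_1\Theta}(f)\to K_{\Phi_2\Theta}(f^\alpha)$ with $\widetilde\gamma_f\circ\mathrm{Ct}_f=\mathrm{Ct}_{f^\alpha}\circ\widetilde{\beta_f}$ and $(\widetilde\gamma_f)^{-1}\circ\mathrm{Ct}_{f^\alpha}=\mathrm{Ct}_f\circ\widetilde{\beta_f'}$ (equalities of functors). *)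

theory Defs
  imports Main "HOL-Library.FuncSet"
begin

section \<open>Many-sorted algebras and varieties\<close>

datatype ('o, tvars: 'x) trm = Var 'x | Op 'o "('o, 'x) trm list"

text \<open>
  A variety is given by its signature, the sorted set \<open>X\<^sup>0\<close> of variables, and a set of identities.
  A sorted set of variables is a set \<open>X\<close> together with the sort map \<open>vsort\<close>, i.e.
  \<open>X\<^sub>i = {x \<in> X. vsort x = i}\<close>.  An identity \<open>(Y, l, r)\<close> carries the finite set \<open>Y\<close> over which it is
  universally quantified; this matters because carriers of some sorts may be empty.
\<close>

record ('s, 'o, 'x) variety =
  ops :: "'o set"
  arity :: "'o \<Rightarrow> 's list"
  rsort :: "'o \<Rightarrow> 's"
  vars :: "'x set"
  vsort :: "'x \<Rightarrow> 's"
  idents :: "('x set \<times> ('o, 'x) trm \<times> ('o, 'x) trm) set"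

inductive wt :: "('s, 'o, 'x, 'z) variety_scheme \<Rightarrow> 'x set \<Rightarrow> ('o, 'x) trm \<Rightarrow> 's \<Rightarrow> bool"
  for \<Theta> :: "('s, 'o, 'x, 'z) variety_scheme" and X :: "'x set" where
  wt_Var: "x \<in> X \<Longrightarrow> wt \<Theta> X (Var x) (vsort \<Theta> x)"
| wt_Op: "\<omega> \<in> ops \<Theta> \<Longrightarrow> list_all2 (wt \<Theta> X) ts (arity \<Theta> \<omega>) \<Longrightarrow> wt \<Theta> X (Op \<omega> ts) (rsort \<Theta> \<omega>)"

definition Gamma0 :: "('s, 'o, 'x) variety \<Rightarrow> 'x set set" where
  "Gamma0 \<Theta> = {X. finite X \<and> X \<subseteq> vars \<Theta>}"

definition wf_variety :: "('s, 'o, 'x) variety \<Rightarrow> bool" where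
  "wf_variety \<Theta> \<longleftrightarrow>
     (\<forall>i. infinite {x \<in> vars \<Theta>. vsort \<Theta> x = i}) \<and>
     (\<forall>(Y, l, r) \<in> idents \<Theta>. Y \<in> Gamma0 \<Theta> \<and> (\<exists>i. wt \<Theta> Y l i \<and> wt \<Theta> Y r i))"

record ('s, 'o, 'a) alg =
  carr :: "'s \<Rightarrow> 'a set"
  opr :: "'o \<Rightarrow> 'a list \<Rightarrow> 'a"

definition tuples :: "('s \<Rightarrow> 'a set) \<Rightarrow> 's list \<Rightarrow> 'a list set" where
  "tuples A is = {as. list_all2 (\<lambda>a i. a \<in> A i) as is}"

definition is_alg :: "('s, 'o, 'x) variety \<Rightarrow> ('s, 'o, 'a) alg \<Rightarrow> bool" where
  "is_alg \<Theta> G \<longleftrightarrow>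
     (\<forall>\<omega>\<in>ops \<Theta>. \<forall>as\<in>tuples (carr G) (arity \<Theta> \<omega>). opr G \<omega> as \<in> carr G (rsort \<Theta> \<omega>))"

primrec trm_eval :: "('s, 'o, 'a) alg \<Rightarrow> ('x \<Rightarrow> 'a) \<Rightarrow> ('o, 'x) trm \<Rightarrow> 'a" where
  "trm_eval G \<rho> (Var x) = \<rho> x"
| "trm_eval G \<rho> (Op \<omega> ts) = opr G \<omega> (map (trm_eval G \<rho>) ts)"

definition in_variety :: "('s, 'o, 'x) variety \<Rightarrow> ('s, 'o, 'a) alg \<Rightarrow> bool" where
  "in_variety \<Theta> G \<longleftrightarrow> is_alg \<Theta> G \<and>
     (\<forall>(Y, l, r) \<in> idents \<Theta>. \<forall>\<rho>. (\<forall>y\<in>Y. \<rho> y \<in> carr G (vsort \<Theta> y)) \<longrightarrow>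
        trm_eval G \<rho> l = trm_eval G \<rho> r)"

definition finite_alg :: "('s, 'o, 'a) alg \<Rightarrow> bool" where
  "finite_alg G \<longleftrightarrow> (\<forall>i. finite (carr G i))"

text \<open>Homomorphisms are families of maps that are \<open>undefined\<close> off the carriers, so that equality of
  homomorphisms is equality of HOL functions.\<close>

definition Hom :: "('s, 'o, 'x) variety \<Rightarrow> ('s, 'o, 'a) alg \<Rightarrow> ('s, 'o, 'b) alg \<Rightarrow> ('s \<Rightarrow> 'a \<Rightarrow> 'b) set" where
  "Hom \<Theta> A B = {h. (\<forall>i. h i \<in> carr A i \<rightarrow>\<^sub>E carr B i) \<and>
     (\<forall>\<omega>\<in>ops \<Theta>. \<forall>as\<in>tuples (carr A) (arity \<Theta> \<omega>).
        h (rsort \<Theta> \<omega>) (opr A \<omega> as) = opr B \<omega> (map2 h (arity \<Theta> \<omega>) as))}"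

definition id_hom :: "('s, 'o, 'a) alg \<Rightarrow> 's \<Rightarrow> 'a \<Rightarrow> 'a" where
  "id_hom A = (\<lambda>i. restrict id (carr A i))"

definition comp_hom :: "('s, 'o, 'a) alg \<Rightarrow> ('s \<Rightarrow> 'b \<Rightarrow> 'c) \<Rightarrow> ('s \<Rightarrow> 'a \<Rightarrow> 'b) \<Rightarrow> 's \<Rightarrow> 'a \<Rightarrow> 'c" where
  "comp_hom A h g = (\<lambda>i. compose (carr A i) (h i) (g i))"


section \<open>The free algebras \<open>W(X)\<close>\<close>

primrec tsubst :: "('x \<Rightarrow> ('o, 'x) trm) \<Rightarrow> ('o, 'x) trm \<Rightarrow> ('o, 'x) trm" where
  "tsubst \<sigma> (Var x) = \<sigma> x"
| "tsubst \<sigma> (Op \<omega> ts) = Op \<omega> (map (tsubst \<sigma>) ts)"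

text \<open>Equational consequence of the identities, between terms over \<open>X\<close>.\<close>

inductive teq :: "('s, 'o, 'x) variety \<Rightarrow> 'x set \<Rightarrow> ('o, 'x) trm \<Rightarrow> ('o, 'x) trm \<Rightarrow> bool"
  for \<Theta> :: "('s, 'o, 'x) variety" and X :: "'x set" where
  teq_refl: "wt \<Theta> X t i \<Longrightarrow> teq \<Theta> X t t"
| teq_sym: "teq \<Theta> X t u \<Longrightarrow> teq \<Theta> X u t"
| teq_trans: "teq \<Theta> X t u \<Longrightarrow> teq \<Theta> X u v \<Longrightarrow> teq \<Theta> X t v"
| teq_cong: "\<omega> \<in> ops \<Theta> \<Longrightarrow> list_all2 (wt \<Theta> X) ts (arity \<Theta> \<omega>) \<Longrightarrow> list_all2 (teq \<Theta> X) ts us \<Longrightarrow>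
    teq \<Theta> X (Op \<omega> ts) (Op \<omega> us)"
| teq_ident: "(Y, l, r) \<in> idents \<Theta> \<Longrightarrow> (\<And>y. y \<in> Y \<Longrightarrow> wt \<Theta> X (\<sigma> y) (vsort \<Theta> y)) \<Longrightarrow>
    teq \<Theta> X (tsubst \<sigma> l) (tsubst \<sigma> r)"

definition tcls :: "('s, 'o, 'x) variety \<Rightarrow> 'x set \<Rightarrow> ('o, 'x) trm \<Rightarrow> ('o, 'x) trm set" where
  "tcls \<Theta> X t = {u. teq \<Theta> X t u}"

definition W :: "('s, 'o, 'x) variety \<Rightarrow> 'x set \<Rightarrow> ('s, 'o, ('o, 'x) trm set) alg" where
  "W \<Theta> X = \<lparr> carr = (\<lambda>i. {tcls \<Theta> X t | t. wt \<Theta> X t i}),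
             opr = (\<lambda>\<omega> ws. \<Union>ts\<in>listset ws. tcls \<Theta> X (Op \<omega> ts)) \<rparr>"

definition gen :: "('s, 'o, 'x) variety \<Rightarrow> 'x set \<Rightarrow> 'x \<Rightarrow> ('o, 'x) trm set" where
  "gen \<Theta> X x = tcls \<Theta> X (Var x)"

text \<open>A variable is outside the support of \<open>w\<close> iff \<open>w\<close> is represented by a term not containing it.\<close>

definition support :: "('o, 'x) trm set \<Rightarrow> 'x set" where
  "support w = (\<Inter>t\<in>w. tvars t)"

type_synonym ('s, 'o, 'x) sub = "'s \<Rightarrow> ('o, 'x) trm set \<Rightarrow> ('o, 'x) trm set"

definition subs :: "('s, 'o, 'x) variety \<Rightarrow> 'x set \<Rightarrow> 'x set \<Rightarrow> ('s, 'o, 'x) sub set" where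
  "subs \<Theta> X Y = Hom \<Theta> (W \<Theta> X) (W \<Theta> Y)"

definition app_var :: "('s, 'o, 'x) variety \<Rightarrow> 'x set \<Rightarrow> ('s \<Rightarrow> ('o, 'x) trm set \<Rightarrow> 'a) \<Rightarrow> 'x \<Rightarrow> 'a" where
  "app_var \<Theta> X h x = h (vsort \<Theta> x) (gen \<Theta> X x)"

definition is_single_sub :: "('s, 'o, 'x) variety \<Rightarrow> 'x set \<Rightarrow> 'x \<Rightarrow> ('o, 'x) trm set \<Rightarrow> ('s, 'o, 'x) sub \<Rightarrow> bool" where
  "is_single_sub \<Theta> X x w s \<longleftrightarrow> s \<in> subs \<Theta> X X \<and> app_var \<Theta> X s x = w \<and>
     (\<forall>y\<in>X. y \<noteq> x \<longrightarrow> app_var \<Theta> X s y = gen \<Theta> X y)"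


section \<open>Halmos algebras\<close>

text \<open>
  Structures in the signature of Halmos algebras, indexed by sets of variables.  The nullary operation
  \<open>w \<equiv> w'\<close> is \<open>heq H X i w w'\<close>, where \<open>i\<close> is the common sort of \<open>w\<close> and \<open>w'\<close>; the operation
  \<open>s\<^sub>*\<close> for \<open>s : W(X) \<rightarrow> W(Y)\<close> is \<open>hsub H X Y s\<close>.  The Boolean constants are part of the structure.
\<close>

record ('s, 'o, 'x, 'h) hal =
  hcarr :: "'x set \<Rightarrow> 'h set"
  hbot :: "'x set \<Rightarrow> 'h"
  htop :: "'x set \<Rightarrow> 'h"
  hjoin :: "'x set \<Rightarrow> 'h \<Rightarrow> 'h \<Rightarrow> 'h"
  hmeet :: "'x set \<Rightarrow> 'h \<Rightarrow> 'h \<Rightarrow> 'h"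
  hneg :: "'x set \<Rightarrow> 'h \<Rightarrow> 'h"
  hex :: "'x set \<Rightarrow> 'x \<Rightarrow> 'h \<Rightarrow> 'h"
  heq :: "'x set \<Rightarrow> 's \<Rightarrow> ('o, 'x) trm set \<Rightarrow> ('o, 'x) trm set \<Rightarrow> 'h"
  hsub :: "'x set \<Rightarrow> 'x set \<Rightarrow> ('s, 'o, 'x) sub \<Rightarrow> 'h \<Rightarrow> 'h"

definition hle :: "('s, 'o, 'x, 'h) hal \<Rightarrow> 'x set \<Rightarrow> 'h \<Rightarrow> 'h \<Rightarrow> bool" where
  "hle H X a b \<longleftrightarrow> hmeet H X a b = a"

definition closed_ops :: "('s, 'o, 'x) variety \<Rightarrow> ('s, 'o, 'x, 'h) hal \<Rightarrow> bool" where
  "closed_ops \<Theta> H \<longleftrightarrow> (\<forall>X\<in>Gamma0 \<Theta>.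
     hbot H X \<in> hcarr H X \<and> htop H X \<in> hcarr H X \<and>
     (\<forall>a\<in>hcarr H X. \<forall>b\<in>hcarr H X. hjoin H X a b \<in> hcarr H X \<and> hmeet H X a b \<in> hcarr H X) \<and>
     (\<forall>a\<in>hcarr H X. hneg H X a \<in> hcarr H X \<and> (\<forall>x\<in>X. hex H X x a \<in> hcarr H X)) \<and>
     (\<forall>i. \<forall>w\<in>carr (W \<Theta> X) i. \<forall>w'\<in>carr (W \<Theta> X) i. heq H X i w w' \<in> hcarr H X) \<and>
     (\<forall>Y\<in>Gamma0 \<Theta>. \<forall>s\<in>subs \<Theta> X Y. \<forall>a\<in>hcarr H X. hsub H X Y s a \<in> hcarr H Y))"

text \<open>Huntington's axioms, relativised to the carrier.\<close>

definition boolean_on :: "('s, 'o, 'x, 'h) hal \<Rightarrow> 'x set \<Rightarrow> bool" where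
  "boolean_on H X \<longleftrightarrow> (\<forall>a\<in>hcarr H X. \<forall>b\<in>hcarr H X. \<forall>c\<in>hcarr H X.
     hjoin H X a b = hjoin H X b a \<and> hmeet H X a b = hmeet H X b a \<and>
     hjoin H X a (hmeet H X b c) = hmeet H X (hjoin H X a b) (hjoin H X a c) \<and>
     hmeet H X a (hjoin H X b c) = hjoin H X (hmeet H X a b) (hmeet H X a c) \<and>
     hjoin H X a (hbot H X) = a \<and> hmeet H X a (htop H X) = a \<and>
     hjoin H X a (hneg H X a) = htop H X \<and> hmeet H X a (hneg H X a) = hbot H X)"

definition quantifiers_on :: "('s, 'o, 'x, 'h) hal \<Rightarrow> 'x set \<Rightarrow> bool" where
  "quantifiers_on H X \<longleftrightarrow> (\<forall>x\<in>X.
     hex H X x (hbot H X) = hbot H X \<and>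
     (\<forall>a\<in>hcarr H X. hle H X a (hex H X x a)) \<and>
     (\<forall>a\<in>hcarr H X. \<forall>b\<in>hcarr H X.
        hex H X x (hmeet H X a (hex H X x b)) = hmeet H X (hex H X x a) (hex H X x b)) \<and>
     (\<forall>y\<in>X. \<forall>a\<in>hcarr H X. hex H X x (hex H X y a) = hex H X y (hex H X x a)))"

definition equalities_on :: "('s, 'o, 'x) variety \<Rightarrow> ('s, 'o, 'x, 'h) hal \<Rightarrow> 'x set \<Rightarrow> bool" where
  "equalities_on \<Theta> H X \<longleftrightarrow>
     (\<forall>i. \<forall>w\<in>carr (W \<Theta> X) i. heq H X i w w = htop H X) \<and>
     (\<forall>\<omega>\<in>ops \<Theta>. \<forall>ws\<in>tuples (carr (W \<Theta> X)) (arity \<Theta> \<omega>). \<forall>ws'\<in>tuples (carr (W \<Theta> X)) (arity \<Theta> \<omega>).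
        hle H X
          (foldr (hmeet H X) (map (\<lambda>(i, w, w'). heq H X i w w') (zip (arity \<Theta> \<omega>) (zip ws ws'))) (htop H X))
          (heq H X (rsort \<Theta> \<omega>) (opr (W \<Theta> X) \<omega> ws) (opr (W \<Theta> X) \<omega> ws')))"

definition halmos_algebra :: "('s, 'o, 'x) variety \<Rightarrow> ('s, 'o, 'x, 'h) hal \<Rightarrow> bool" where
  "halmos_algebra \<Theta> H \<longleftrightarrow> closed_ops \<Theta> H \<and>
   (\<forall>X\<in>Gamma0 \<Theta>. boolean_on H X \<and> quantifiers_on H X \<and> equalities_on \<Theta> H X) \<and>
   \<comment> \<open>\<open>s\<^sub>*\<close> is functorial\<close>
   (\<forall>X\<in>Gamma0 \<Theta>. \<forall>a\<in>hcarr H X. hsub H X X (id_hom (W \<Theta> X)) a = a) \<and>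
   (\<forall>X\<in>Gamma0 \<Theta>. \<forall>Y\<in>Gamma0 \<Theta>. \<forall>Z\<in>Gamma0 \<Theta>. \<forall>s\<in>subs \<Theta> X Y. \<forall>t\<in>subs \<Theta> Y Z. \<forall>a\<in>hcarr H X.
      hsub H X Z (comp_hom (W \<Theta> X) t s) a = hsub H Y Z t (hsub H X Y s a)) \<and>
   \<comment> \<open>\<open>s\<^sub>*\<close> is a Boolean homomorphism\<close>
   (\<forall>X\<in>Gamma0 \<Theta>. \<forall>Y\<in>Gamma0 \<Theta>. \<forall>s\<in>subs \<Theta> X Y.
      hsub H X Y s (hbot H X) = hbot H Y \<and> hsub H X Y s (htop H X) = htop H Y \<and>
      (\<forall>a\<in>hcarr H X. hsub H X Y s (hneg H X a) = hneg H Y (hsub H X Y s a) \<and>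
        (\<forall>b\<in>hcarr H X.
           hsub H X Y s (hjoin H X a b) = hjoin H Y (hsub H X Y s a) (hsub H X Y s b) \<and>
           hsub H X Y s (hmeet H X a b) = hmeet H Y (hsub H X Y s a) (hsub H X Y s b)))) \<and>
   \<comment> \<open>\<open>s\<^sub>*\<close> and quantifiers\<close>
   (\<forall>X\<in>Gamma0 \<Theta>. \<forall>Y\<in>Gamma0 \<Theta>. \<forall>s\<^sub>1\<in>subs \<Theta> X Y. \<forall>s\<^sub>2\<in>subs \<Theta> X Y. \<forall>x\<in>X. \<forall>a\<in>hcarr H X.
      (\<forall>y\<in>X. y \<noteq> x \<longrightarrow> app_var \<Theta> X s\<^sub>1 y = app_var \<Theta> X s\<^sub>2 y) \<longrightarrow>
      hsub H X Y s\<^sub>1 (hex H X x a) = hsub H X Y s\<^sub>2 (hex H X x a)) \<and>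
   (\<forall>X\<in>Gamma0 \<Theta>. \<forall>Y\<in>Gamma0 \<Theta>. \<forall>s\<in>subs \<Theta> X Y. \<forall>x\<in>X. \<forall>y\<in>Y. \<forall>a\<in>hcarr H X.
      vsort \<Theta> y = vsort \<Theta> x \<and> app_var \<Theta> X s x = gen \<Theta> Y y \<and>
      (\<forall>x'\<in>X. x' \<noteq> x \<longrightarrow> y \<notin> support (app_var \<Theta> X s x')) \<longrightarrow>
      hsub H X Y s (hex H X x a) = hex H Y y (hsub H X Y s a)) \<and>
   \<comment> \<open>\<open>s\<^sub>*\<close> and equalities\<close>
   (\<forall>X\<in>Gamma0 \<Theta>. \<forall>Y\<in>Gamma0 \<Theta>. \<forall>s\<in>subs \<Theta> X Y. \<forall>i. \<forall>w\<in>carr (W \<Theta> X) i. \<forall>w'\<in>carr (W \<Theta> X) i.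
      hsub H X Y s (heq H X i w w') = heq H Y i (s i w) (s i w')) \<and>
   (\<forall>X\<in>Gamma0 \<Theta>. \<forall>x\<in>X. \<forall>w\<in>carr (W \<Theta> X) (vsort \<Theta> x). \<forall>w'\<in>carr (W \<Theta> X) (vsort \<Theta> x).
      \<forall>s s'. is_single_sub \<Theta> X x w s \<and> is_single_sub \<Theta> X x w' s' \<longrightarrow>
      (\<forall>a\<in>hcarr H X. hle H X (hmeet H X (hsub H X X s a) (heq H X (vsort \<Theta> x) w w')) (hsub H X X s' a)))"

definition hal_hom :: "('s, 'o, 'x) variety \<Rightarrow> ('s, 'o, 'x, 'h) hal \<Rightarrow> ('s, 'o, 'x, 'k) hal \<Rightarrow>
    ('x set \<Rightarrow> 'h \<Rightarrow> 'k) \<Rightarrow> bool" where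
  "hal_hom \<Theta> H K \<beta> \<longleftrightarrow> (\<forall>X\<in>Gamma0 \<Theta>.
     \<beta> X \<in> hcarr H X \<rightarrow> hcarr K X \<and>
     \<beta> X (hbot H X) = hbot K X \<and> \<beta> X (htop H X) = htop K X \<and>
     (\<forall>a\<in>hcarr H X. \<forall>b\<in>hcarr H X.
        \<beta> X (hjoin H X a b) = hjoin K X (\<beta> X a) (\<beta> X b) \<and>
        \<beta> X (hmeet H X a b) = hmeet K X (\<beta> X a) (\<beta> X b)) \<and>
     (\<forall>a\<in>hcarr H X. \<beta> X (hneg H X a) = hneg K X (\<beta> X a) \<and>
        (\<forall>x\<in>X. \<beta> X (hex H X x a) = hex K X x (\<beta> X a))) \<and>
     (\<forall>i. \<forall>w\<in>carr (W \<Theta> X) i. \<forall>w'\<in>carr (W \<Theta> X) i. \<beta> X (heq H X i w w') = heq K X i w w') \<and>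
     (\<forall>Y\<in>Gamma0 \<Theta>. \<forall>s\<in>subs \<Theta> X Y. \<forall>a\<in>hcarr H X. \<beta> Y (hsub H X Y s a) = hsub K X Y s (\<beta> X a)))"

definition hal_iso :: "('s, 'o, 'x) variety \<Rightarrow> ('s, 'o, 'x, 'h) hal \<Rightarrow> ('s, 'o, 'x, 'k) hal \<Rightarrow>
    ('x set \<Rightarrow> 'h \<Rightarrow> 'k) \<Rightarrow> bool" where
  "hal_iso \<Theta> H K \<gamma> \<longleftrightarrow> hal_hom \<Theta> H K \<gamma> \<and> (\<forall>X\<in>Gamma0 \<Theta>. bij_betw (\<gamma> X) (hcarr H X) (hcarr K X))"


section \<open>The algebra \<open>Hal\<^sub>\<Theta>(G)\<close>\<close>

type_synonym ('s, 'o, 'x, 'a) point = "'s \<Rightarrow> ('o, 'x) trm set \<Rightarrow> 'a"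

definition points :: "('s, 'o, 'x) variety \<Rightarrow> ('s, 'o, 'a) alg \<Rightarrow> 'x set \<Rightarrow> ('s, 'o, 'x, 'a) point set" where
  "points \<Theta> G X = Hom \<Theta> (W \<Theta> X) G"

definition HalG :: "('s, 'o, 'x) variety \<Rightarrow> ('s, 'o, 'a) alg \<Rightarrow>
    ('s, 'o, 'x, ('s, 'o, 'x, 'a) point set) hal" where
  "HalG \<Theta> G = \<lparr>
     hcarr = (\<lambda>X. Pow (points \<Theta> G X)),
     hbot = (\<lambda>X. {}),
     htop = (\<lambda>X. points \<Theta> G X),
     hjoin = (\<lambda>X A B. A \<union> B),
     hmeet = (\<lambda>X A B. A \<inter> B),
     hneg = (\<lambda>X A. points \<Theta> G X - A),
     hex = (\<lambda>X x A. {\<mu> \<in> points \<Theta> G X. \<exists>\<nu>\<in>A. \<forall>y\<in>X. y \<noteq> x \<longrightarrow> app_var \<Theta> X \<mu> y = app_var \<Theta> X \<nu> y}),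
     heq = (\<lambda>X i w w'. {\<mu> \<in> points \<Theta> G X. \<mu> i w = \<mu> i w'}),
     hsub = (\<lambda>X Y s A. {\<nu> \<in> points \<Theta> G Y. comp_hom (W \<Theta> X) \<nu> s \<in> A}) \<rparr>"


section \<open>The algebra \<open>Hal\<^sub>\<Theta>(\<Phi>)\<close>\<close>

record ('p, 's) rels =
  syms :: "'p set"
  rtype :: "'p \<Rightarrow> 's list"

text \<open>
  Terms in the signature of Halmos algebras over the atomic formulas.  Their sort \<open>X\<close> is an argument of
  \<open>wff\<close>; \<open>Sub X s u\<close> stands for \<open>s\<^sub>* u\<close> with \<open>u\<close> of sort \<open>X\<close>.
\<close>

datatype ('s, 'o, 'x, 'p) fm =
    Atom 'p "('o, 'x) trm set list"
  | Bot
  | Top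
  | Or "('s, 'o, 'x, 'p) fm" "('s, 'o, 'x, 'p) fm"
  | And "('s, 'o, 'x, 'p) fm" "('s, 'o, 'x, 'p) fm"
  | Neg "('s, 'o, 'x, 'p) fm"
  | Ex 'x "('s, 'o, 'x, 'p) fm"
  | Eq 's "('o, 'x) trm set" "('o, 'x) trm set"
  | Sub "'x set" "'s \<Rightarrow> ('o, 'x) trm set \<Rightarrow> ('o, 'x) trm set" "('s, 'o, 'x, 'p) fm"

inductive wff :: "('s, 'o, 'x) variety \<Rightarrow> ('p, 's) rels \<Rightarrow> 'x set \<Rightarrow> ('s, 'o, 'x, 'p) fm \<Rightarrow> bool"
  for \<Theta> :: "('s, 'o, 'x) variety" and \<Phi> :: "('p, 's) rels" where
  wff_Atom: "\<phi> \<in> syms \<Phi> \<Longrightarrow> ws \<in> tuples (carr (W \<Theta> X)) (rtype \<Phi> \<phi>) \<Longrightarrow> wff \<Theta> \<Phi> X (Atom \<phi> ws)"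
| wff_Bot: "wff \<Theta> \<Phi> X Bot"
| wff_Top: "wff \<Theta> \<Phi> X Top"
| wff_Or: "wff \<Theta> \<Phi> X u \<Longrightarrow> wff \<Theta> \<Phi> X v \<Longrightarrow> wff \<Theta> \<Phi> X (Or u v)"
| wff_And: "wff \<Theta> \<Phi> X u \<Longrightarrow> wff \<Theta> \<Phi> X v \<Longrightarrow> wff \<Theta> \<Phi> X (And u v)"
| wff_Neg: "wff \<Theta> \<Phi> X u \<Longrightarrow> wff \<Theta> \<Phi> X (Neg u)"
| wff_Ex: "x \<in> X \<Longrightarrow> wff \<Theta> \<Phi> X u \<Longrightarrow> wff \<Theta> \<Phi> X (Ex x u)"
| wff_Eq: "w \<in> carr (W \<Theta> X) i \<Longrightarrow> w' \<in> carr (W \<Theta> X) i \<Longrightarrow> wff \<Theta> \<Phi> X (Eq i w w')"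
| wff_Sub: "X \<in> Gamma0 \<Theta> \<Longrightarrow> s \<in> subs \<Theta> X Y \<Longrightarrow> wff \<Theta> \<Phi> X u \<Longrightarrow> wff \<Theta> \<Phi> Y (Sub X s u)"

definition fm_alg :: "('s, 'o, 'x) variety \<Rightarrow> ('p, 's) rels \<Rightarrow> ('s, 'o, 'x, ('s, 'o, 'x, 'p) fm) hal" where
  "fm_alg \<Theta> \<Phi> = \<lparr>
     hcarr = (\<lambda>X. {u. wff \<Theta> \<Phi> X u}),
     hbot = (\<lambda>X. Bot), htop = (\<lambda>X. Top),
     hjoin = (\<lambda>X. Or), hmeet = (\<lambda>X. And), hneg = (\<lambda>X. Neg),
     hex = (\<lambda>X. Ex), heq = (\<lambda>X. Eq),
     hsub = (\<lambda>X Y. Sub X) \<rparr>"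

definition hal_congruence :: "('s, 'o, 'x) variety \<Rightarrow> ('s, 'o, 'x, 'h) hal \<Rightarrow> ('x set \<Rightarrow> ('h \<times> 'h) set) \<Rightarrow> bool" where
  "hal_congruence \<Theta> H R \<longleftrightarrow> (\<forall>X\<in>Gamma0 \<Theta>.
     equiv (hcarr H X) (R X) \<and>
     (\<forall>(a, a')\<in>R X. \<forall>(b, b')\<in>R X.
        (hjoin H X a b, hjoin H X a' b') \<in> R X \<and> (hmeet H X a b, hmeet H X a' b') \<in> R X) \<and>
     (\<forall>(a, a')\<in>R X. (hneg H X a, hneg H X a') \<in> R X \<and>
        (\<forall>x\<in>X. (hex H X x a, hex H X x a') \<in> R X) \<and>
        (\<forall>Y\<in>Gamma0 \<Theta>. \<forall>s\<in>subs \<Theta> X Y. (hsub H X Y s a, hsub H X Y s a') \<in> R Y)))"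

definition hal_quot :: "('s, 'o, 'x, 'h) hal \<Rightarrow> ('x set \<Rightarrow> ('h \<times> 'h) set) \<Rightarrow> ('s, 'o, 'x, 'h set) hal" where
  "hal_quot H R = \<lparr>
     hcarr = (\<lambda>X. hcarr H X // R X),
     hbot = (\<lambda>X. R X `` {hbot H X}),
     htop = (\<lambda>X. R X `` {htop H X}),
     hjoin = (\<lambda>X A B. \<Union>a\<in>A. \<Union>b\<in>B. R X `` {hjoin H X a b}),
     hmeet = (\<lambda>X A B. \<Union>a\<in>A. \<Union>b\<in>B. R X `` {hmeet H X a b}),
     hneg = (\<lambda>X A. \<Union>a\<in>A. R X `` {hneg H X a}),
     hex = (\<lambda>X x A. \<Union>a\<in>A. R X `` {hex H X x a}),
     heq = (\<lambda>X i w w'. R X `` {heq H X i w w'}),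
     hsub = (\<lambda>X Y s A. \<Union>a\<in>A. R Y `` {hsub H X Y s a}) \<rparr>"

text \<open>
  Passing to the free algebra of \<open>Hal\<^sub>\<Theta>\<close> and then factoring by \<open>s\<^sub>* \<phi>(w\<^sub>1, \<dots>, w\<^sub>n) = \<phi>(s w\<^sub>1, \<dots>, s w\<^sub>n)\<close>
  amounts to dividing the term structure by the least congruence that contains these relations and whose
  quotient is a Halmos algebra.
\<close>

definition fm_cong :: "('s, 'o, 'x) variety \<Rightarrow> ('p, 's) rels \<Rightarrow> 'x set \<Rightarrow>
    (('s, 'o, 'x, 'p) fm \<times> ('s, 'o, 'x, 'p) fm) set" where
  "fm_cong \<Theta> \<Phi> X = \<Inter> {R X | R.
     hal_congruence \<Theta> (fm_alg \<Theta> \<Phi>) R \<and> halmos_algebra \<Theta> (hal_quot (fm_alg \<Theta> \<Phi>) R) \<and>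
     (\<forall>Y\<in>Gamma0 \<Theta>. \<forall>Z\<in>Gamma0 \<Theta>. \<forall>s\<in>subs \<Theta> Y Z. \<forall>\<phi>\<in>syms \<Phi>. \<forall>ws\<in>tuples (carr (W \<Theta> Y)) (rtype \<Phi> \<phi>).
        (Sub Y s (Atom \<phi> ws), Atom \<phi> (map2 s (rtype \<Phi> \<phi>) ws)) \<in> R Z)}"

definition Hal\<Phi> :: "('s, 'o, 'x) variety \<Rightarrow> ('p, 's) rels \<Rightarrow> ('s, 'o, 'x, ('s, 'o, 'x, 'p) fm set) hal" where
  "Hal\<Phi> \<Theta> \<Phi> = hal_quot (fm_alg \<Theta> \<Phi>) (fm_cong \<Theta> \<Phi>)"


section \<open>Multi-models and values of formulas\<close>

definition interps :: "('s, 'o, 'a) alg \<Rightarrow> ('p, 's) rels \<Rightarrow> ('p \<Rightarrow> 'a list set) set" where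
  "interps G \<Phi> = (\<Pi>\<^sub>E \<phi>\<in>syms \<Phi>. Pow (tuples (carr G) (rtype \<Phi> \<phi>)))"

record ('s, 'o, 'a, 'p) multi_model =
  mm_alg :: "('s, 'o, 'a) alg"
  mm_rels :: "('p, 's) rels"
  mm_ints :: "('p \<Rightarrow> 'a list set) set"

definition is_multi_model :: "('s, 'o, 'x) variety \<Rightarrow> ('s, 'o, 'a, 'p) multi_model \<Rightarrow> bool" where
  "is_multi_model \<Theta> M \<longleftrightarrow>
     in_variety \<Theta> (mm_alg M) \<and> mm_ints M \<subseteq> interps (mm_alg M) (mm_rels M)"

primrec fm_eval :: "('s, 'o, 'x, 'h) hal \<Rightarrow> ('x set \<Rightarrow> 'p \<Rightarrow> ('o, 'x) trm set list \<Rightarrow> 'h) \<Rightarrow>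
    ('s, 'o, 'x, 'p) fm \<Rightarrow> 'x set \<Rightarrow> 'h" where
  "fm_eval H a (Atom \<phi> ws) X = a X \<phi> ws"
| "fm_eval H a Bot X = hbot H X"
| "fm_eval H a Top X = htop H X"
| "fm_eval H a (Or u v) X = hjoin H X (fm_eval H a u X) (fm_eval H a v X)"
| "fm_eval H a (And u v) X = hmeet H X (fm_eval H a u X) (fm_eval H a v X)"
| "fm_eval H a (Neg u) X = hneg H X (fm_eval H a u X)"
| "fm_eval H a (Ex x u) X = hex H X x (fm_eval H a u X)"
| "fm_eval H a (Eq i w w') X = heq H X i w w'"
| "fm_eval H a (Sub Y s u) X = hsub H Y X s (fm_eval H a u Y)"

definition atom_val :: "('s, 'o, 'x) variety \<Rightarrow> ('s, 'o, 'a) alg \<Rightarrow> ('p, 's) rels \<Rightarrow> ('p \<Rightarrow> 'a list set) \<Rightarrow>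
    'x set \<Rightarrow> 'p \<Rightarrow> ('o, 'x) trm set list \<Rightarrow> ('s, 'o, 'x, 'a) point set" where
  "atom_val \<Theta> G \<Phi> f X \<phi> ws = {\<mu> \<in> points \<Theta> G X. map2 \<mu> (rtype \<Phi> \<phi>) ws \<in> f \<phi>}"

text \<open>All representatives of a formula have the same value, so the image below is a singleton.\<close>

definition Val :: "('s, 'o, 'x) variety \<Rightarrow> ('s, 'o, 'a, 'p) multi_model \<Rightarrow> ('p \<Rightarrow> 'a list set) \<Rightarrow>
    'x set \<Rightarrow> ('s, 'o, 'x, 'p) fm set \<Rightarrow> ('s, 'o, 'x, 'a) point set" where
  "Val \<Theta> M f X U = the_elem
     ((\<lambda>u. fm_eval (HalG \<Theta> (mm_alg M)) (atom_val \<Theta> (mm_alg M) (mm_rels M) f) u X) ` U)"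

definition R_alg :: "('s, 'o, 'x) variety \<Rightarrow> ('s, 'o, 'a, 'p) multi_model \<Rightarrow> ('p \<Rightarrow> 'a list set) \<Rightarrow>
    ('s, 'o, 'x, ('s, 'o, 'x, 'a) point set) hal" where
  "R_alg \<Theta> M f = (HalG \<Theta> (mm_alg M))
     \<lparr> hcarr := (\<lambda>X. Val \<Theta> M f X ` hcarr (Hal\<Phi> \<Theta> (mm_rels M)) X) \<rparr>"

definition sol :: "('s, 'o, 'x) variety \<Rightarrow> ('s, 'o, 'a, 'p) multi_model \<Rightarrow> ('p \<Rightarrow> 'a list set) \<Rightarrow>
    'x set \<Rightarrow> ('s, 'o, 'x, 'p) fm set set \<Rightarrow> ('s, 'o, 'x, 'a) point set" where
  "sol \<Theta> M f X T = {\<mu> \<in> points \<Theta> (mm_alg M) X. \<forall>U\<in>T. \<mu> \<in> Val \<Theta> M f X U}"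


section \<open>Categories\<close>

record ('ob, 'ar) cat =
  Ob :: "'ob set"
  Ar :: "'ar set"
  Dom :: "'ar \<Rightarrow> 'ob"
  Cod :: "'ar \<Rightarrow> 'ob"
  Id :: "'ob \<Rightarrow> 'ar"
  Comp :: "'ar \<Rightarrow> 'ar \<Rightarrow> 'ar"  \<comment> \<open>\<open>Comp C g f\<close> is \<open>g\<close> after \<open>f\<close>\<close>

record ('ob, 'ar, 'ob2, 'ar2) ftr =
  fob :: "'ob \<Rightarrow> 'ob2"
  far :: "'ar \<Rightarrow> 'ar2"

definition is_functor :: "('ob, 'ar) cat \<Rightarrow> ('ob2, 'ar2) cat \<Rightarrow> ('ob, 'ar, 'ob2, 'ar2) ftr \<Rightarrow> bool" where
  "is_functor C D F \<longleftrightarrow>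
     (\<forall>a\<in>Ob C. fob F a \<in> Ob D \<and> far F (Id C a) = Id D (fob F a)) \<and>
     (\<forall>f\<in>Ar C. far F f \<in> Ar D \<and> Dom D (far F f) = fob F (Dom C f) \<and> Cod D (far F f) = fob F (Cod C f)) \<and>
     (\<forall>f\<in>Ar C. \<forall>g\<in>Ar C. Dom C g = Cod C f \<longrightarrow> far F (Comp C g f) = Comp D (far F g) (far F f))"

definition ftr_id :: "('ob, 'ar, 'ob, 'ar) ftr" where
  "ftr_id = \<lparr> fob = id, far = id \<rparr>"

definition ftr_comp :: "('ob2, 'ar2, 'ob3, 'ar3) ftr \<Rightarrow> ('ob, 'ar, 'ob2, 'ar2) ftr \<Rightarrow> ('ob, 'ar, 'ob3, 'ar3) ftr" where
  "ftr_comp F E = \<lparr> fob = fob F \<circ> fob E, far = far F \<circ> far E \<rparr>"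

text \<open>Equality of (co- or contravariant) functors with source \<open>C\<close>.\<close>

definition ftr_eq :: "('ob, 'ar) cat \<Rightarrow> ('ob, 'ar, 'ob2, 'ar2) ftr \<Rightarrow> ('ob, 'ar, 'ob2, 'ar2) ftr \<Rightarrow> bool" where
  "ftr_eq C E F \<longleftrightarrow> (\<forall>a\<in>Ob C. fob E a = fob F a) \<and> (\<forall>f\<in>Ar C. far E f = far F f)"

definition inverse_functors :: "('ob, 'ar) cat \<Rightarrow> ('ob2, 'ar2) cat \<Rightarrow> ('ob, 'ar, 'ob2, 'ar2) ftr \<Rightarrow>
    ('ob2, 'ar2, 'ob, 'ar) ftr \<Rightarrow> bool" where
  "inverse_functors C D F E \<longleftrightarrow> is_functor C D F \<and> is_functor D C E \<and>
     ftr_eq C (ftr_comp E F) ftr_id \<and> ftr_eq D (ftr_comp F E) ftr_id"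


section \<open>Knowledge bases and informational equivalence\<close>

type_synonym ('s, 'o, 'x, 'p) Lob = "'x set \<times> ('s, 'o, 'x, 'p) fm set set"
type_synonym ('s, 'o, 'x, 'p) Lar = "('s, 'o, 'x, 'p) Lob \<times> ('s, 'o, 'x) sub \<times> ('s, 'o, 'x, 'p) Lob"
type_synonym ('s, 'o, 'x, 'a) Kob = "'x set \<times> ('s, 'o, 'x, 'a) point set"
type_synonym ('s, 'o, 'x, 'a) Kar = "('s, 'o, 'x, 'a) Kob \<times>
    (('s, 'o, 'x, 'a) point \<Rightarrow> ('s, 'o, 'x, 'a) point) \<times> ('s, 'o, 'x, 'a) Kob"

definition L_cat :: "('s, 'o, 'x) variety \<Rightarrow> ('p, 's) rels \<Rightarrow>
    (('s, 'o, 'x, 'p) Lob, ('s, 'o, 'x, 'p) Lar) cat" where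
  "L_cat \<Theta> \<Phi> = (let Obs = {(X, T). X \<in> Gamma0 \<Theta> \<and> T \<subseteq> hcarr (Hal\<Phi> \<Theta> \<Phi>) X} in \<lparr>
     Ob = Obs,
     Ar = {((X, T\<^sub>1), s, (Y, T\<^sub>2)) | X T\<^sub>1 s Y T\<^sub>2.
             (X, T\<^sub>1) \<in> Obs \<and> (Y, T\<^sub>2) \<in> Obs \<and> s \<in> subs \<Theta> X Y \<and>
             (\<forall>u\<in>T\<^sub>1. hsub (Hal\<Phi> \<Theta> \<Phi>) X Y s u \<in> T\<^sub>2)},
     Dom = (\<lambda>(a, s, b). a),
     Cod = (\<lambda>(a, s, b). b),
     Id = (\<lambda>(X, T). ((X, T), id_hom (W \<Theta> X), (X, T))),
     Comp = (\<lambda>(b, t, c) (a, s, b'). (a, comp_hom (W \<Theta> (fst a)) t s, c)) \<rparr>)"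

text \<open>For \<open>s : W(Y) \<rightarrow> W(X)\<close> and a set \<open>A\<close> of points over \<open>X\<close>, \<open>pull \<Theta> Y A s\<close> is the map \<open>[s]\<close> on \<open>A\<close>.\<close>

definition pull :: "('s, 'o, 'x) variety \<Rightarrow> 'x set \<Rightarrow> ('s, 'o, 'x, 'a) point set \<Rightarrow> ('s, 'o, 'x) sub \<Rightarrow>
    ('s, 'o, 'x, 'a) point \<Rightarrow> ('s, 'o, 'x, 'a) point" where
  "pull \<Theta> Y A s = (\<lambda>\<nu>\<in>A. comp_hom (W \<Theta> Y) \<nu> s)"

definition K_cat :: "('s, 'o, 'x) variety \<Rightarrow> ('s, 'o, 'a, 'p) multi_model \<Rightarrow> ('p \<Rightarrow> 'a list set) \<Rightarrow>
    (('s, 'o, 'x, 'a) Kob, ('s, 'o, 'x, 'a) Kar) cat" where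
  "K_cat \<Theta> M f = (let Obs = {(X, sol \<Theta> M f X T) | X T. (X, T) \<in> Ob (L_cat \<Theta> (mm_rels M))} in \<lparr>
     Ob = Obs,
     Ar = {((X, A), pull \<Theta> Y A s, (Y, B)) | X A s Y B.
             (X, A) \<in> Obs \<and> (Y, B) \<in> Obs \<and> s \<in> subs \<Theta> Y X \<and>
             (\<forall>\<nu>\<in>A. comp_hom (W \<Theta> Y) \<nu> s \<in> B)},
     Dom = (\<lambda>(a, g, b). a),
     Cod = (\<lambda>(a, g, b). b),
     Id = (\<lambda>(X, A). ((X, A), restrict id A, (X, A))),
     Comp = (\<lambda>(b, h, c) (a, g, b'). (a, compose (snd a) h g, c)) \<rparr>)"

definition Ct :: "('s, 'o, 'x) variety \<Rightarrow> ('s, 'o, 'a, 'p) multi_model \<Rightarrow> ('p \<Rightarrow> 'a list set) \<Rightarrow>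
    (('s, 'o, 'x, 'p) Lob, ('s, 'o, 'x, 'p) Lar, ('s, 'o, 'x, 'a) Kob, ('s, 'o, 'x, 'a) Kar) ftr" where
  "Ct \<Theta> M f = \<lparr>
     fob = (\<lambda>(X, T). (X, sol \<Theta> M f X T)),
     far = (\<lambda>((X, T\<^sub>1), s, (Y, T\<^sub>2)).
              ((Y, sol \<Theta> M f Y T\<^sub>2), pull \<Theta> X (sol \<Theta> M f Y T\<^sub>2) s, (X, sol \<Theta> M f X T\<^sub>1))) \<rparr>"

definition lift_hom :: "('x set \<Rightarrow> ('s, 'o, 'x, 'p) fm set \<Rightarrow> ('s, 'o, 'x, 'q) fm set) \<Rightarrow>
    (('s, 'o, 'x, 'p) Lob, ('s, 'o, 'x, 'p) Lar, ('s, 'o, 'x, 'q) Lob, ('s, 'o, 'x, 'q) Lar) ftr" where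
  "lift_hom \<beta> = \<lparr>
     fob = (\<lambda>(X, T). (X, \<beta> X ` T)),
     far = (\<lambda>((X, T\<^sub>1), s, (Y, T\<^sub>2)). ((X, \<beta> X ` T\<^sub>1), s, (Y, \<beta> Y ` T\<^sub>2))) \<rparr>"

text \<open>Informational equivalence of the knowledge bases of two multi-models.\<close>

definition kb_equivalent :: "('s, 'o, 'x) variety \<Rightarrow> ('s, 'o, 'a, 'p) multi_model \<Rightarrow>
    ('s, 'o, 'b, 'q) multi_model \<Rightarrow> bool" where
  "kb_equivalent \<Theta> M\<^sub>1 M\<^sub>2 \<longleftrightarrow> (\<exists>\<alpha>. bij_betw \<alpha> (mm_ints M\<^sub>1) (mm_ints M\<^sub>2) \<and>
     (\<forall>f\<in>mm_ints M\<^sub>1. \<exists>\<beta> \<beta>' \<gamma> \<gamma>'.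
        hal_hom \<Theta> (Hal\<Phi> \<Theta> (mm_rels M\<^sub>1)) (Hal\<Phi> \<Theta> (mm_rels M\<^sub>2)) \<beta> \<and>
        hal_hom \<Theta> (Hal\<Phi> \<Theta> (mm_rels M\<^sub>2)) (Hal\<Phi> \<Theta> (mm_rels M\<^sub>1)) \<beta>' \<and>
        inverse_functors (K_cat \<Theta> M\<^sub>1 f) (K_cat \<Theta> M\<^sub>2 (\<alpha> f)) \<gamma> \<gamma>' \<and>
        ftr_eq (L_cat \<Theta> (mm_rels M\<^sub>1))
          (ftr_comp \<gamma> (Ct \<Theta> M\<^sub>1 f)) (ftr_comp (Ct \<Theta> M\<^sub>2 (\<alpha> f)) (lift_hom \<beta>)) \<and>
        ftr_eq (L_cat \<Theta> (mm_rels M\<^sub>2))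
          (ftr_comp \<gamma>' (Ct \<Theta> M\<^sub>2 (\<alpha> f))) (ftr_comp (Ct \<Theta> M\<^sub>1 f) (lift_hom \<beta>'))))"

end

theory Submission
  imports Defs
begin

text \<open>
  Why the theorem holds.  Fix \<open>f\<close> and its partner \<open>f'\<close>, an interpretation in the second model.  An isomorphism
  of categories \<open>K(f) \<rightarrow> K(f')\<close> that is compatible with a homomorphism \<open>\<beta>\<close> of formulas sends
  \<open>(X, Val\<^sub>f u)\<close>, the content of the one-element description \<open>{u}\<close>, to \<open>(X, Val\<^sub>f\<^sub>' (\<beta> u))\<close>.  On objects it is
  therefore a well-defined injective map \<open>Val\<^sub>f u \<mapsto> Val\<^sub>f\<^sub>' (\<beta> u)\<close> between the algebras of values; it is a
  homomorphism because \<open>\<beta>\<close> and the two value maps are, and the inverse functor makes it surjective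
  (\<open>hal_iso_of_K_isomorphism\<close>).

  Conversely, let \<open>\<gamma>\<close> be an isomorphism between the algebras of values.  Two things have to be produced.

  The homomorphism \<open>\<beta>\<close> with \<open>Val\<^sub>f\<^sub>' \<circ> \<beta> = \<gamma> \<circ> Val\<^sub>f\<close> exists because algebras of formulas are projective
  (\<open>Hal\<Phi>_projective\<close>): each relation symbol contributes one free generator, its atom over distinct
  variables, and these exist since every sort has infinitely many variables.

  The isomorphism of categories sends \<open>(X, A)\<close> to \<open>(X, \<gamma> A)\<close>.  In a finite model every \<open>T\<^sup>f\<close> is an
  intersection of finitely many values and hence itself a value, so that \<open>\<gamma>\<close> applies to it and sends it to
  the content of the image of \<open>T\<close> under \<open>\<beta>\<close> (\<open>sol_in_R_alg\<close>).  That \<open>s\<close> induces a mapping \<open>A \<rightarrow> B\<close> is the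
  inclusion \<open>A \<subseteq> s\<^sub>* B\<close>, and that \<open>s\<close> and \<open>s'\<close> induce the same mapping on \<open>A\<close> says that \<open>A \<subseteq> (s y \<equiv> s' y)\<close>
  for all variables \<open>y\<close>; both are preserved by \<open>\<gamma>\<close>, so the assignment \<open>[s] \<mapsto> [s]\<close> on morphisms is
  well-defined and functorial (\<open>iso_arrow_iff\<close>, \<open>iso_pull_eq_iff\<close>).

  Both directions rest on the value maps being well-defined homomorphisms, and the second also on
  algebras of formulas being Halmos algebras.  The former follows from the universal property of the algebra of
  formulas (\<open>Hal\<Phi>_induced\<close>) once all subsets of the sets of points are known to form a Halmos algebra
  (\<open>halmos_HalG\<close>), which in turn uses that the algebras \<open>W(X)\<close> are free in the variety; the latter holds
  because the Halmos axioms are identities (\<open>halmos_algebra_subdirect\<close>).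
\<close>

section \<open>The free algebras of a variety\<close>

lemma wt_VarE: "wt \<Theta> X (Var x) i \<Longrightarrow> x \<in> X \<and> i = vsort \<Theta> x"
  by (auto elim: wt.cases)

lemma wt_OpE:
  "wt \<Theta> X (Op \<omega> ts) i \<Longrightarrow> \<omega> \<in> ops \<Theta> \<and> list_all2 (wt \<Theta> X) ts (arity \<Theta> \<omega>) \<and> i = rsort \<Theta> \<omega>"
  by (erule wt.cases) auto

lemma wt_unique: "wt \<Theta> X t i \<Longrightarrow> wt \<Theta> X t j \<Longrightarrow> i = j"
  by (cases t) (auto dest!: wt_VarE wt_OpE)

lemma wt_tsubst:
  assumes "wt \<Theta> Y t i" and "\<And>y. y \<in> Y \<Longrightarrow> wt \<Theta> X (\<sigma> y) (vsort \<Theta> y)"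
  shows "wt \<Theta> X (tsubst \<sigma> t) i"
  using assms(1)
proof (induction rule: wt.induct)
  case (wt_Op \<omega> ts)
  then have "list_all2 (wt \<Theta> X) (map (tsubst \<sigma>) ts) (arity \<Theta> \<omega>)"
    by (auto simp: list_all2_conv_all_nth)
  then show ?case using wt_Op.hyps by (auto intro: wt.wt_Op)
qed (simp add: assms(2))

lemma trm_eval_tsubst: "trm_eval G \<rho> (tsubst \<sigma> t) = trm_eval G (\<lambda>y. trm_eval G \<rho> (\<sigma> y)) t"
proof (induction t)
  case (Op \<omega> ts)
  have "map (trm_eval G \<rho> \<circ> tsubst \<sigma>) ts = map (trm_eval G (\<lambda>y. trm_eval G \<rho> (\<sigma> y))) ts"
    using Op.IH by auto
  then show ?case by (simp only: trm_eval.simps tsubst.simps map_map)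
qed simp

lemma trm_eval_cong: "(\<And>x. x \<in> tvars t \<Longrightarrow> \<rho> x = \<rho>' x) \<Longrightarrow> trm_eval G \<rho> t = trm_eval G \<rho>' t"
proof (induction t)
  case (Op \<omega> ts)
  have "map (trm_eval G \<rho>) ts = map (trm_eval G \<rho>') ts"
    using Op.prems by (auto intro!: Op.IH)
  then show ?case by (simp only: trm_eval.simps)
qed simp

lemma tvars_wt: "wt \<Theta> X t i \<Longrightarrow> tvars t \<subseteq> X"
  by (induction rule: wt.induct) (fastforce simp: list_all2_conv_all_nth in_set_conv_nth)+

lemma trm_eval_in_carr:
  assumes "wt \<Theta> X t i" and "is_alg \<Theta> G" and "\<And>x. x \<in> X \<Longrightarrow> \<rho> x \<in> carr G (vsort \<Theta> x)"
  shows "trm_eval G \<rho> t \<in> carr G i"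
  using assms(1)
proof (induction rule: wt.induct)
  case (wt_Op \<omega> ts)
  then have "map (trm_eval G \<rho>) ts \<in> tuples (carr G) (arity \<Theta> \<omega>)"
    by (auto simp: tuples_def list_all2_conv_all_nth)
  then show ?case using wt_Op.hyps assms(2) by (auto simp: is_alg_def)
qed (simp add: assms(3))

lemma HomD_carr: "h \<in> Hom \<Theta> A B \<Longrightarrow> w \<in> carr A i \<Longrightarrow> h i w \<in> carr B i"
  by (auto simp: Hom_def)

lemma HomD_op:
  "h \<in> Hom \<Theta> A B \<Longrightarrow> \<omega> \<in> ops \<Theta> \<Longrightarrow> as \<in> tuples (carr A) (arity \<Theta> \<omega>) \<Longrightarrow>
   h (rsort \<Theta> \<omega>) (opr A \<omega> as) = opr B \<omega> (map2 h (arity \<Theta> \<omega>) as)"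
  by (auto simp: Hom_def)

lemma map2_tuples:
  "h \<in> Hom \<Theta> A B \<Longrightarrow> as \<in> tuples (carr A) is \<Longrightarrow> map2 h is as \<in> tuples (carr B) is"
  by (auto simp: tuples_def list_all2_conv_all_nth HomD_carr)

lemma map2_comp_hom:
  "as \<in> tuples (carr A) is \<Longrightarrow> map2 (comp_hom A h g) is as = map2 h is (map2 g is as)"
  by (auto simp: tuples_def list_all2_conv_all_nth comp_hom_def compose_def intro!: nth_equalityI)

lemma comp_hom_apply: "w \<in> carr A i \<Longrightarrow> comp_hom A h g i w = h i (g i w)"
  by (simp add: comp_hom_def compose_def)

lemma comp_hom_Hom:
  assumes "is_alg \<Theta> A" and "g \<in> Hom \<Theta> A B" and "h \<in> Hom \<Theta> B C"
  shows "comp_hom A h g \<in> Hom \<Theta> A C"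
proof -
  have "comp_hom A h g i \<in> carr A i \<rightarrow>\<^sub>E carr C i" for i
    using assms by (auto simp: comp_hom_def compose_def HomD_carr)
  moreover have "comp_hom A h g (rsort \<Theta> \<omega>) (opr A \<omega> as) = opr C \<omega> (map2 (comp_hom A h g) (arity \<Theta> \<omega>) as)"
    if "\<omega> \<in> ops \<Theta>" "as \<in> tuples (carr A) (arity \<Theta> \<omega>)" for \<omega> as
  proof -
    have "opr A \<omega> as \<in> carr A (rsort \<Theta> \<omega>)" using that assms(1) by (auto simp: is_alg_def)
    then show ?thesis
      using HomD_op[OF assms(2) that] HomD_op[OF assms(3) that(1) map2_tuples[OF assms(2) that(2)]]
        map2_comp_hom[OF that(2), of h g] by (simp only: comp_hom_apply)
  qed
  ultimately show ?thesis by (simp add: Hom_def)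
qed

lemma id_hom_Hom: "is_alg \<Theta> A \<Longrightarrow> id_hom A \<in> Hom \<Theta> A A"
proof -
  assume a: "is_alg \<Theta> A"
  have "map2 (id_hom A) is as = as" if "as \<in> tuples (carr A) is" for "is" as
    using that by (auto simp: tuples_def list_all2_conv_all_nth id_hom_def intro!: nth_equalityI)
  moreover have "id_hom A i \<in> carr A i \<rightarrow>\<^sub>E carr A i" for i by (auto simp: id_hom_def)
  moreover have "id_hom A i a = a" if "a \<in> carr A i" for i a using that by (simp add: id_hom_def)
  ultimately show ?thesis using a by (simp add: Hom_def is_alg_def)
qed

lemma comp_hom_id: "h \<in> Hom \<Theta> A B \<Longrightarrow> comp_hom A h (id_hom A) = h"
  by (intro ext) (auto simp: comp_hom_def compose_def id_hom_def Hom_def PiE_def extensional_def)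

lemma comp_hom_assoc:
  "g \<in> Hom \<Theta> A B \<Longrightarrow> comp_hom A k (comp_hom A h g) = comp_hom A (comp_hom B k h) g"
  by (intro ext) (auto simp: comp_hom_def compose_def Hom_def PiE_def)

locale wf_var =
  fixes \<Theta> :: "('s, 'o, 'x) variety"
  assumes wf: "wf_variety \<Theta>"
begin

lemma teq_wt: "teq \<Theta> X t u \<Longrightarrow> \<exists>i. wt \<Theta> X t i \<and> wt \<Theta> X u i"
proof (induction rule: teq.induct)
  case (teq_cong \<omega> ts us)
  then have "list_all2 (wt \<Theta> X) us (arity \<Theta> \<omega>)"
    by (auto simp: list_all2_conv_all_nth) (metis wt_unique)
  then show ?case using teq_cong.hyps by (auto intro: wt.wt_Op)
next
  case (teq_ident Y l r \<sigma>)
  then obtain i where "wt \<Theta> Y l i" "wt \<Theta> Y r i"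
    using wf by (fastforce simp: wf_variety_def)
  then show ?case using teq_ident.hyps(2) by (metis wt_tsubst)
qed (auto dest: wt_unique)

lemma teq_sound:
  assumes "in_variety \<Theta> G" and "\<And>x. x \<in> X \<Longrightarrow> \<rho> x \<in> carr G (vsort \<Theta> x)"
  shows "teq \<Theta> X t u \<Longrightarrow> trm_eval G \<rho> t = trm_eval G \<rho> u"
proof (induction rule: teq.induct)
  case (teq_cong \<omega> ts us)
  then have "map (trm_eval G \<rho>) ts = map (trm_eval G \<rho>) us"
    by (auto simp: list_all2_conv_all_nth intro!: nth_equalityI)
  then show ?case by (simp only: trm_eval.simps)
next
  case (teq_ident Y l r \<sigma>)
  have "\<forall>y\<in>Y. trm_eval G \<rho> (\<sigma> y) \<in> carr G (vsort \<Theta> y)"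
    using teq_ident.hyps(2) assms by (auto simp: in_variety_def intro: trm_eval_in_carr)
  then show ?case
    using assms(1) teq_ident.hyps(1) by (auto simp: in_variety_def trm_eval_tsubst)
qed auto

lemma tcls_eq_iff: "wt \<Theta> X t i \<Longrightarrow> tcls \<Theta> X t = tcls \<Theta> X u \<longleftrightarrow> teq \<Theta> X t u"
  unfolding tcls_def by (auto intro: teq_sym teq_trans dest: teq_refl)

lemma tcls_in_carr: "wt \<Theta> X t i \<Longrightarrow> tcls \<Theta> X t \<in> carr (W \<Theta> X) i"
  by (auto simp: W_def)

lemma gen_in_carr: "x \<in> X \<Longrightarrow> gen \<Theta> X x \<in> carr (W \<Theta> X) (vsort \<Theta> x)"
  by (auto simp: gen_def intro: tcls_in_carr wt.wt_Var)

lemma mem_listset_map_tcls: "us \<in> listset (map (tcls \<Theta> X) ts) \<longleftrightarrow> list_all2 (teq \<Theta> X) ts us"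
  by (induction ts arbitrary: us) (auto simp: set_Cons_def tcls_def list_all2_Cons1)

lemma opr_W:
  assumes "\<omega> \<in> ops \<Theta>" and "list_all2 (wt \<Theta> X) ts (arity \<Theta> \<omega>)"
  shows "opr (W \<Theta> X) \<omega> (map (tcls \<Theta> X) ts) = tcls \<Theta> X (Op \<omega> ts)"
proof -
  have "tcls \<Theta> X (Op \<omega> us) = tcls \<Theta> X (Op \<omega> ts)" if "us \<in> listset (map (tcls \<Theta> X) ts)" for us
    using tcls_eq_iff[OF wt.wt_Op[OF assms], THEN iffD2, OF teq_cong[OF assms], of us] that
    by (simp only: mem_listset_map_tcls)
  moreover have "ts \<in> listset (map (tcls \<Theta> X) ts)"
    using assms(2) unfolding mem_listset_map_tcls list_all2_conv_all_nth by (blast intro: teq_refl)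
  ultimately have "(\<Union>us\<in>listset (map (tcls \<Theta> X) ts). tcls \<Theta> X (Op \<omega> us)) = tcls \<Theta> X (Op \<omega> ts)"
    by blast
  then show ?thesis by (simp add: W_def)
qed

lemma tuples_W:
  assumes "ws \<in> tuples (carr (W \<Theta> X)) is"
  obtains ts where "ws = map (tcls \<Theta> X) ts" and "list_all2 (wt \<Theta> X) ts is"
proof -
  have "\<exists>ts. ws = map (tcls \<Theta> X) ts \<and> list_all2 (wt \<Theta> X) ts is"
    using assms unfolding tuples_def mem_Collect_eq
  proof (induction rule: list_all2_induct)
    case (Cons w ws i "is")
    then obtain t ts where "w = tcls \<Theta> X t" "wt \<Theta> X t i" "ws = map (tcls \<Theta> X) ts"
      "list_all2 (wt \<Theta> X) ts is" by (auto simp: W_def)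
    then show ?case by (intro exI[of _ "t # ts"]) auto
  qed simp
  then show ?thesis using that by blast
qed

lemma is_alg_W: "is_alg \<Theta> (W \<Theta> X)"
  unfolding is_alg_def
proof (intro ballI)
  fix \<omega> ws assume \<omega>: "\<omega> \<in> ops \<Theta>" and "ws \<in> tuples (carr (W \<Theta> X)) (arity \<Theta> \<omega>)"
  then obtain ts where "ws = map (tcls \<Theta> X) ts" "list_all2 (wt \<Theta> X) ts (arity \<Theta> \<omega>)"
    by (elim tuples_W)
  then show "opr (W \<Theta> X) \<omega> ws \<in> carr (W \<Theta> X) (rsort \<Theta> \<omega>)"
    using tcls_in_carr[OF wt.wt_Op[OF \<omega>]] opr_W[OF \<omega>] by simp
qed

lemma trm_eval_W:
  assumes "wt \<Theta> Y t i" and "\<And>y. y \<in> Y \<Longrightarrow> wt \<Theta> X (\<sigma> y) (vsort \<Theta> y)"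
    and "\<And>y. y \<in> Y \<Longrightarrow> \<rho> y = tcls \<Theta> X (\<sigma> y)"
  shows "trm_eval (W \<Theta> X) \<rho> t = tcls \<Theta> X (tsubst \<sigma> t)"
  using assms(1)
proof (induction rule: wt.induct)
  case (wt_Op \<omega> ts)
  then have "list_all2 (wt \<Theta> X) (map (tsubst \<sigma>) ts) (arity \<Theta> \<omega>)"
    by (auto simp: list_all2_conv_all_nth intro!: wt_tsubst[where Y = Y] assms(2))
  moreover have "map (trm_eval (W \<Theta> X) \<rho>) ts = map (tcls \<Theta> X) (map (tsubst \<sigma>) ts)"
    using wt_Op by (simp add: list_all2_conv_all_nth list_eq_iff_nth_eq)
  ultimately show ?case
    using opr_W[OF wt_Op.hyps(1), of X "map (tsubst \<sigma>) ts"] by (simp only: trm_eval.simps tsubst.simps)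
qed (simp add: assms(3))

text \<open>A valuation of the variables of an identity by classes of terms is induced by a substitution,
  and \<^const>\<open>teq\<close> contains all substitution instances of the identities.\<close>

lemma in_variety_W: "in_variety \<Theta> (W \<Theta> X)"
  unfolding in_variety_def
proof (intro conjI is_alg_W, clarify)
  fix Y l r \<rho>
  assume Y: "(Y, l, r) \<in> idents \<Theta>" and \<rho>: "\<forall>y\<in>Y. \<rho> y \<in> carr (W \<Theta> X) (vsort \<Theta> y)"
  have "\<forall>y\<in>Y. \<exists>t. wt \<Theta> X t (vsort \<Theta> y) \<and> \<rho> y = tcls \<Theta> X t"
    using \<rho> by (auto simp: W_def)
  then obtain \<sigma> where \<sigma>: "\<And>y. y \<in> Y \<Longrightarrow> wt \<Theta> X (\<sigma> y) (vsort \<Theta> y)"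
    "\<And>y. y \<in> Y \<Longrightarrow> \<rho> y = tcls \<Theta> X (\<sigma> y)" by metis
  obtain i where i: "wt \<Theta> Y l i" "wt \<Theta> Y r i"
    using wf Y by (fastforce simp: wf_variety_def)
  have "teq \<Theta> X (tsubst \<sigma> l) (tsubst \<sigma> r)" using Y \<sigma>(1) by (rule teq_ident)
  then show "trm_eval (W \<Theta> X) \<rho> l = trm_eval (W \<Theta> X) \<rho> r"
    using trm_eval_W[OF i(1) \<sigma>] trm_eval_W[OF i(2) \<sigma>] tcls_eq_iff wt_tsubst[OF i(1) \<sigma>(1)] by metis
qed

lemma Hom_W_tcls:
  assumes "h \<in> Hom \<Theta> (W \<Theta> X) G" and "wt \<Theta> X t i"
  shows "h i (tcls \<Theta> X t) = trm_eval G (app_var \<Theta> X h) t"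
  using assms(2)
proof (induction rule: wt.induct)
  case (wt_Var x)
  then show ?case by (simp add: app_var_def gen_def)
next
  case (wt_Op \<omega> ts)
  then have ts: "list_all2 (wt \<Theta> X) ts (arity \<Theta> \<omega>)" by (auto simp: list_all2_conv_all_nth)
  then have "map (tcls \<Theta> X) ts \<in> tuples (carr (W \<Theta> X)) (arity \<Theta> \<omega>)"
    by (auto simp: tuples_def list_all2_conv_all_nth intro: tcls_in_carr)
  then have "h (rsort \<Theta> \<omega>) (tcls \<Theta> X (Op \<omega> ts)) = opr G \<omega> (map2 h (arity \<Theta> \<omega>) (map (tcls \<Theta> X) ts))"
    using HomD_op[OF assms(1) wt_Op.hyps(1)] opr_W[OF wt_Op.hyps(1) ts] by metis
  also have "map2 h (arity \<Theta> \<omega>) (map (tcls \<Theta> X) ts) = map (trm_eval G (app_var \<Theta> X h)) ts"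
    using wt_Op by (auto simp: list_all2_conv_all_nth intro!: nth_equalityI)
  finally show ?case by simp
qed

lemma Hom_W_eqI:
  assumes g: "g \<in> Hom \<Theta> (W \<Theta> X) G" and h: "h \<in> Hom \<Theta> (W \<Theta> X) G"
    and "\<And>x. x \<in> X \<Longrightarrow> app_var \<Theta> X g x = app_var \<Theta> X h x"
  shows "g = h"
proof (intro ext)
  fix i w
  show "g i w = h i w"
  proof (cases "w \<in> carr (W \<Theta> X) i")
    case True
    then obtain t where t: "w = tcls \<Theta> X t" "wt \<Theta> X t i" by (auto simp: W_def)
    have "trm_eval G (app_var \<Theta> X g) t = trm_eval G (app_var \<Theta> X h) t"
      using tvars_wt[OF t(2)] assms(3) by (intro trm_eval_cong) blast
    then show ?thesis using Hom_W_tcls[OF g t(2)] Hom_W_tcls[OF h t(2)] t(1) by simp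
  next
    case False
    then show ?thesis using g h by (auto simp: Hom_def PiE_def extensional_def)
  qed
qed

text \<open>The universal property of \<open>W(X)\<close>: evaluation of representatives is a well-defined homomorphism
  because \<^const>\<open>teq\<close> is sound in the variety.\<close>

lemma Hom_W_exists:
  assumes G: "in_variety \<Theta> G" and \<rho>: "\<And>x. x \<in> X \<Longrightarrow> \<rho> x \<in> carr G (vsort \<Theta> x)"
  obtains h where "h \<in> Hom \<Theta> (W \<Theta> X) G" and "\<And>x. x \<in> X \<Longrightarrow> app_var \<Theta> X h x = \<rho> x"
proof -
  define h where "h = (\<lambda>i. \<lambda>w\<in>carr (W \<Theta> X) i. trm_eval G \<rho> (SOME t. t \<in> w))"
  have h: "h i (tcls \<Theta> X t) = trm_eval G \<rho> t" if t: "wt \<Theta> X t i" for i t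
  proof -
    have "(SOME u. u \<in> tcls \<Theta> X t) \<in> tcls \<Theta> X t"
      by (rule someI[of _ t]) (use t in \<open>auto simp: tcls_def intro: teq_refl\<close>)
    then have "teq \<Theta> X t (SOME u. u \<in> tcls \<Theta> X t)" by (simp add: tcls_def)
    then show ?thesis using teq_sound[OF G \<rho>] tcls_in_carr[OF t] by (simp add: h_def)
  qed
  have alg: "is_alg \<Theta> G" using G by (simp add: in_variety_def)
  have "h i w \<in> carr G i" if "w \<in> carr (W \<Theta> X) i" for i w
    using that h trm_eval_in_carr[OF _ alg \<rho>] by (auto simp: W_def)
  then have "h i \<in> carr (W \<Theta> X) i \<rightarrow>\<^sub>E carr G i" for i by (auto simp: h_def)
  moreover have "h (rsort \<Theta> \<omega>) (opr (W \<Theta> X) \<omega> ws) = opr G \<omega> (map2 h (arity \<Theta> \<omega>) ws)"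
    if \<omega>: "\<omega> \<in> ops \<Theta>" and ws: "ws \<in> tuples (carr (W \<Theta> X)) (arity \<Theta> \<omega>)" for \<omega> ws
  proof -
    obtain ts where ts: "ws = map (tcls \<Theta> X) ts" "list_all2 (wt \<Theta> X) ts (arity \<Theta> \<omega>)"
      using ws by (rule tuples_W)
    have "map2 h (arity \<Theta> \<omega>) ws = map (trm_eval G \<rho>) ts"
      using ts by (auto simp: list_all2_conv_all_nth h intro!: nth_equalityI)
    then show ?thesis using h[OF wt.wt_Op[OF \<omega> ts(2)]] opr_W[OF \<omega> ts(2)] ts(1) by simp
  qed
  ultimately have "h \<in> Hom \<Theta> (W \<Theta> X) G" by (simp add: Hom_def)
  moreover have "app_var \<Theta> X h x = \<rho> x" if "x \<in> X" for x
    using h[OF wt.wt_Var[OF that]] by (simp add: app_var_def gen_def)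
  ultimately show ?thesis using that by blast
qed

lemma app_var_in_carr: "h \<in> Hom \<Theta> (W \<Theta> X) G \<Longrightarrow> x \<in> X \<Longrightarrow> app_var \<Theta> X h x \<in> carr G (vsort \<Theta> x)"
  by (simp add: app_var_def HomD_carr gen_in_carr)

lemma app_var_comp_hom:
  "x \<in> X \<Longrightarrow> app_var \<Theta> X (comp_hom (W \<Theta> X) h s) x = h (vsort \<Theta> x) (app_var \<Theta> X s x)"
  by (simp add: app_var_def comp_hom_apply gen_in_carr)

text \<open>A variable outside the support of \<open>w\<close> is absent from some representative of \<open>w\<close>, and that
  representative may be evaluated instead.\<close>

lemma Hom_W_off_support:
  assumes g: "g \<in> Hom \<Theta> (W \<Theta> Y) G" and h: "h \<in> Hom \<Theta> (W \<Theta> Y) G"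
    and w: "w \<in> carr (W \<Theta> Y) i" and y: "y \<notin> support w"
    and agree: "\<And>z. z \<in> Y \<Longrightarrow> z \<noteq> y \<Longrightarrow> app_var \<Theta> Y g z = app_var \<Theta> Y h z"
  shows "g i w = h i w"
proof -
  obtain t where t: "t \<in> w" "y \<notin> tvars t" using y by (auto simp: support_def)
  obtain t\<^sub>0 where t0: "w = tcls \<Theta> Y t\<^sub>0" "wt \<Theta> Y t\<^sub>0 i" using w by (auto simp: W_def)
  have eq: "teq \<Theta> Y t\<^sub>0 t" using t(1) t0(1) by (simp add: tcls_def)
  then have wtt: "wt \<Theta> Y t i" using teq_wt t0(2) wt_unique by metis
  have "w = tcls \<Theta> Y t" using t0 eq tcls_eq_iff by blast
  moreover have "trm_eval G (app_var \<Theta> Y g) t = trm_eval G (app_var \<Theta> Y h) t"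
    using agree t(2) tvars_wt[OF wtt] by (intro trm_eval_cong) blast
  ultimately show ?thesis using Hom_W_tcls[OF g wtt] Hom_W_tcls[OF h wtt] by simp
qed


section \<open>The Halmos algebra of an algebra in the variety\<close>

lemma hle_HalG: "hle (HalG \<Theta> G) X A B \<longleftrightarrow> A \<subseteq> B"
  by (auto simp: hle_def HalG_def)

lemma subs_points: "s \<in> subs \<Theta> X Y \<Longrightarrow> \<nu> \<in> points \<Theta> G Y \<Longrightarrow> comp_hom (W \<Theta> X) \<nu> s \<in> points \<Theta> G X"
  unfolding subs_def points_def by (rule comp_hom_Hom[OF is_alg_W])

lemma subs_comp: "s \<in> subs \<Theta> X Y \<Longrightarrow> t \<in> subs \<Theta> Y Z \<Longrightarrow> comp_hom (W \<Theta> X) t s \<in> subs \<Theta> X Z"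
  unfolding subs_def by (rule comp_hom_Hom[OF is_alg_W])

lemma subs_id: "id_hom (W \<Theta> X) \<in> subs \<Theta> X X"
  unfolding subs_def by (rule id_hom_Hom[OF is_alg_W])

lemma points_eqI:
  "\<mu> \<in> points \<Theta> G X \<Longrightarrow> \<nu> \<in> points \<Theta> G X \<Longrightarrow> (\<And>x. x \<in> X \<Longrightarrow> app_var \<Theta> X \<mu> x = app_var \<Theta> X \<nu> x) \<Longrightarrow> \<mu> = \<nu>"
  unfolding points_def by (rule Hom_W_eqI)

text \<open>The witnesses that the quantifier axioms ask for arise from a given point by a change at one variable;
  freeness of \<open>W(X)\<close> makes every such change possible.\<close>

lemma point_update:
  assumes G: "in_variety \<Theta> G" and \<mu>: "\<mu> \<in> points \<Theta> G X" and a: "a \<in> carr G (vsort \<Theta> x)"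
  obtains \<nu> where "\<nu> \<in> points \<Theta> G X" and "x \<in> X \<Longrightarrow> app_var \<Theta> X \<nu> x = a"
    and "\<And>y. y \<in> X \<Longrightarrow> y \<noteq> x \<Longrightarrow> app_var \<Theta> X \<nu> y = app_var \<Theta> X \<mu> y"
proof -
  have "((app_var \<Theta> X \<mu>)(x := a)) y \<in> carr G (vsort \<Theta> y)" if "y \<in> X" for y
    using a \<mu> that by (auto simp: points_def intro: app_var_in_carr)
  then obtain \<nu> where "\<nu> \<in> Hom \<Theta> (W \<Theta> X) G" "\<And>y. y \<in> X \<Longrightarrow> app_var \<Theta> X \<nu> y = ((app_var \<Theta> X \<mu>)(x := a)) y"
    using Hom_W_exists[OF G] by blast
  then show ?thesis using that by (simp add: points_def)
qed

lemma foldr_inter_base: "\<mu> \<in> foldr (\<inter>) (map f ps) P \<Longrightarrow> \<mu> \<in> P"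
  by (induction ps) auto

lemma foldr_inter_mem:
  assumes "\<mu> \<in> foldr (\<inter>) (map f ps) P" and "p \<in> set ps"
  shows "\<mu> \<in> f p"
  using assms by (induction ps) auto

lemma quantifiers_HalG:
  assumes G: "in_variety \<Theta> G"
  shows "quantifiers_on (HalG \<Theta> G) X"
proof -
  let ?E = "hex (HalG \<Theta> G) X"
  have E: "\<mu> \<in> ?E x A \<longleftrightarrow>
      \<mu> \<in> points \<Theta> G X \<and> (\<exists>\<nu>\<in>A. \<forall>y\<in>X. y \<noteq> x \<longrightarrow> app_var \<Theta> X \<mu> y = app_var \<Theta> X \<nu> y)" for \<mu> x A
    by (simp add: HalG_def)
  have comm: "?E x (?E y A) \<subseteq> ?E y (?E x A)" if xy: "x \<in> X" "y \<in> X" and A: "A \<subseteq> points \<Theta> G X" for x y A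
  proof (cases "x = y")
    case False
    show ?thesis
    proof
      fix \<mu> assume "\<mu> \<in> ?E x (?E y A)"
      then obtain \<nu> \<kappa> where \<mu>: "\<mu> \<in> points \<Theta> G X" and \<nu>: "\<nu> \<in> points \<Theta> G X" and \<kappa>: "\<kappa> \<in> A"
        and \<mu>\<nu>: "\<forall>z\<in>X. z \<noteq> x \<longrightarrow> app_var \<Theta> X \<mu> z = app_var \<Theta> X \<nu> z"
        and \<nu>\<kappa>: "\<forall>z\<in>X. z \<noteq> y \<longrightarrow> app_var \<Theta> X \<nu> z = app_var \<Theta> X \<kappa> z"
        unfolding E Bex_def by blast
      have "app_var \<Theta> X \<kappa> y \<in> carr G (vsort \<Theta> y)"
        using \<kappa> A xy by (auto simp: points_def intro: app_var_in_carr)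
      then obtain \<nu>' where \<nu>': "\<nu>' \<in> points \<Theta> G X" "app_var \<Theta> X \<nu>' y = app_var \<Theta> X \<kappa> y"
        "\<And>z. z \<in> X \<Longrightarrow> z \<noteq> y \<Longrightarrow> app_var \<Theta> X \<nu>' z = app_var \<Theta> X \<mu> z"
        using point_update[OF G \<mu>] xy(2) by metis
      have "app_var \<Theta> X \<nu>' z = app_var \<Theta> X \<kappa> z" if "z \<in> X" "z \<noteq> x" for z
        using that \<nu>' \<mu>\<nu> \<nu>\<kappa> by (cases "z = y") auto
      then have "\<nu>' \<in> ?E x A" using \<nu>'(1) \<kappa> unfolding E by blast
      then show "\<mu> \<in> ?E y (?E x A)" using \<mu> \<nu>'(3) unfolding E[of \<mu>] by metis
    qed
  qed simp
  have "?E x {} = {}" for x by (auto simp: E)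
  moreover have "A \<subseteq> ?E x A" if "A \<subseteq> points \<Theta> G X" for x A using that by (auto simp: E)
  moreover have "?E x (A \<inter> ?E x B) = ?E x A \<inter> ?E x B" if A: "A \<subseteq> points \<Theta> G X" for x A B
  proof (intro equalityI subsetI)
    fix \<mu> assume "\<mu> \<in> ?E x A \<inter> ?E x B"
    then have \<mu>: "\<mu> \<in> ?E x A" "\<mu> \<in> ?E x B" by simp_all
    then obtain \<nu> where \<nu>: "\<nu> \<in> A" and \<mu>\<nu>: "\<forall>y\<in>X. y \<noteq> x \<longrightarrow> app_var \<Theta> X \<mu> y = app_var \<Theta> X \<nu> y"
      unfolding E by blast
    obtain \<kappa> where \<kappa>: "\<kappa> \<in> B" and \<mu>\<kappa>: "\<forall>y\<in>X. y \<noteq> x \<longrightarrow> app_var \<Theta> X \<mu> y = app_var \<Theta> X \<kappa> y"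
      using \<mu>(2) unfolding E by blast
    have pt: "\<mu> \<in> points \<Theta> G X" using \<mu>(1) unfolding E by blast
    have "\<forall>y\<in>X. y \<noteq> x \<longrightarrow> app_var \<Theta> X \<nu> y = app_var \<Theta> X \<kappa> y"
      using \<mu>\<nu> \<mu>\<kappa> by metis
    then have "\<nu> \<in> ?E x B" unfolding E using \<nu> A \<kappa> by blast
    then show "\<mu> \<in> ?E x (A \<inter> ?E x B)" unfolding E[of \<mu>] using pt \<nu> \<mu>\<nu> by blast
  qed (fastforce simp: E)
  moreover have "?E x (?E y A) = ?E y (?E x A)" if "x \<in> X" "y \<in> X" "A \<subseteq> points \<Theta> G X" for x y A
    using comm that by blast
  ultimately show ?thesis
    unfolding quantifiers_on_def hle_HalG by (simp add: HalG_def)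
qed

lemma equalities_HalG: "equalities_on \<Theta> (HalG \<Theta> G) X"
  unfolding equalities_on_def hle_HalG
proof (intro conjI allI ballI subsetI)
  fix \<omega> ws ws' \<mu>
  assume \<omega>: "\<omega> \<in> ops \<Theta>" and ws: "ws \<in> tuples (carr (W \<Theta> X)) (arity \<Theta> \<omega>)"
    and ws': "ws' \<in> tuples (carr (W \<Theta> X)) (arity \<Theta> \<omega>)"
    and "\<mu> \<in> foldr (hmeet (HalG \<Theta> G) X) (map (\<lambda>(i, w, w'). heq (HalG \<Theta> G) X i w w')
            (zip (arity \<Theta> \<omega>) (zip ws ws'))) (htop (HalG \<Theta> G) X)"
  then have \<mu>: "\<mu> \<in> foldr (\<inter>) (map (\<lambda>(i, w, w'). {\<mu> \<in> points \<Theta> G X. \<mu> i w = \<mu> i w'})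
      (zip (arity \<Theta> \<omega>) (zip ws ws'))) (points \<Theta> G X)"
    by (simp add: HalG_def)
  have pt: "\<mu> \<in> points \<Theta> G X" using foldr_inter_base[OF \<mu>] .
  have len: "length ws = length (arity \<Theta> \<omega>)" "length ws' = length (arity \<Theta> \<omega>)"
    using ws ws' by (auto simp: tuples_def list_all2_conv_all_nth)
  have "\<mu> (arity \<Theta> \<omega> ! n) (ws ! n) = \<mu> (arity \<Theta> \<omega> ! n) (ws' ! n)" if "n < length (arity \<Theta> \<omega>)" for n
  proof -
    have "(arity \<Theta> \<omega> ! n, ws ! n, ws' ! n) \<in> set (zip (arity \<Theta> \<omega>) (zip ws ws'))"
      using that len by (auto simp: in_set_zip)
    from foldr_inter_mem[OF \<mu> this] show ?thesis by simp
  qed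
  then have "map2 \<mu> (arity \<Theta> \<omega>) ws = map2 \<mu> (arity \<Theta> \<omega>) ws'"
    using len by (auto intro!: nth_equalityI)
  then show "\<mu> \<in> heq (HalG \<Theta> G) X (rsort \<Theta> \<omega>) (opr (W \<Theta> X) \<omega> ws) (opr (W \<Theta> X) \<omega> ws')"
    using pt HomD_op[OF _ \<omega> ws, of \<mu> G] HomD_op[OF _ \<omega> ws', of \<mu> G]
    by (simp add: HalG_def points_def)
qed (simp add: HalG_def)

text \<open>A witness for \<open>\<exists>x\<close> over \<open>X\<close> is carried to \<open>Y\<close> by moving the point at the single variable \<open>y = s x\<close>;
  this does not affect \<open>s x'\<close> for \<open>x' \<noteq> x\<close> because \<open>y\<close> is outside its support.\<close>

lemma hsub_hex_HalG:
  assumes G: "in_variety \<Theta> G" and s: "s \<in> subs \<Theta> X Y" and x: "x \<in> X" and y: "y \<in> Y"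
    and A: "A \<subseteq> points \<Theta> G X" and sort: "vsort \<Theta> y = vsort \<Theta> x" and sx: "app_var \<Theta> X s x = gen \<Theta> Y y"
    and supp: "\<And>x'. x' \<in> X \<Longrightarrow> x' \<noteq> x \<Longrightarrow> y \<notin> support (app_var \<Theta> X s x')"
  shows "hsub (HalG \<Theta> G) X Y s (hex (HalG \<Theta> G) X x A) = hex (HalG \<Theta> G) Y y (hsub (HalG \<Theta> G) X Y s A)"
proof -
  have app: "app_var \<Theta> X (comp_hom (W \<Theta> X) \<nu> s) x = app_var \<Theta> Y \<nu> y" for \<nu> :: "('s, 'o, 'x, 'a) point"
    using sx sort x by (simp add: app_var_comp_hom app_var_def[of \<Theta> Y])
  have off: "app_var \<Theta> X (comp_hom (W \<Theta> X) \<nu> s) x' = app_var \<Theta> X (comp_hom (W \<Theta> X) \<nu>' s) x'"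
    if x': "x' \<in> X" "x' \<noteq> x" and "\<nu> \<in> points \<Theta> G Y" "\<nu>' \<in> points \<Theta> G Y"
      and "\<And>z. z \<in> Y \<Longrightarrow> z \<noteq> y \<Longrightarrow> app_var \<Theta> Y \<nu> z = app_var \<Theta> Y \<nu>' z" for \<nu> \<nu>' x'
  proof -
    have "app_var \<Theta> X s x' \<in> carr (W \<Theta> Y) (vsort \<Theta> x')"
      using s x'(1) by (simp add: subs_def app_var_in_carr)
    then show ?thesis
      using that supp[OF x'] Hom_W_off_support[of \<nu> Y G \<nu>']
      by (simp add: app_var_comp_hom points_def)
  qed
  show ?thesis
  proof (intro equalityI subsetI)
    fix \<nu> assume "\<nu> \<in> hsub (HalG \<Theta> G) X Y s (hex (HalG \<Theta> G) X x A)"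
    then obtain \<mu> where \<nu>: "\<nu> \<in> points \<Theta> G Y" and \<mu>: "\<mu> \<in> A"
      and agree: "\<And>x'. x' \<in> X \<Longrightarrow> x' \<noteq> x \<Longrightarrow> app_var \<Theta> X (comp_hom (W \<Theta> X) \<nu> s) x' = app_var \<Theta> X \<mu> x'"
      by (auto simp: HalG_def)
    have "app_var \<Theta> X \<mu> x \<in> carr G (vsort \<Theta> y)"
      using \<mu> A x sort by (auto simp: points_def intro: app_var_in_carr)
    then obtain \<nu>' where \<nu>': "\<nu>' \<in> points \<Theta> G Y" "app_var \<Theta> Y \<nu>' y = app_var \<Theta> X \<mu> x"
      "\<And>z. z \<in> Y \<Longrightarrow> z \<noteq> y \<Longrightarrow> app_var \<Theta> Y \<nu>' z = app_var \<Theta> Y \<nu> z"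
      using point_update[OF G \<nu>] y by metis
    have "app_var \<Theta> X (comp_hom (W \<Theta> X) \<nu>' s) x' = app_var \<Theta> X \<mu> x'" if "x' \<in> X" for x'
      using that agree off[OF _ _ \<nu>'(1) \<nu>] \<nu>' app[of \<nu>'] by (cases "x' = x") auto
    then have "comp_hom (W \<Theta> X) \<nu>' s = \<mu>"
      using points_eqI[OF subs_points[OF s \<nu>'(1)]] \<mu> A by blast
    then have "\<nu>' \<in> hsub (HalG \<Theta> G) X Y s A" using \<nu>'(1) \<mu> by (simp add: HalG_def)
    then show "\<nu> \<in> hex (HalG \<Theta> G) Y y (hsub (HalG \<Theta> G) X Y s A)"
      using \<nu> \<nu>'(3) by (auto simp: HalG_def intro!: bexI[of _ \<nu>'])
  next
    fix \<nu> assume "\<nu> \<in> hex (HalG \<Theta> G) Y y (hsub (HalG \<Theta> G) X Y s A)"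
    then obtain \<nu>' where \<nu>: "\<nu> \<in> points \<Theta> G Y" and \<nu>': "\<nu>' \<in> points \<Theta> G Y" "comp_hom (W \<Theta> X) \<nu>' s \<in> A"
      "\<And>z. z \<in> Y \<Longrightarrow> z \<noteq> y \<Longrightarrow> app_var \<Theta> Y \<nu> z = app_var \<Theta> Y \<nu>' z"
      by (auto simp: HalG_def)
    have "comp_hom (W \<Theta> X) \<nu> s \<in> hex (HalG \<Theta> G) X x A"
      using subs_points[OF s \<nu>] \<nu>'(2) off[OF _ _ \<nu> \<nu>'(1) \<nu>'(3)] by (auto simp: HalG_def)
    then show "\<nu> \<in> hsub (HalG \<Theta> G) X Y s (hex (HalG \<Theta> G) X x A)" using \<nu> by (simp add: HalG_def)
  qed
qed

lemma hsub_hex_cong_HalG: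
  assumes s: "s\<^sub>1 \<in> subs \<Theta> X Y" "s\<^sub>2 \<in> subs \<Theta> X Y"
    and agree: "\<And>y. y \<in> X \<Longrightarrow> y \<noteq> x \<Longrightarrow> app_var \<Theta> X s\<^sub>1 y = app_var \<Theta> X s\<^sub>2 y"
  shows "hsub (HalG \<Theta> G) X Y s\<^sub>1 (hex (HalG \<Theta> G) X x A) = hsub (HalG \<Theta> G) X Y s\<^sub>2 (hex (HalG \<Theta> G) X x A)"
proof -
  have "app_var \<Theta> X (comp_hom (W \<Theta> X) \<nu> s\<^sub>1) y = app_var \<Theta> X (comp_hom (W \<Theta> X) \<nu> s\<^sub>2) y"
    if "y \<in> X" "y \<noteq> x" for y and \<nu> :: "('s, 'o, 'x, 'a) point"
    using agree[OF that] that(1) by (simp add: app_var_comp_hom)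
  then show ?thesis using subs_points[OF s(1)] subs_points[OF s(2)] by (auto simp: HalG_def)
qed

lemma single_sub_HalG:
  assumes s: "is_single_sub \<Theta> X x w s" and s': "is_single_sub \<Theta> X x w' s'"
    and \<nu>: "\<nu> \<in> points \<Theta> G X" and eq: "\<nu> (vsort \<Theta> x) w = \<nu> (vsort \<Theta> x) w'"
  shows "comp_hom (W \<Theta> X) \<nu> s = comp_hom (W \<Theta> X) \<nu> s'"
proof (rule points_eqI)
  show "app_var \<Theta> X (comp_hom (W \<Theta> X) \<nu> s) y = app_var \<Theta> X (comp_hom (W \<Theta> X) \<nu> s') y" if "y \<in> X" for y
    using that s s' eq by (cases "y = x") (auto simp: is_single_sub_def app_var_comp_hom)
qed (use s s' \<nu> in \<open>auto simp: is_single_sub_def intro: subs_points\<close>)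

lemma halmos_HalG:
  assumes G: "in_variety \<Theta> G"
  shows "halmos_algebra \<Theta> (HalG \<Theta> G)"
proof -
  have "closed_ops \<Theta> (HalG \<Theta> G)" by (auto simp: closed_ops_def HalG_def)
  moreover have "boolean_on (HalG \<Theta> G) X" for X by (auto simp: boolean_on_def HalG_def)
  moreover have "hsub (HalG \<Theta> G) X X (id_hom (W \<Theta> X)) A = A" if "A \<subseteq> points \<Theta> G X" for X A
    using that comp_hom_id[of _ \<Theta> "W \<Theta> X" G] by (auto simp: HalG_def points_def)
  moreover have "hsub (HalG \<Theta> G) X Z (comp_hom (W \<Theta> X) t s) A =
      hsub (HalG \<Theta> G) Y Z t (hsub (HalG \<Theta> G) X Y s A)"
    if "s \<in> subs \<Theta> X Y" "t \<in> subs \<Theta> Y Z" for X Y Z s t A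
    using that subs_points[OF that(2)] by (auto simp: HalG_def subs_def comp_hom_assoc)
  moreover have "hsub (HalG \<Theta> G) X Y s (heq (HalG \<Theta> G) X i w w') = heq (HalG \<Theta> G) Y i (s i w) (s i w')"
    if "s \<in> subs \<Theta> X Y" "w \<in> carr (W \<Theta> X) i" "w' \<in> carr (W \<Theta> X) i" for X Y s i w w'
    using that subs_points[OF that(1)] by (auto simp: HalG_def comp_hom_apply)
  moreover have "hsub (HalG \<Theta> G) X X s A \<inter> heq (HalG \<Theta> G) X (vsort \<Theta> x) w w' \<subseteq> hsub (HalG \<Theta> G) X X s' A"
    if "is_single_sub \<Theta> X x w s" "is_single_sub \<Theta> X x w' s'" for X x w w' s s' A
    using single_sub_HalG[OF that, of _ G] by (auto simp: HalG_def)
  moreover have "hsub (HalG \<Theta> G) X Y s {} = {}" "hsub (HalG \<Theta> G) X Y s (points \<Theta> G X) = points \<Theta> G Y"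
    "hsub (HalG \<Theta> G) X Y s (points \<Theta> G X - A) = points \<Theta> G Y - hsub (HalG \<Theta> G) X Y s A"
    "hsub (HalG \<Theta> G) X Y s (A \<union> B) = hsub (HalG \<Theta> G) X Y s A \<union> hsub (HalG \<Theta> G) X Y s B"
    "hsub (HalG \<Theta> G) X Y s (A \<inter> B) = hsub (HalG \<Theta> G) X Y s A \<inter> hsub (HalG \<Theta> G) X Y s B"
    if "s \<in> subs \<Theta> X Y" for X Y s A B
    using subs_points[OF that] by (auto simp: HalG_def)
  moreover have "hcarr (HalG \<Theta> G) X = Pow (points \<Theta> G X)" "hbot (HalG \<Theta> G) X = {}"
    "htop (HalG \<Theta> G) X = points \<Theta> G X" "hjoin (HalG \<Theta> G) X = (\<union>)" "hmeet (HalG \<Theta> G) X = (\<inter>)"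
    "hneg (HalG \<Theta> G) X A = points \<Theta> G X - A" for X A
    by (auto simp: HalG_def)
  ultimately show ?thesis
    unfolding halmos_algebra_def hle_HalG
    by (intro conjI ballI allI impI quantifiers_HalG[OF G] equalities_HalG hsub_hex_HalG[OF G]
        hsub_hex_cong_HalG) simp_all
qed

end

section \<open>Homomorphisms and quotients of Halmos structures\<close>

lemma hal_homD:
  assumes "hal_hom \<Theta> H K g" and "X \<in> Gamma0 \<Theta>"
  shows hal_hom_carr: "a \<in> hcarr H X \<Longrightarrow> g X a \<in> hcarr K X"
    and hal_hom_bot: "g X (hbot H X) = hbot K X"
    and hal_hom_top: "g X (htop H X) = htop K X"
    and hal_hom_join: "a \<in> hcarr H X \<Longrightarrow> b \<in> hcarr H X \<Longrightarrow> g X (hjoin H X a b) = hjoin K X (g X a) (g X b)"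
    and hal_hom_meet: "a \<in> hcarr H X \<Longrightarrow> b \<in> hcarr H X \<Longrightarrow> g X (hmeet H X a b) = hmeet K X (g X a) (g X b)"
    and hal_hom_neg: "a \<in> hcarr H X \<Longrightarrow> g X (hneg H X a) = hneg K X (g X a)"
    and hal_hom_ex: "a \<in> hcarr H X \<Longrightarrow> x \<in> X \<Longrightarrow> g X (hex H X x a) = hex K X x (g X a)"
    and hal_hom_eq: "w \<in> carr (W \<Theta> X) i \<Longrightarrow> w' \<in> carr (W \<Theta> X) i \<Longrightarrow> g X (heq H X i w w') = heq K X i w w'"
    and hal_hom_sub: "Y \<in> Gamma0 \<Theta> \<Longrightarrow> s \<in> subs \<Theta> X Y \<Longrightarrow> a \<in> hcarr H X \<Longrightarrow>
      g Y (hsub H X Y s a) = hsub K X Y s (g X a)"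
  using assms unfolding hal_hom_def by (blast intro: funcset_mem)+

lemma closed_opsD:
  assumes "closed_ops \<Theta> H" and "X \<in> Gamma0 \<Theta>"
  shows closed_bot: "hbot H X \<in> hcarr H X"
    and closed_top: "htop H X \<in> hcarr H X"
    and closed_join: "a \<in> hcarr H X \<Longrightarrow> b \<in> hcarr H X \<Longrightarrow> hjoin H X a b \<in> hcarr H X"
    and closed_meet: "a \<in> hcarr H X \<Longrightarrow> b \<in> hcarr H X \<Longrightarrow> hmeet H X a b \<in> hcarr H X"
    and closed_neg: "a \<in> hcarr H X \<Longrightarrow> hneg H X a \<in> hcarr H X"
    and closed_ex: "a \<in> hcarr H X \<Longrightarrow> x \<in> X \<Longrightarrow> hex H X x a \<in> hcarr H X"
    and closed_eq: "w \<in> carr (W \<Theta> X) i \<Longrightarrow> w' \<in> carr (W \<Theta> X) i \<Longrightarrow> heq H X i w w' \<in> hcarr H X"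
    and closed_sub: "Y \<in> Gamma0 \<Theta> \<Longrightarrow> s \<in> subs \<Theta> X Y \<Longrightarrow> a \<in> hcarr H X \<Longrightarrow> hsub H X Y s a \<in> hcarr H Y"
  using assms unfolding closed_ops_def by blast+

lemma hal_hom_comp:
  "hal_hom \<Theta> H K g \<Longrightarrow> hal_hom \<Theta> K L h \<Longrightarrow> hal_hom \<Theta> H L (\<lambda>X a. h X (g X a))"
  unfolding hal_hom_def[of \<Theta> H L] by (auto simp: hal_homD)

lemma closed_ops_image:
  assumes H: "closed_ops \<Theta> H" and p: "hal_hom \<Theta> H Q p"
    and onto: "\<And>X. X \<in> Gamma0 \<Theta> \<Longrightarrow> hcarr Q X = p X ` hcarr H X"
  shows "closed_ops \<Theta> Q"
  unfolding closed_ops_def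
proof (intro ballI conjI allI)
  fix X assume X: "X \<in> Gamma0 \<Theta>"
  note D = closed_opsD[OF H X] and P = hal_homD[OF p X]
  show "hbot Q X \<in> hcarr Q X" "htop Q X \<in> hcarr Q X"
    using P(1)[OF D(1)] P(1)[OF D(2)] P(2,3) by simp_all
  fix A assume A: "A \<in> hcarr Q X"
  then obtain a where a: "a \<in> hcarr H X" "A = p X a" using onto[OF X] by blast
  show "hneg Q X A \<in> hcarr Q X" using P(1)[OF D(5)[OF a(1)]] P(6) a by simp
  show "hex Q X x A \<in> hcarr Q X" if "x \<in> X" for x
    using P(1)[OF D(6)[OF a(1) that]] P(7) a that by simp
  show "hsub Q X Y s A \<in> hcarr Q Y" if "Y \<in> Gamma0 \<Theta>" "s \<in> subs \<Theta> X Y" for Y s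
    using hal_hom_carr[OF p that(1) D(8)[OF that a(1)]] P(9)[OF that a(1)] a(2) by simp
  fix B assume "B \<in> hcarr Q X"
  then obtain b where b: "b \<in> hcarr H X" "B = p X b" using onto[OF X] by blast
  show "hjoin Q X A B \<in> hcarr Q X" "hmeet Q X A B \<in> hcarr Q X"
    using P(1)[OF D(3)[OF a(1) b(1)]] P(1)[OF D(4)[OF a(1) b(1)]] P(4,5) a b by simp_all
next
  fix X i w w' assume X: "X \<in> Gamma0 \<Theta>" and w: "w \<in> carr (W \<Theta> X) i" "w' \<in> carr (W \<Theta> X) i"
  show "heq Q X i w w' \<in> hcarr Q X"
    using hal_homD(1)[OF p X closed_eq[OF H X w]] hal_hom_eq[OF p X w] by simp
qed

text \<open>Homomorphisms out of a quotient, out of an algebra of values and out of an isomorphic copy of \<open>H\<close> are all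
  obtained from a homomorphism on \<open>H\<close> in this way.\<close>

lemma hal_hom_descend:
  assumes H: "closed_ops \<Theta> H" and p: "hal_hom \<Theta> H Q p" and g: "hal_hom \<Theta> H K g"
    and onto: "\<And>X. X \<in> Gamma0 \<Theta> \<Longrightarrow> hcarr Q X = p X ` hcarr H X"
    and fac: "\<And>X a. X \<in> Gamma0 \<Theta> \<Longrightarrow> a \<in> hcarr H X \<Longrightarrow> h X (p X a) = g X a"
  shows "hal_hom \<Theta> Q K h"
  unfolding hal_hom_def
proof (intro ballI conjI allI funcsetI)
  fix X assume X: "X \<in> Gamma0 \<Theta>"
  note D = closed_opsD[OF H X] and P = hal_homD[OF p X] and G = hal_homD[OF g X] and F = fac[OF X]
  show "h X (hbot Q X) = hbot K X" "h X (htop Q X) = htop K X"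
    using F[OF D(1)] F[OF D(2)] P(2,3) G(2,3) by simp_all
  fix A assume A: "A \<in> hcarr Q X"
  then obtain a where a: "a \<in> hcarr H X" "A = p X a" using onto[OF X] by blast
  show "h X A \<in> hcarr K X" using G(1) F a by simp
  show "h X (hneg Q X A) = hneg K X (h X A)" using F[OF D(5)[OF a(1)]] P(6) G(6) F a by simp
  show "h X (hex Q X x A) = hex K X x (h X A)" if "x \<in> X" for x
    using F[OF D(6)[OF a(1) that]] P(7) G(7) F a that by simp
  show "h Y (hsub Q X Y s A) = hsub K X Y s (h X A)" if "Y \<in> Gamma0 \<Theta>" "s \<in> subs \<Theta> X Y" for Y s
    using fac[OF that(1) D(8)[OF that a(1)]] P(9)[OF that a(1)] G(9)[OF that a(1)] F a by simp
  fix B assume "B \<in> hcarr Q X"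
  then obtain b where b: "b \<in> hcarr H X" "B = p X b" using onto[OF X] by blast
  show "h X (hjoin Q X A B) = hjoin K X (h X A) (h X B)" "h X (hmeet Q X A B) = hmeet K X (h X A) (h X B)"
    using F[OF D(3)[OF a(1) b(1)]] F[OF D(4)[OF a(1) b(1)]] P(4,5) G(4,5) F a b by simp_all
next
  fix X i w w' assume X: "X \<in> Gamma0 \<Theta>" and w: "w \<in> carr (W \<Theta> X) i" "w' \<in> carr (W \<Theta> X) i"
  show "h X (heq Q X i w w') = heq K X i w w'"
    using fac[OF X closed_eq[OF H X w]] hal_hom_eq[OF p X w] hal_hom_eq[OF g X w] by simp
qed

lemma hal_hom_id: "hal_hom \<Theta> H H (\<lambda>X a. a)"
  by (simp add: hal_hom_def)

lemma hal_iso_inv: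
  assumes H: "closed_ops \<Theta> H" and g: "hal_iso \<Theta> H K g"
  shows "hal_iso \<Theta> K H (\<lambda>X. inv_into (hcarr H X) (g X))"
proof -
  have bij: "bij_betw (g X) (hcarr H X) (hcarr K X)" if "X \<in> Gamma0 \<Theta>" for X
    using g that by (simp add: hal_iso_def)
  have "hal_hom \<Theta> K H (\<lambda>X. inv_into (hcarr H X) (g X))"
  proof (rule hal_hom_descend[OF H _ hal_hom_id])
    show "hal_hom \<Theta> H K g" using g by (simp add: hal_iso_def)
  qed (use bij in \<open>auto simp: bij_betw_def\<close>)
  then show ?thesis using bij_betw_inv_into[OF bij] by (simp add: hal_iso_def)
qed

lemma hal_hom_foldr_meet:
  assumes H: "closed_ops \<Theta> H" and g: "hal_hom \<Theta> H K g" and X: "X \<in> Gamma0 \<Theta>" and as: "set as \<subseteq> hcarr H X"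
  shows "foldr (hmeet H X) as (htop H X) \<in> hcarr H X \<and>
    g X (foldr (hmeet H X) as (htop H X)) = foldr (hmeet K X) (map (g X) as) (htop K X)"
  using as by (induction as) (auto simp: closed_opsD[OF H X] hal_homD[OF g X])

lemma UN_const_eq: "a \<in> A \<Longrightarrow> (\<And>b. b \<in> A \<Longrightarrow> f b = f a) \<Longrightarrow> (\<Union>b\<in>A. f b) = f a"
  by blast

lemma UN_const_eq2:
  "a \<in> A \<Longrightarrow> b \<in> B \<Longrightarrow> (\<And>a' b'. a' \<in> A \<Longrightarrow> b' \<in> B \<Longrightarrow> f a' b' = f a b) \<Longrightarrow>
    (\<Union>a'\<in>A. \<Union>b'\<in>B. f a' b') = f a b"
  by blast

context
  fixes \<Theta> :: "('s, 'o, 'x) variety" and H :: "('s, 'o, 'x, 'h) hal" and R :: "'x set \<Rightarrow> ('h \<times> 'h) set"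
  assumes H: "closed_ops \<Theta> H" and R: "hal_congruence \<Theta> H R"
begin

lemma hal_congruenceD:
  assumes "X \<in> Gamma0 \<Theta>"
  shows "equiv (hcarr H X) (R X)"
    and "(a, a') \<in> R X \<Longrightarrow> (b, b') \<in> R X \<Longrightarrow> (hjoin H X a b, hjoin H X a' b') \<in> R X"
    and "(a, a') \<in> R X \<Longrightarrow> (b, b') \<in> R X \<Longrightarrow> (hmeet H X a b, hmeet H X a' b') \<in> R X"
    and "(a, a') \<in> R X \<Longrightarrow> (hneg H X a, hneg H X a') \<in> R X"
    and "(a, a') \<in> R X \<Longrightarrow> x \<in> X \<Longrightarrow> (hex H X x a, hex H X x a') \<in> R X"
    and "(a, a') \<in> R X \<Longrightarrow> Y \<in> Gamma0 \<Theta> \<Longrightarrow> s \<in> subs \<Theta> X Y \<Longrightarrow> (hsub H X Y s a, hsub H X Y s a') \<in> R Y"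
  using R assms unfolding hal_congruence_def by fast+

lemma hal_congruence_self: "X \<in> Gamma0 \<Theta> \<Longrightarrow> a \<in> hcarr H X \<Longrightarrow> a \<in> R X `` {a}"
  by (rule equiv_class_self[OF hal_congruenceD(1)])

lemma hal_congruence_class_eq: "X \<in> Gamma0 \<Theta> \<Longrightarrow> (a, b) \<in> R X \<Longrightarrow> R X `` {b} = R X `` {a}"
  using equiv_class_eq[OF hal_congruenceD(1)] by metis

lemma hal_quot_proj: "hal_hom \<Theta> H (hal_quot H R) (\<lambda>X a. R X `` {a})"
  unfolding hal_hom_def
proof (intro ballI conjI allI funcsetI)
  fix X assume X: "X \<in> Gamma0 \<Theta>"
  note D = hal_congruenceD[OF X] and S = hal_congruence_self[OF X] and E = hal_congruence_class_eq
  fix a assume a: "a \<in> hcarr H X"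
  show "R X `` {a} \<in> hcarr (hal_quot H R) X" using a by (auto simp: hal_quot_def quotient_def)
  show "R X `` {hneg H X a} = hneg (hal_quot H R) X (R X `` {a})"
    unfolding hal_quot_def hal.select_convs
    by (rule UN_const_eq[symmetric, OF S[OF a]], rule E[OF X D(4)], simp)
  show "R X `` {hex H X x a} = hex (hal_quot H R) X x (R X `` {a})" if "x \<in> X" for x
    unfolding hal_quot_def hal.select_convs
    by (rule UN_const_eq[symmetric, OF S[OF a]], rule E[OF X D(5)[OF _ that]], simp)
  show "R Y `` {hsub H X Y s a} = hsub (hal_quot H R) X Y s (R X `` {a})"
    if "Y \<in> Gamma0 \<Theta>" "s \<in> subs \<Theta> X Y" for Y s
    unfolding hal_quot_def hal.select_convs
    by (rule UN_const_eq[symmetric, OF S[OF a]], rule E[OF that(1) D(6)[OF _ that]], simp)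
  fix b assume b: "b \<in> hcarr H X"
  show "R X `` {hjoin H X a b} = hjoin (hal_quot H R) X (R X `` {a}) (R X `` {b})"
    unfolding hal_quot_def hal.select_convs
    by (rule UN_const_eq2[symmetric, OF S[OF a] S[OF b]], rule E[OF X D(2)], simp_all)
  show "R X `` {hmeet H X a b} = hmeet (hal_quot H R) X (R X `` {a}) (R X `` {b})"
    unfolding hal_quot_def hal.select_convs
    by (rule UN_const_eq2[symmetric, OF S[OF a] S[OF b]], rule E[OF X D(3)], simp_all)
qed (simp_all add: hal_quot_def)

lemma hcarr_hal_quot: "hcarr (hal_quot H R) X = (\<lambda>a. R X `` {a}) ` hcarr H X"
  by (auto simp: hal_quot_def quotient_def)

lemma closed_ops_hal_quot: "closed_ops \<Theta> (hal_quot H R)"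
  by (rule closed_ops_image[OF H hal_quot_proj hcarr_hal_quot])

lemma hal_quot_value:
  assumes "X \<in> Gamma0 \<Theta>" and "a \<in> hcarr H X" and "\<And>b. (a, b) \<in> R X \<Longrightarrow> g b = g a"
  shows "the_elem (g ` (R X `` {a})) = g a"
proof -
  have "g ` (R X `` {a}) = (\<lambda>_. g a) ` (R X `` {a})" using assms(3) by (intro image_cong) blast+
  then show ?thesis by (simp only: image_constant[OF hal_congruence_self[OF assms(1,2)]] the_elem_eq)
qed

lemma hal_quot_induced:
  assumes g: "hal_hom \<Theta> H K g"
    and ker: "\<And>X a b. X \<in> Gamma0 \<Theta> \<Longrightarrow> (a, b) \<in> R X \<Longrightarrow> g X a = g X b"
  shows "hal_hom \<Theta> (hal_quot H R) K (\<lambda>X A. the_elem (g X ` A))"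
proof (rule hal_hom_descend[OF H hal_quot_proj g hcarr_hal_quot])
  fix X a assume "X \<in> Gamma0 \<Theta>" "a \<in> hcarr H X"
  then show "the_elem (g X ` (R X `` {a})) = g X a" by (rule hal_quot_value) (metis ker \<open>X \<in> Gamma0 \<Theta>\<close>)
qed

end

definition hal_kernel ::
  "('s, 'o, 'x, 'h) hal \<Rightarrow> ('x set \<Rightarrow> 'h \<Rightarrow> 'k) \<Rightarrow> 'x set \<Rightarrow> ('h \<times> 'h) set" where
  "hal_kernel H g X = {(a, b). a \<in> hcarr H X \<and> b \<in> hcarr H X \<and> g X a = g X b}"

lemma hal_congruence_kernel:
  assumes H: "closed_ops \<Theta> H" and g: "hal_hom \<Theta> H K g"
  shows "hal_congruence \<Theta> H (hal_kernel H g)"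
  unfolding hal_congruence_def
proof (intro ballI conjI)
  fix X assume X: "X \<in> Gamma0 \<Theta>"
  show "equiv (hcarr H X) (hal_kernel H g X)"
    by (auto simp: equiv_def refl_on_def sym_def trans_def hal_kernel_def)
qed (auto simp: hal_kernel_def closed_opsD[OF H] hal_homD[OF g])

lemma boolean_onD:
  assumes "boolean_on H X" and "a \<in> hcarr H X" and "b \<in> hcarr H X" and "c \<in> hcarr H X"
  shows "hjoin H X a b = hjoin H X b a" "hmeet H X a b = hmeet H X b a"
    "hjoin H X a (hmeet H X b c) = hmeet H X (hjoin H X a b) (hjoin H X a c)"
    "hmeet H X a (hjoin H X b c) = hjoin H X (hmeet H X a b) (hmeet H X a c)"
    "hjoin H X a (hbot H X) = a" "hmeet H X a (htop H X) = a"
    "hjoin H X a (hneg H X a) = htop H X" "hmeet H X a (hneg H X a) = hbot H X"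
  using assms unfolding boolean_on_def by blast+

lemma quantifiers_onD:
  assumes "quantifiers_on H X" and "x \<in> X"
  shows "hex H X x (hbot H X) = hbot H X"
    "a \<in> hcarr H X \<Longrightarrow> hle H X a (hex H X x a)"
    "a \<in> hcarr H X \<Longrightarrow> b \<in> hcarr H X \<Longrightarrow> hex H X x (hmeet H X a (hex H X x b)) = hmeet H X (hex H X x a) (hex H X x b)"
    "y \<in> X \<Longrightarrow> a \<in> hcarr H X \<Longrightarrow> hex H X x (hex H X y a) = hex H X y (hex H X x a)"
  using assms unfolding quantifiers_on_def by blast+

lemma halmos_closed: "halmos_algebra \<Theta> H \<Longrightarrow> closed_ops \<Theta> H"
  by (simp add: halmos_algebra_def)

lemma halmos_sub_comp:
  assumes H: "halmos_algebra \<Theta> H" and XYZ: "X \<in> Gamma0 \<Theta>" "Y \<in> Gamma0 \<Theta>" "Z \<in> Gamma0 \<Theta>"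
    and st: "s \<in> subs \<Theta> X Y" "t \<in> subs \<Theta> Y Z" and a: "a \<in> hcarr H X"
  shows "hsub H X Z (comp_hom (W \<Theta> X) t s) a = hsub H Y Z t (hsub H X Y s a)"
  by (rule H[unfolded halmos_algebra_def, THEN conjunct2, THEN conjunct2, THEN conjunct2, THEN conjunct1,
        rule_format, OF XYZ st a])

text \<open>The Halmos axioms are identities (an inequality \<open>a \<le> b\<close> abbreviates \<open>a \<and> b = a\<close>), so they pass to
  subdirect products.  The family may be empty, and then \<open>Q\<close> has one-element components.\<close>

lemma (in wf_var) halmos_algebra_subdirect:
  assumes Q: "closed_ops \<Theta> Q"
    and hom: "\<And>j. j \<in> J \<Longrightarrow> hal_hom \<Theta> Q (H j) (q j)"
    and hal: "\<And>j. j \<in> J \<Longrightarrow> halmos_algebra \<Theta> (H j)"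
    and inj: "\<And>X a b. X \<in> Gamma0 \<Theta> \<Longrightarrow> a \<in> hcarr Q X \<Longrightarrow> b \<in> hcarr Q X \<Longrightarrow>
      (\<And>j. j \<in> J \<Longrightarrow> q j X a = q j X b) \<Longrightarrow> a = b"
  shows "halmos_algebra \<Theta> Q"
proof -
  note r1 = hal[unfolded halmos_algebra_def, THEN conjunct2]
  note c1 = r1[THEN conjunct1] and r2 = r1[THEN conjunct2]
  note c2 = r2[THEN conjunct1] and r3 = r2[THEN conjunct2]
  note c3 = r3[THEN conjunct1] and r4 = r3[THEN conjunct2]
  note c4 = r4[THEN conjunct1] and r5 = r4[THEN conjunct2]
  note c5 = r5[THEN conjunct1] and r6 = r5[THEN conjunct2]
  note c6 = r6[THEN conjunct1] and r7 = r6[THEN conjunct2]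
  note c7 = r7[THEN conjunct1] and c8 = r7[THEN conjunct2]
  note cl = closed_opsD[OF Q] and ho = hal_homD[OF hom]
  note bool = c1[rule_format, THEN conjunct1] and quant = c1[rule_format, THEN conjunct2, THEN conjunct1]
    and equ = c1[rule_format, THEN conjunct2, THEN conjunct2]
  have le: "hle Q X a b"
    if X: "X \<in> Gamma0 \<Theta>" and ab: "a \<in> hcarr Q X" "b \<in> hcarr Q X"
      and "\<And>j. j \<in> J \<Longrightarrow> hle (H j) X (q j X a) (q j X b)" for X a b
    unfolding hle_def using that(4) by (intro inj[OF X] cl X ab) (simp add: hle_def ho X ab)
  show ?thesis
    unfolding halmos_algebra_def
  proof (intro conjI ballI allI impI Q)
    fix X assume X: "X \<in> Gamma0 \<Theta>"
    note cX = cl[OF X] and hX = ho[OF _ X]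
    show "boolean_on Q X"
      unfolding boolean_on_def
    proof (intro ballI)
      fix a b c assume abc: "a \<in> hcarr Q X" "b \<in> hcarr Q X" "c \<in> hcarr Q X"
      note B = boolean_onD[OF bool[OF _ X] hX(1)[OF _ abc(1)] hX(1)[OF _ abc(2)] hX(1)[OF _ abc(3)]]
      show "hjoin Q X a b = hjoin Q X b a \<and> hmeet Q X a b = hmeet Q X b a \<and>
        hjoin Q X a (hmeet Q X b c) = hmeet Q X (hjoin Q X a b) (hjoin Q X a c) \<and>
        hmeet Q X a (hjoin Q X b c) = hjoin Q X (hmeet Q X a b) (hmeet Q X a c) \<and>
        hjoin Q X a (hbot Q X) = a \<and> hmeet Q X a (htop Q X) = a \<and>
        hjoin Q X a (hneg Q X a) = htop Q X \<and> hmeet Q X a (hneg Q X a) = hbot Q X"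
        by (intro conjI; rule inj[OF X], (simp add: cX abc), (simp add: cX abc),
            simp only: hX cX abc, rule B, assumption+)
    qed
    show "quantifiers_on Q X"
      unfolding quantifiers_on_def
    proof (intro ballI conjI)
      fix x assume x: "x \<in> X"
      note E = quantifiers_onD[OF quant[OF _ X] x]
      show "hex Q X x (hbot Q X) = hbot Q X"
        by (rule inj[OF X]) (simp_all add: cX hX x E)
      fix a assume a: "a \<in> hcarr Q X"
      show "hle Q X a (hex Q X x a)"
        by (rule le[OF X]) (simp_all add: cX hX x a E)
      show "hex Q X x (hmeet Q X a (hex Q X x b)) = hmeet Q X (hex Q X x a) (hex Q X x b)"
        if b: "b \<in> hcarr Q X" for b
        by (rule inj[OF X]) (simp_all add: cX hX x a b E)
      show "hex Q X x (hex Q X y a) = hex Q X y (hex Q X x a)" if y: "y \<in> X" for y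
        by (rule inj[OF X]) (simp_all add: cX hX x y a, rule E(4), simp_all add: hX y a)
    qed
    show "equalities_on \<Theta> Q X"
      unfolding equalities_on_def
    proof (intro conjI allI ballI)
      fix i w assume w: "w \<in> carr (W \<Theta> X) i"
      show "heq Q X i w w = htop Q X"
        by (rule inj[OF X]) (use equ[OF _ X] in \<open>simp_all add: cX hX w equalities_on_def\<close>)
    next
      fix \<omega> ws ws'
      assume \<omega>: "\<omega> \<in> ops \<Theta>" and ws: "ws \<in> tuples (carr (W \<Theta> X)) (arity \<Theta> \<omega>)"
        and ws': "ws' \<in> tuples (carr (W \<Theta> X)) (arity \<Theta> \<omega>)"
      let ?ps = "zip (arity \<Theta> \<omega>) (zip ws ws')"
      let ?eqs = "\<lambda>H. map (\<lambda>(i, w, w'). heq H X i w w') ?ps"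
      have ps: "w \<in> carr (W \<Theta> X) i \<and> w' \<in> carr (W \<Theta> X) i" if "(i, w, w') \<in> set ?ps" for i w w'
        using that ws ws' by (auto simp: tuples_def list_all2_conv_all_nth in_set_zip)
      have sub: "set (?eqs Q) \<subseteq> hcarr Q X" using ps by (auto intro: cX)
      have opr: "opr (W \<Theta> X) \<omega> ws \<in> carr (W \<Theta> X) (rsort \<Theta> \<omega>)" "opr (W \<Theta> X) \<omega> ws' \<in> carr (W \<Theta> X) (rsort \<Theta> \<omega>)"
        using is_alg_W \<omega> ws ws' by (auto simp: is_alg_def)
      show "hle Q X (foldr (hmeet Q X) (?eqs Q) (htop Q X))
          (heq Q X (rsort \<Theta> \<omega>) (opr (W \<Theta> X) \<omega> ws) (opr (W \<Theta> X) \<omega> ws'))"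
      proof (rule le[OF X])
        show "foldr (hmeet Q X) (?eqs Q) (htop Q X) \<in> hcarr Q X"
          using hal_hom_foldr_meet[OF Q hal_hom_id X sub] by simp
        show "heq Q X (rsort \<Theta> \<omega>) (opr (W \<Theta> X) \<omega> ws) (opr (W \<Theta> X) \<omega> ws') \<in> hcarr Q X"
          by (rule cX(7)[OF opr])
        fix j assume j: "j \<in> J"
        have "map (q j X) (?eqs Q) = ?eqs (H j)"
          using ps hX(8)[OF j] by (auto simp: case_prod_beta)
        then have "q j X (foldr (hmeet Q X) (?eqs Q) (htop Q X)) = foldr (hmeet (H j) X) (?eqs (H j)) (htop (H j) X)"
          using hal_hom_foldr_meet[OF Q hom[OF j] X sub, THEN conjunct2] by (simp only:)
        then show "hle (H j) X (q j X (foldr (hmeet Q X) (?eqs Q) (htop Q X)))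
            (q j X (heq Q X (rsort \<Theta> \<omega>) (opr (W \<Theta> X) \<omega> ws) (opr (W \<Theta> X) \<omega> ws')))"
          using equ[OF j X] \<omega> ws ws' hX(8)[OF j opr] by (simp add: equalities_on_def)
      qed
    qed
  next
    fix X a assume X: "X \<in> Gamma0 \<Theta>" and a: "a \<in> hcarr Q X"
    show "hsub Q X X (id_hom (W \<Theta> X)) a = a"
      by (rule inj[OF X]) (simp_all add: cl ho X a subs_id c2)
  next
    fix X Y Z s t a
    assume XYZ: "X \<in> Gamma0 \<Theta>" "Y \<in> Gamma0 \<Theta>" "Z \<in> Gamma0 \<Theta>"
      and st: "s \<in> subs \<Theta> X Y" "t \<in> subs \<Theta> Y Z" and a: "a \<in> hcarr Q X"
    show "hsub Q X Z (comp_hom (W \<Theta> X) t s) a = hsub Q Y Z t (hsub Q X Y s a)"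
      by (rule inj[OF XYZ(3)]) (simp_all add: cl ho XYZ st a subs_comp[OF st] c3[rule_format, OF _ XYZ st])
  next
    fix X Y s assume XY: "X \<in> Gamma0 \<Theta>" "Y \<in> Gamma0 \<Theta>" and s: "s \<in> subs \<Theta> X Y"
    note S = c4[rule_format, OF _ XY s] and D = cl[OF XY(1)] cl[OF XY(2)] ho[OF _ XY(1)] ho[OF _ XY(2)] XY s
    show "hsub Q X Y s (hbot Q X) = hbot Q Y" "hsub Q X Y s (htop Q X) = htop Q Y"
      by (rule inj[OF XY(2)]; simp add: D S)+
    fix a assume a: "a \<in> hcarr Q X"
    show "hsub Q X Y s (hneg Q X a) = hneg Q Y (hsub Q X Y s a)"
      by (rule inj[OF XY(2)]; simp add: D S a)
    fix b assume b: "b \<in> hcarr Q X"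
    show "hsub Q X Y s (hjoin Q X a b) = hjoin Q Y (hsub Q X Y s a) (hsub Q X Y s b)"
      "hsub Q X Y s (hmeet Q X a b) = hmeet Q Y (hsub Q X Y s a) (hsub Q X Y s b)"
      by (rule inj[OF XY(2)]; simp add: D S a b)+
  next
    fix X Y s\<^sub>1 s\<^sub>2 x a
    assume as: "X \<in> Gamma0 \<Theta>" "Y \<in> Gamma0 \<Theta>" "s\<^sub>1 \<in> subs \<Theta> X Y" "s\<^sub>2 \<in> subs \<Theta> X Y" "x \<in> X" "a \<in> hcarr Q X"
      and agree: "\<forall>y\<in>X. y \<noteq> x \<longrightarrow> app_var \<Theta> X s\<^sub>1 y = app_var \<Theta> X s\<^sub>2 y"
    show "hsub Q X Y s\<^sub>1 (hex Q X x a) = hsub Q X Y s\<^sub>2 (hex Q X x a)"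
      by (rule inj[OF as(2)])
        (simp_all add: cl ho as, rule c5[rule_format, OF _ as(1-5)], simp_all add: ho as agree)
  next
    fix X Y s x y a
    assume as: "X \<in> Gamma0 \<Theta>" "Y \<in> Gamma0 \<Theta>" "s \<in> subs \<Theta> X Y" "x \<in> X" "y \<in> Y" "a \<in> hcarr Q X"
      and supp: "vsort \<Theta> y = vsort \<Theta> x \<and> app_var \<Theta> X s x = gen \<Theta> Y y \<and>
        (\<forall>x'\<in>X. x' \<noteq> x \<longrightarrow> y \<notin> support (app_var \<Theta> X s x'))"
    show "hsub Q X Y s (hex Q X x a) = hex Q Y y (hsub Q X Y s a)"
      by (rule inj[OF as(2)])
        (simp_all add: cl ho as, rule c6[rule_format, OF _ as(1-5)], simp_all add: ho as supp)
  next
    fix X Y s i w w'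
    assume as: "X \<in> Gamma0 \<Theta>" "Y \<in> Gamma0 \<Theta>" "s \<in> subs \<Theta> X Y" "w \<in> carr (W \<Theta> X) i" "w' \<in> carr (W \<Theta> X) i"
    have "s i w \<in> carr (W \<Theta> Y) i" "s i w' \<in> carr (W \<Theta> Y) i"
      using as by (auto simp: subs_def HomD_carr)
    then show "hsub Q X Y s (heq Q X i w w') = heq Q Y i (s i w) (s i w')"
      by (intro inj[OF as(2)]) (simp_all add: cl ho as c7)
  next
    fix X x w w' s s' a
    assume as: "X \<in> Gamma0 \<Theta>" "x \<in> X" "w \<in> carr (W \<Theta> X) (vsort \<Theta> x)" "w' \<in> carr (W \<Theta> X) (vsort \<Theta> x)"
      and ss: "is_single_sub \<Theta> X x w s \<and> is_single_sub \<Theta> X x w' s'" and a: "a \<in> hcarr Q X"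
    have "s \<in> subs \<Theta> X X" "s' \<in> subs \<Theta> X X" using ss by (auto simp: is_single_sub_def)
    then show "hle Q X (hmeet Q X (hsub Q X X s a) (heq Q X (vsort \<Theta> x) w w')) (hsub Q X X s' a)"
      by (intro le[OF as(1)]) (simp_all add: cl ho as a c8[rule_format, OF _ as ss])
  qed
qed

section \<open>The universal property of the algebra of formulas\<close>

lemma closed_ops_fm_alg: "closed_ops \<Theta> (fm_alg \<Theta> \<Phi>)"
  by (auto simp: closed_ops_def fm_alg_def intro: wff.intros)

lemma hcarr_fm_alg: "hcarr (fm_alg \<Theta> \<Phi>) X = {u. wff \<Theta> \<Phi> X u}"
  by (simp add: fm_alg_def)

text \<open>The admissible relations, whose intersection is \<^const>\<open>fm_cong\<close>.\<close>

definition formula_congruence :: "('s, 'o, 'x) variety \<Rightarrow> ('p, 's) rels \<Rightarrow>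
    ('x set \<Rightarrow> (('s, 'o, 'x, 'p) fm \<times> ('s, 'o, 'x, 'p) fm) set) \<Rightarrow> bool" where
  "formula_congruence \<Theta> \<Phi> R \<longleftrightarrow>
     hal_congruence \<Theta> (fm_alg \<Theta> \<Phi>) R \<and> halmos_algebra \<Theta> (hal_quot (fm_alg \<Theta> \<Phi>) R) \<and>
     (\<forall>Y\<in>Gamma0 \<Theta>. \<forall>Z\<in>Gamma0 \<Theta>. \<forall>s\<in>subs \<Theta> Y Z. \<forall>\<phi>\<in>syms \<Phi>. \<forall>ws\<in>tuples (carr (W \<Theta> Y)) (rtype \<Phi> \<phi>).
        (Sub Y s (Atom \<phi> ws), Atom \<phi> (map2 s (rtype \<Phi> \<phi>) ws)) \<in> R Z)"

lemma mem_fm_cong: "(u, v) \<in> fm_cong \<Theta> \<Phi> X \<longleftrightarrow> (\<forall>R. formula_congruence \<Theta> \<Phi> R \<longrightarrow> (u, v) \<in> R X)"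
  unfolding fm_cong_def formula_congruence_def by auto

lemma fm_eval_in_carr:
  assumes H: "closed_ops \<Theta> H"
    and a: "\<And>X \<phi> ws. X \<in> Gamma0 \<Theta> \<Longrightarrow> \<phi> \<in> syms \<Phi> \<Longrightarrow> ws \<in> tuples (carr (W \<Theta> X)) (rtype \<Phi> \<phi>) \<Longrightarrow> a X \<phi> ws \<in> hcarr H X"
    and u: "wff \<Theta> \<Phi> X u" and X: "X \<in> Gamma0 \<Theta>"
  shows "fm_eval H a u X \<in> hcarr H X"
  using u X by (induction rule: wff.induct) (auto simp: closed_opsD[OF H] a)

lemma fm_eval_hom:
  assumes H: "closed_ops \<Theta> H"
    and a: "\<And>X \<phi> ws. X \<in> Gamma0 \<Theta> \<Longrightarrow> \<phi> \<in> syms \<Phi> \<Longrightarrow> ws \<in> tuples (carr (W \<Theta> X)) (rtype \<Phi> \<phi>) \<Longrightarrow> a X \<phi> ws \<in> hcarr H X"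
  shows "hal_hom \<Theta> (fm_alg \<Theta> \<Phi>) H (\<lambda>X u. fm_eval H a u X)"
  using fm_eval_in_carr[OF H a] by (auto simp: hal_hom_def fm_alg_def)

abbreviation fm_class :: "('s, 'o, 'x) variety \<Rightarrow> ('p, 's) rels \<Rightarrow> 'x set \<Rightarrow> ('s, 'o, 'x, 'p) fm \<Rightarrow>
    ('s, 'o, 'x, 'p) fm set" where
  "fm_class \<Theta> \<Phi> X u \<equiv> fm_cong \<Theta> \<Phi> X `` {u}"

lemma hal_congruence_total: "closed_ops \<Theta> H \<Longrightarrow> hal_congruence \<Theta> H (\<lambda>X. hcarr H X \<times> hcarr H X)"
  unfolding hal_congruence_def
  by (auto simp: closed_opsD equiv_def refl_on_def sym_def trans_def)

context wf_var
begin

text \<open>The total relation is admissible, so the intersection that defines \<^const>\<open>fm_cong\<close> ranges over a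
  nonempty family.\<close>

lemma formula_congruence_total:
  "formula_congruence \<Theta> \<Phi> (\<lambda>X. hcarr (fm_alg \<Theta> \<Phi>) X \<times> hcarr (fm_alg \<Theta> \<Phi>) X)"
  (is "formula_congruence _ _ ?R")
proof -
  note cong = hal_congruence_total[OF closed_ops_fm_alg]
  have "halmos_algebra \<Theta> (hal_quot (fm_alg \<Theta> \<Phi>) ?R)"
    by (rule halmos_algebra_subdirect[OF closed_ops_hal_quot[OF closed_ops_fm_alg cong], where J = "{}"])
      (auto simp: hal_quot_def quotient_def)
  moreover have "(Sub Y s (Atom \<phi> ws), Atom \<phi> (map2 s (rtype \<Phi> \<phi>) ws)) \<in> ?R Z"
    if "Y \<in> Gamma0 \<Theta>" "s \<in> subs \<Theta> Y Z" "\<phi> \<in> syms \<Phi>" "ws \<in> tuples (carr (W \<Theta> Y)) (rtype \<Phi> \<phi>)" for Y Z s \<phi> ws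
    using that map2_tuples[of s \<Theta> "W \<Theta> Y" "W \<Theta> Z" ws]
    by (auto simp: fm_alg_def subs_def intro!: wff.intros)
  ultimately show ?thesis using cong by (simp add: formula_congruence_def)
qed

lemma hal_congruence_fm_cong: "hal_congruence \<Theta> (fm_alg \<Theta> \<Phi>) (fm_cong \<Theta> \<Phi>)"
proof -
  let ?F = "formula_congruence \<Theta> \<Phi>"
  have cong: "hal_congruence \<Theta> (fm_alg \<Theta> \<Phi>) R" if "?F R" for R
    using that by (simp add: formula_congruence_def)
  note D = hal_congruenceD[OF closed_ops_fm_alg cong]
  show ?thesis
    unfolding hal_congruence_def
  proof (intro ballI conjI)
    fix X assume X: "X \<in> Gamma0 \<Theta>"
    show "equiv (hcarr (fm_alg \<Theta> \<Phi>) X) (fm_cong \<Theta> \<Phi> X)"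
    proof (rule equivI)
      show "fm_cong \<Theta> \<Phi> X \<subseteq> hcarr (fm_alg \<Theta> \<Phi>) X \<times> hcarr (fm_alg \<Theta> \<Phi>) X"
      proof (rule subrelI)
        fix u v assume "(u, v) \<in> fm_cong \<Theta> \<Phi> X"
        from this[unfolded mem_fm_cong, rule_format, OF formula_congruence_total]
        show "(u, v) \<in> hcarr (fm_alg \<Theta> \<Phi>) X \<times> hcarr (fm_alg \<Theta> \<Phi>) X" .
      qed
      show "refl_on (hcarr (fm_alg \<Theta> \<Phi>) X) (fm_cong \<Theta> \<Phi> X)"
        using D(1)[OF _ X] by (auto simp: refl_on_def equiv_def mem_fm_cong)
      show "sym (fm_cong \<Theta> \<Phi> X)"
        using D(1)[OF _ X] by (auto simp: sym_def equiv_def mem_fm_cong)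
      show "trans (fm_cong \<Theta> \<Phi> X)"
        using D(1)[OF _ X] unfolding trans_def equiv_def mem_fm_cong by blast
    qed
  qed (use D(2-6) in \<open>auto simp: mem_fm_cong\<close>)
qed

lemma hcarr_Hal\<Phi>: "hcarr (Hal\<Phi> \<Theta> \<Phi>) X = fm_class \<Theta> \<Phi> X ` {u. wff \<Theta> \<Phi> X u}"
  unfolding Hal\<Phi>_def hcarr_hal_quot[OF closed_ops_fm_alg hal_congruence_fm_cong] by (simp add: fm_alg_def)

lemma hal_hom_fm_class: "hal_hom \<Theta> (fm_alg \<Theta> \<Phi>) (Hal\<Phi> \<Theta> \<Phi>) (fm_class \<Theta> \<Phi>)"
  unfolding Hal\<Phi>_def by (rule hal_quot_proj[OF closed_ops_fm_alg hal_congruence_fm_cong])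

lemma fm_class_eq_iff:
  "X \<in> Gamma0 \<Theta> \<Longrightarrow> wff \<Theta> \<Phi> X u \<Longrightarrow> wff \<Theta> \<Phi> X v \<Longrightarrow>
    fm_class \<Theta> \<Phi> X u = fm_class \<Theta> \<Phi> X v \<longleftrightarrow> (u, v) \<in> fm_cong \<Theta> \<Phi> X"
  using eq_equiv_class_iff[OF hal_congruenceD(1)[OF closed_ops_fm_alg hal_congruence_fm_cong]]
  by (simp add: fm_alg_def)

text \<open>\<open>Hal\<^sub>\<Theta>(\<Phi>)\<close> is a subdirect product of the quotients by the admissible congruences.\<close>

lemma halmos_Hal\<Phi>: "halmos_algebra \<Theta> (Hal\<Phi> \<Theta> \<Phi>)"
proof -
  let ?F = "fm_alg \<Theta> \<Phi>"
  let ?q = "\<lambda>R X A. the_elem ((\<lambda>u. R X `` {u}) ` A)"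
  have fc: "hal_congruence \<Theta> ?F R" "halmos_algebra \<Theta> (hal_quot ?F R)" if "formula_congruence \<Theta> \<Phi> R" for R
    using that by (auto simp: formula_congruence_def)
  have cls: "R X `` {u} = R X `` {v}"
    if "formula_congruence \<Theta> \<Phi> R" "X \<in> Gamma0 \<Theta>" "(u, v) \<in> fm_cong \<Theta> \<Phi> X" for R X u v
    using that hal_congruence_class_eq[OF closed_ops_fm_alg fc(1)] mem_fm_cong by metis
  have val: "?q R X (fm_class \<Theta> \<Phi> X u) = R X `` {u}"
    if "formula_congruence \<Theta> \<Phi> R" "X \<in> Gamma0 \<Theta>" "wff \<Theta> \<Phi> X u" for R X u
    by (rule hal_quot_value[OF closed_ops_fm_alg hal_congruence_fm_cong that(2)])
      (use that cls[OF that(1,2)] in \<open>auto simp: fm_alg_def\<close>)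
  show ?thesis
    unfolding Hal\<Phi>_def
  proof (rule halmos_algebra_subdirect)
    show "closed_ops \<Theta> (hal_quot ?F (fm_cong \<Theta> \<Phi>))"
      by (rule closed_ops_hal_quot[OF closed_ops_fm_alg hal_congruence_fm_cong])
    fix R assume R: "R \<in> Collect (formula_congruence \<Theta> \<Phi>)"
    show "halmos_algebra \<Theta> (hal_quot ?F R)" using fc R by blast
    show "hal_hom \<Theta> (hal_quot ?F (fm_cong \<Theta> \<Phi>)) (hal_quot ?F R) (?q R)"
      using R cls fc by (intro hal_quot_induced[OF closed_ops_fm_alg hal_congruence_fm_cong] hal_quot_proj
          closed_ops_fm_alg) auto
  next
    fix X A B assume X: "X \<in> Gamma0 \<Theta>"
      and A: "A \<in> hcarr (hal_quot ?F (fm_cong \<Theta> \<Phi>)) X" and B: "B \<in> hcarr (hal_quot ?F (fm_cong \<Theta> \<Phi>)) X"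
      and eq: "\<And>R. R \<in> Collect (formula_congruence \<Theta> \<Phi>) \<Longrightarrow> ?q R X A = ?q R X B"
    obtain u where u: "wff \<Theta> \<Phi> X u" "A = fm_class \<Theta> \<Phi> X u"
      using A[folded Hal\<Phi>_def] unfolding hcarr_Hal\<Phi> by blast
    obtain v where v: "wff \<Theta> \<Phi> X v" "B = fm_class \<Theta> \<Phi> X v"
      using B[folded Hal\<Phi>_def] unfolding hcarr_Hal\<Phi> by blast
    have "(u, v) \<in> R X" if R: "formula_congruence \<Theta> \<Phi> R" for R
    proof -
      have "R X `` {u} = R X `` {v}" using eq[of R] val[OF R X] u v R by simp
      then show ?thesis
        using eq_equiv_class_iff[OF hal_congruenceD(1)[OF closed_ops_fm_alg fc(1)[OF R] X]] u v
        by (simp add: fm_alg_def)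
    qed
    then show "A = B" using fm_class_eq_iff[OF X u(1) v(1)] u v by (simp add: mem_fm_cong)
  qed
qed

lemma Hal\<Phi>_sub_atom:
  assumes "Y \<in> Gamma0 \<Theta>" "Z \<in> Gamma0 \<Theta>" "s \<in> subs \<Theta> Y Z" "\<phi> \<in> syms \<Phi>" "ws \<in> tuples (carr (W \<Theta> Y)) (rtype \<Phi> \<phi>)"
  shows "hsub (Hal\<Phi> \<Theta> \<Phi>) Y Z s (fm_class \<Theta> \<Phi> Y (Atom \<phi> ws)) =
    fm_class \<Theta> \<Phi> Z (Atom \<phi> (map2 s (rtype \<Phi> \<phi>) ws))"
proof -
  have u: "wff \<Theta> \<Phi> Y (Atom \<phi> ws)" using assms by (auto intro: wff.intros)
  have v: "wff \<Theta> \<Phi> Z (Atom \<phi> (map2 s (rtype \<Phi> \<phi>) ws))"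
    using assms by (auto simp: subs_def intro!: wff.intros map2_tuples[where \<Theta> = \<Theta>])
  have "hsub (Hal\<Phi> \<Theta> \<Phi>) Y Z s (fm_class \<Theta> \<Phi> Y (Atom \<phi> ws)) = fm_class \<Theta> \<Phi> Z (Sub Y s (Atom \<phi> ws))"
    using hal_hom_sub[OF hal_hom_fm_class assms(1-3), of "Atom \<phi> ws" \<Phi>] u by (simp add: fm_alg_def)
  also have "\<dots> = fm_class \<Theta> \<Phi> Z (Atom \<phi> (map2 s (rtype \<Phi> \<phi>) ws))"
    using fm_class_eq_iff[OF assms(2) wff_Sub[OF assms(1,3) u] v] assms
    by (simp add: mem_fm_cong formula_congruence_def)
  finally show ?thesis .
qed

text \<open>Every assignment of the atoms in a Halmos algebra that commutes with the operations \<open>s\<^sub>*\<close> extends to a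
  homomorphism, since the kernel of the evaluation of terms is an admissible congruence.\<close>

lemma Hal\<Phi>_induced:
  fixes H :: "('s, 'o, 'x, 'h) hal" and \<Phi> :: "('p, 's) rels"
  assumes H: "halmos_algebra \<Theta> H"
    and a: "\<And>X \<phi> ws. X \<in> Gamma0 \<Theta> \<Longrightarrow> \<phi> \<in> syms \<Phi> \<Longrightarrow> ws \<in> tuples (carr (W \<Theta> X)) (rtype \<Phi> \<phi>) \<Longrightarrow> a X \<phi> ws \<in> hcarr H X"
    and sub: "\<And>Y Z s \<phi> ws. Y \<in> Gamma0 \<Theta> \<Longrightarrow> Z \<in> Gamma0 \<Theta> \<Longrightarrow> s \<in> subs \<Theta> Y Z \<Longrightarrow> \<phi> \<in> syms \<Phi> \<Longrightarrow>
      ws \<in> tuples (carr (W \<Theta> Y)) (rtype \<Phi> \<phi>) \<Longrightarrow> hsub H Y Z s (a Y \<phi> ws) = a Z \<phi> (map2 s (rtype \<Phi> \<phi>) ws)"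
  shows "hal_hom \<Theta> (Hal\<Phi> \<Theta> \<Phi>) H (\<lambda>X U. the_elem ((\<lambda>u. fm_eval H a u X) ` U))"
    and "X \<in> Gamma0 \<Theta> \<Longrightarrow> wff \<Theta> \<Phi> X u \<Longrightarrow> the_elem ((\<lambda>u. fm_eval H a u X) ` fm_class \<Theta> \<Phi> X u) = fm_eval H a u X"
proof -
  let ?F = "fm_alg \<Theta> \<Phi>" and ?e = "\<lambda>X u. fm_eval H a u X"
  let ?R = "hal_kernel ?F ?e"
  have ev: "hal_hom \<Theta> ?F H ?e" by (rule fm_eval_hom[OF halmos_closed[OF H]]) (rule a)
  note cong = hal_congruence_kernel[OF closed_ops_fm_alg ev]
  have hom: "hal_hom \<Theta> (hal_quot ?F ?R) H (\<lambda>X A. the_elem (?e X ` A))"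
    by (rule hal_quot_induced[OF closed_ops_fm_alg cong ev]) (auto simp: hal_kernel_def)
  have val: "the_elem (?e X ` (?R X `` {u})) = ?e X u" if "X \<in> Gamma0 \<Theta>" "wff \<Theta> \<Phi> X u" for X u
    by (rule hal_quot_value[OF closed_ops_fm_alg cong that(1)]) (use that in \<open>auto simp: hal_kernel_def fm_alg_def\<close>)
  have hal: "halmos_algebra \<Theta> (hal_quot ?F ?R)"
  proof (rule halmos_algebra_subdirect[where J = "UNIV :: unit set"])
    show "closed_ops \<Theta> (hal_quot ?F ?R)" by (rule closed_ops_hal_quot[OF closed_ops_fm_alg cong])
    show "hal_hom \<Theta> (hal_quot ?F ?R) H (\<lambda>X A. the_elem (?e X ` A))" by (rule hom)
    show "halmos_algebra \<Theta> H" by (rule H)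
  next
    fix X A B assume X: "X \<in> Gamma0 \<Theta>"
      and A: "A \<in> hcarr (hal_quot ?F ?R) X" and B: "B \<in> hcarr (hal_quot ?F ?R) X"
      and eq: "\<And>j :: unit. j \<in> UNIV \<Longrightarrow> the_elem (?e X ` A) = the_elem (?e X ` B)"
    obtain u where u: "wff \<Theta> \<Phi> X u" "A = ?R X `` {u}"
      using A unfolding hcarr_hal_quot[OF closed_ops_fm_alg cong] hcarr_fm_alg by blast
    obtain v where v: "wff \<Theta> \<Phi> X v" "B = ?R X `` {v}"
      using B unfolding hcarr_hal_quot[OF closed_ops_fm_alg cong] hcarr_fm_alg by blast
    have "?e X u = ?e X v" using eq[of "()"] val[OF X] u v by simp
    then show "A = B" using u v by (auto simp: hal_kernel_def hcarr_fm_alg)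
  qed
  have "(Sub Y s (Atom \<phi> ws), Atom \<phi> (map2 s (rtype \<Phi> \<phi>) ws)) \<in> ?R Z"
    if "Y \<in> Gamma0 \<Theta>" "Z \<in> Gamma0 \<Theta>" "s \<in> subs \<Theta> Y Z" "\<phi> \<in> syms \<Phi>" "ws \<in> tuples (carr (W \<Theta> Y)) (rtype \<Phi> \<phi>)"
    for Y Z s \<phi> ws
    using that map2_tuples[of s \<Theta> "W \<Theta> Y" "W \<Theta> Z" ws] sub[OF that]
    by (auto simp: hal_kernel_def fm_alg_def subs_def intro!: wff.intros)
  then have "formula_congruence \<Theta> \<Phi> ?R" using cong hal by (simp add: formula_congruence_def)
  then have ker: "?e X u = ?e X v" if "(u, v) \<in> fm_cong \<Theta> \<Phi> X" for X u v
    using that by (auto simp: mem_fm_cong hal_kernel_def)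
  show "hal_hom \<Theta> (Hal\<Phi> \<Theta> \<Phi>) H (\<lambda>X U. the_elem (?e X ` U))"
    unfolding Hal\<Phi>_def
    by (rule hal_quot_induced[OF closed_ops_fm_alg hal_congruence_fm_cong ev]) (use ker in auto)
  show "the_elem (?e X ` fm_class \<Theta> \<Phi> X u) = ?e X u" if "X \<in> Gamma0 \<Theta>" "wff \<Theta> \<Phi> X u"
    by (rule hal_quot_value[OF closed_ops_fm_alg hal_congruence_fm_cong that(1)])
      (use that ker in \<open>auto simp: fm_alg_def\<close>)
qed

text \<open>The atoms generate the algebra of formulas.\<close>

lemma Hal\<Phi>_hom_eqI:
  assumes g: "hal_hom \<Theta> (Hal\<Phi> \<Theta> \<Phi>) H g" and h: "hal_hom \<Theta> (Hal\<Phi> \<Theta> \<Phi>) H h"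
    and atoms: "\<And>X \<phi> ws. X \<in> Gamma0 \<Theta> \<Longrightarrow> \<phi> \<in> syms \<Phi> \<Longrightarrow> ws \<in> tuples (carr (W \<Theta> X)) (rtype \<Phi> \<phi>) \<Longrightarrow>
      g X (fm_class \<Theta> \<Phi> X (Atom \<phi> ws)) = h X (fm_class \<Theta> \<Phi> X (Atom \<phi> ws))"
    and X: "X \<in> Gamma0 \<Theta>" and U: "U \<in> hcarr (Hal\<Phi> \<Theta> \<Phi>) X"
  shows "g X U = h X U"
proof -
  note G = hal_homD[OF hal_hom_comp[OF hal_hom_fm_class g], unfolded fm_alg_def hal.select_convs mem_Collect_eq]
    and H = hal_homD[OF hal_hom_comp[OF hal_hom_fm_class h], unfolded fm_alg_def hal.select_convs mem_Collect_eq]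
  have "g X (fm_class \<Theta> \<Phi> X u) = h X (fm_class \<Theta> \<Phi> X u)" if "wff \<Theta> \<Phi> X u" for u
    using that X by (induction rule: wff.induct) (simp_all add: G H atoms)
  then show ?thesis using U unfolding hcarr_Hal\<Phi> by blast
qed

section \<open>Algebras of formulas are projective\<close>

lemma distinct_vars_exist:
  obtains xs where "distinct xs" and "set xs \<subseteq> vars \<Theta>" and "map (vsort \<Theta>) xs = is"
proof -
  have "\<exists>xs. distinct xs \<and> set xs \<subseteq> vars \<Theta> \<and> map (vsort \<Theta>) xs = is"
  proof (induction "is")
    case (Cons i "is")
    then obtain xs where xs: "distinct xs" "set xs \<subseteq> vars \<Theta>" "map (vsort \<Theta>) xs = is" by blast
    have "infinite ({x \<in> vars \<Theta>. vsort \<Theta> x = i} - set xs)"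
      using wf by (intro Diff_infinite_finite) (auto simp: wf_variety_def)
    then obtain x where "x \<in> {x \<in> vars \<Theta>. vsort \<Theta> x = i} - set xs"
      using infinite_imp_nonempty by blast
    then show ?case using xs by (intro exI[of _ "x # xs"]) auto
  qed simp
  then show ?thesis using that by blast
qed

lemma map2_gen: "map2 s (map (vsort \<Theta>) xs) (map (gen \<Theta> X) xs) = map (app_var \<Theta> X s) xs"
  by (rule nth_equalityI) (auto simp: app_var_def)

lemma gens_in_tuples: "map (gen \<Theta> (set xs)) xs \<in> tuples (carr (W \<Theta> (set xs))) (map (vsort \<Theta>) xs)"
  by (auto simp: tuples_def list_all2_conv_all_nth intro: gen_in_carr)

lemma sub_with_values_exists:
  assumes xs: "distinct xs" and ws: "ws \<in> tuples (carr (W \<Theta> X)) (map (vsort \<Theta>) xs)"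
  shows "\<exists>s. s \<in> subs \<Theta> (set xs) X \<and> map2 s (map (vsort \<Theta>) xs) (map (gen \<Theta> (set xs)) xs) = ws"
proof -
  have len: "length ws = length xs" and nth: "\<And>n. n < length xs \<Longrightarrow> ws ! n \<in> carr (W \<Theta> X) (vsort \<Theta> (xs ! n))"
    using ws by (auto simp: tuples_def list_all2_conv_all_nth)
  define \<rho> where "\<rho> = (\<lambda>x. the (map_of (zip xs ws) x))"
  have \<rho>: "\<rho> (xs ! n) = ws ! n" if "n < length xs" for n
    using that xs len by (simp add: \<rho>_def map_of_zip_nth)
  have "\<rho> x \<in> carr (W \<Theta> X) (vsort \<Theta> x)" if "x \<in> set xs" for x
    using that \<rho> nth by (auto simp: in_set_conv_nth)
  then obtain s where s: "s \<in> subs \<Theta> (set xs) X" "\<And>x. x \<in> set xs \<Longrightarrow> app_var \<Theta> (set xs) s x = \<rho> x"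
    unfolding subs_def using Hom_W_exists[OF in_variety_W, of "set xs" \<rho> X] by blast
  have "map (app_var \<Theta> (set xs) s) xs = ws"
    using s(2) \<rho> len by (auto intro!: nth_equalityI)
  then show ?thesis using s(1) map2_gen by metis
qed

lemma sub_eqI:
  assumes "s \<in> subs \<Theta> (set xs) X" and "s' \<in> subs \<Theta> (set xs) X"
    and "map2 s (map (vsort \<Theta>) xs) (map (gen \<Theta> (set xs)) xs) = map2 s' (map (vsort \<Theta>) xs) (map (gen \<Theta> (set xs)) xs)"
  shows "s = s'"
  using assms unfolding subs_def map2_gen by (intro Hom_W_eqI[of s _ _ s']) auto

text \<open>A relation symbol \<open>\<phi>\<close> contributes a single free generator, the atom \<open>\<phi>(x\<^sub>1, \<dots>, x\<^sub>n)\<close> over distinct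
  variables: every other atom is \<open>\<phi>(w\<^sub>1, \<dots>, w\<^sub>n) = s\<^sub>* \<phi>(x\<^sub>1, \<dots>, x\<^sub>n)\<close> for the unique \<open>s\<close> with
  \<open>s x\<^sub>j = w\<^sub>j\<close>.  So a lift is determined by free choices of preimages of these generators, and
  functoriality of \<open>s \<mapsto> s\<^sub>*\<close> makes it compatible with substitution.\<close>

lemma Hal\<Phi>_projective:
  assumes K: "halmos_algebra \<Theta> K" and q: "hal_hom \<Theta> K L q"
    and onto: "\<And>X. X \<in> Gamma0 \<Theta> \<Longrightarrow> hcarr L X \<subseteq> q X ` hcarr K X"
    and g: "hal_hom \<Theta> (Hal\<Phi> \<Theta> \<Phi>) L g"
  obtains \<beta> where "hal_hom \<Theta> (Hal\<Phi> \<Theta> \<Phi>) K \<beta>"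
    and "\<And>X U. X \<in> Gamma0 \<Theta> \<Longrightarrow> U \<in> hcarr (Hal\<Phi> \<Theta> \<Phi>) X \<Longrightarrow> q X (\<beta> X U) = g X U"
proof -
  have "\<forall>\<phi>. \<exists>xs. distinct xs \<and> set xs \<subseteq> vars \<Theta> \<and> map (vsort \<Theta>) xs = rtype \<Phi> \<phi>"
    using distinct_vars_exist by metis
  then obtain xs where xs: "\<And>\<phi>. distinct (xs \<phi>)" "\<And>\<phi>. set (xs \<phi>) \<subseteq> vars \<Theta>"
    "\<And>\<phi>. map (vsort \<Theta>) (xs \<phi>) = rtype \<Phi> \<phi>" by metis
  define S where "S \<phi> = set (xs \<phi>)" for \<phi>
  define gs where "gs \<phi> = map (gen \<Theta> (S \<phi>)) (xs \<phi>)" for \<phi>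
  have S: "S \<phi> \<in> Gamma0 \<Theta>" for \<phi> using xs(2) by (simp add: S_def Gamma0_def)
  have gs: "gs \<phi> \<in> tuples (carr (W \<Theta> (S \<phi>))) (rtype \<Phi> \<phi>)" for \<phi>
    using gens_in_tuples[of "xs \<phi>"] xs(3) by (simp add: gs_def S_def)
  let ?gen = "\<lambda>\<phi>. fm_class \<Theta> \<Phi> (S \<phi>) (Atom \<phi> (gs \<phi>))"
  have gen: "?gen \<phi> \<in> hcarr (Hal\<Phi> \<Theta> \<Phi>) (S \<phi>)" if "\<phi> \<in> syms \<Phi>" for \<phi>
    unfolding hcarr_Hal\<Phi> using that gs by (auto intro: wff.intros)
  have "\<forall>\<phi>\<in>syms \<Phi>. \<exists>k\<in>hcarr K (S \<phi>). q (S \<phi>) k = g (S \<phi>) (?gen \<phi>)"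
  proof
    fix \<phi> assume "\<phi> \<in> syms \<Phi>"
    from subsetD[OF onto[OF S] hal_hom_carr[OF g S gen[OF this]]]
    show "\<exists>k\<in>hcarr K (S \<phi>). q (S \<phi>) k = g (S \<phi>) (?gen \<phi>)" by force
  qed
  then obtain k where k: "\<And>\<phi>. \<phi> \<in> syms \<Phi> \<Longrightarrow> k \<phi> \<in> hcarr K (S \<phi>)"
    "\<And>\<phi>. \<phi> \<in> syms \<Phi> \<Longrightarrow> q (S \<phi>) (k \<phi>) = g (S \<phi>) (?gen \<phi>)" by metis
  define sb where "sb X \<phi> ws = (SOME s. s \<in> subs \<Theta> (S \<phi>) X \<and> map2 s (rtype \<Phi> \<phi>) (gs \<phi>) = ws)" for X \<phi> ws
  have sb: "sb X \<phi> ws \<in> subs \<Theta> (S \<phi>) X \<and> map2 (sb X \<phi> ws) (rtype \<Phi> \<phi>) (gs \<phi>) = ws"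
    if "ws \<in> tuples (carr (W \<Theta> X)) (rtype \<Phi> \<phi>)" for X \<phi> ws
    unfolding sb_def using sub_with_values_exists[OF xs(1)[of \<phi>], of ws X] that xs(3)[of \<phi>]
    by (intro someI_ex[of "\<lambda>s. s \<in> subs \<Theta> (S \<phi>) X \<and> map2 s (rtype \<Phi> \<phi>) (gs \<phi>) = ws"])
      (simp add: gs_def S_def)
  have uniq: "s = sb X \<phi> (map2 s (rtype \<Phi> \<phi>) (gs \<phi>))" if s: "s \<in> subs \<Theta> (S \<phi>) X" for s X \<phi>
  proof -
    from sb[OF map2_tuples[OF s[unfolded subs_def] gs]] show ?thesis
      using s sub_eqI[of s "xs \<phi>" X] xs(3)[of \<phi>] by (simp add: gs_def S_def)
  qed
  define a where "a X \<phi> ws = hsub K (S \<phi>) X (sb X \<phi> ws) (k \<phi>)" for X \<phi> ws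
  have a: "a X \<phi> ws \<in> hcarr K X"
    if "X \<in> Gamma0 \<Theta>" "\<phi> \<in> syms \<Phi>" "ws \<in> tuples (carr (W \<Theta> X)) (rtype \<Phi> \<phi>)" for X \<phi> ws
    using that sb k(1) closed_sub[OF halmos_closed[OF K] S] by (simp add: a_def)
  have sub: "hsub K Y Z t (a Y \<phi> ws) = a Z \<phi> (map2 t (rtype \<Phi> \<phi>) ws)"
    if YZ: "Y \<in> Gamma0 \<Theta>" "Z \<in> Gamma0 \<Theta>" and t: "t \<in> subs \<Theta> Y Z" and \<phi>: "\<phi> \<in> syms \<Phi>"
      and ws: "ws \<in> tuples (carr (W \<Theta> Y)) (rtype \<Phi> \<phi>)" for Y Z t \<phi> ws
  proof -
    let ?s = "sb Y \<phi> ws"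
    have s: "?s \<in> subs \<Theta> (S \<phi>) Y" "map2 ?s (rtype \<Phi> \<phi>) (gs \<phi>) = ws" using sb[OF ws] by auto
    have "comp_hom (W \<Theta> (S \<phi>)) t ?s = sb Z \<phi> (map2 t (rtype \<Phi> \<phi>) ws)"
      using uniq[OF subs_comp[OF s(1) t]] map2_comp_hom[OF gs[of \<phi>], of t ?s] s(2) by simp
    then show ?thesis
      using halmos_sub_comp[OF K S YZ s(1) t k(1)[OF \<phi>]] by (simp add: a_def)
  qed
  define \<beta> where "\<beta> = (\<lambda>X U. the_elem ((\<lambda>u. fm_eval K a u X) ` U))"
  have \<beta>: "hal_hom \<Theta> (Hal\<Phi> \<Theta> \<Phi>) K \<beta>" unfolding \<beta>_def by (rule Hal\<Phi>_induced(1)[OF K]) (fact a sub)+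
  have "q X (\<beta> X U) = g X U" if X: "X \<in> Gamma0 \<Theta>" and U: "U \<in> hcarr (Hal\<Phi> \<Theta> \<Phi>) X" for X U
  proof (rule Hal\<Phi>_hom_eqI[OF hal_hom_comp[OF \<beta> q] g _ X U])
    fix X \<phi> ws
    assume X: "X \<in> Gamma0 \<Theta>" and \<phi>: "\<phi> \<in> syms \<Phi>" and ws: "ws \<in> tuples (carr (W \<Theta> X)) (rtype \<Phi> \<phi>)"
    have s: "sb X \<phi> ws \<in> subs \<Theta> (S \<phi>) X" "map2 (sb X \<phi> ws) (rtype \<Phi> \<phi>) (gs \<phi>) = ws" using sb[OF ws] by auto
    have "\<beta> X (fm_class \<Theta> \<Phi> X (Atom \<phi> ws)) = fm_eval K a (Atom \<phi> ws) X"
      unfolding \<beta>_def by (rule Hal\<Phi>_induced(2)[OF K]) (fact a sub X wff_Atom[OF \<phi> ws])+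
    then have "q X (\<beta> X (fm_class \<Theta> \<Phi> X (Atom \<phi> ws))) = q X (hsub K (S \<phi>) X (sb X \<phi> ws) (k \<phi>))"
      by (simp add: a_def)
    also have "\<dots> = hsub L (S \<phi>) X (sb X \<phi> ws) (g (S \<phi>) (?gen \<phi>))"
      using hal_hom_sub[OF q S X s(1) k(1)[OF \<phi>]] k(2)[OF \<phi>] by simp
    also have "\<dots> = g X (hsub (Hal\<Phi> \<Theta> \<Phi>) (S \<phi>) X (sb X \<phi> ws) (?gen \<phi>))"
      using hal_hom_sub[OF g S X s(1) gen[OF \<phi>]] by simp
    also have "\<dots> = g X (fm_class \<Theta> \<Phi> X (Atom \<phi> ws))"
      using Hal\<Phi>_sub_atom[OF S X s(1) \<phi> gs] s(2) by simp
    finally show "q X (\<beta> X (fm_class \<Theta> \<Phi> X (Atom \<phi> ws))) = g X (fm_class \<Theta> \<Phi> X (Atom \<phi> ws))" .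
  qed
  then show ?thesis using that \<beta> by blast
qed

section \<open>Values of formulas\<close>

text \<open>The value of an atom commutes with \<open>s\<^sub>*\<close> because the point \<open>\<nu> s\<close> takes at \<open>w\<close> the value of \<open>\<nu>\<close> at \<open>s w\<close>.
  Hence the universal property applies, and it shows that all representatives of a formula have one value.\<close>

lemma Val_hom_HalG:
  assumes G: "in_variety \<Theta> (mm_alg M)"
  shows "hal_hom \<Theta> (Hal\<Phi> \<Theta> (mm_rels M)) (HalG \<Theta> (mm_alg M)) (Val \<Theta> M f)"
proof -
  have "Val \<Theta> M f = (\<lambda>X U. the_elem
      ((\<lambda>u. fm_eval (HalG \<Theta> (mm_alg M)) (atom_val \<Theta> (mm_alg M) (mm_rels M) f) u X) ` U))"
    by (intro ext) (simp add: Val_def)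
  moreover have "hal_hom \<Theta> (Hal\<Phi> \<Theta> (mm_rels M)) (HalG \<Theta> (mm_alg M)) \<dots>"
  proof (rule Hal\<Phi>_induced(1)[OF halmos_HalG[OF G]])
    fix Y Z s \<phi> ws
    assume s: "s \<in> subs \<Theta> Y Z" and ws: "ws \<in> tuples (carr (W \<Theta> Y)) (rtype (mm_rels M) \<phi>)"
    show "hsub (HalG \<Theta> (mm_alg M)) Y Z s (atom_val \<Theta> (mm_alg M) (mm_rels M) f Y \<phi> ws) =
        atom_val \<Theta> (mm_alg M) (mm_rels M) f Z \<phi> (map2 s (rtype (mm_rels M) \<phi>) ws)"
      using subs_points[OF s] by (auto simp: HalG_def atom_val_def map2_comp_hom[OF ws])
  qed (auto simp: HalG_def atom_val_def)
  ultimately show ?thesis by simp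
qed

lemma hcarr_R_alg: "hcarr (R_alg \<Theta> M f) X = Val \<Theta> M f X ` hcarr (Hal\<Phi> \<Theta> (mm_rels M)) X"
  by (simp add: R_alg_def)

lemma R_alg_simps:
  "hbot (R_alg \<Theta> M f) X = {}" "htop (R_alg \<Theta> M f) X = points \<Theta> (mm_alg M) X"
  "hjoin (R_alg \<Theta> M f) X A B = A \<union> B" "hmeet (R_alg \<Theta> M f) X A B = A \<inter> B"
  "hneg (R_alg \<Theta> M f) X A = points \<Theta> (mm_alg M) X - A"
  "heq (R_alg \<Theta> M f) X i w w' = {\<mu> \<in> points \<Theta> (mm_alg M) X. \<mu> i w = \<mu> i w'}"
  "hsub (R_alg \<Theta> M f) X Y s A = {\<nu> \<in> points \<Theta> (mm_alg M) Y. comp_hom (W \<Theta> X) \<nu> s \<in> A}"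
  by (simp_all add: R_alg_def HalG_def)

lemma sol_eq: "sol \<Theta> M f X T = points \<Theta> (mm_alg M) X \<inter> \<Inter>(Val \<Theta> M f X ` T)"
  by (auto simp: sol_def)

context
  fixes M :: "('s, 'o, 'a, 'p) multi_model" and f :: "'p \<Rightarrow> 'a list set"
  assumes G: "in_variety \<Theta> (mm_alg M)"
begin

lemma Val_hom: "hal_hom \<Theta> (Hal\<Phi> \<Theta> (mm_rels M)) (R_alg \<Theta> M f) (Val \<Theta> M f)"
  using Val_hom_HalG[OF G, of f] unfolding hal_hom_def R_alg_def by auto

lemma closed_ops_R_alg: "closed_ops \<Theta> (R_alg \<Theta> M f)"
  by (rule closed_ops_image[OF halmos_closed[OF halmos_Hal\<Phi>] Val_hom hcarr_R_alg])

lemma R_alg_subset_points: "X \<in> Gamma0 \<Theta> \<Longrightarrow> A \<in> hcarr (R_alg \<Theta> M f) X \<Longrightarrow> A \<subseteq> points \<Theta> (mm_alg M) X"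
  using hal_hom_carr[OF Val_hom_HalG[OF G]] by (auto simp: hcarr_R_alg HalG_def)

end

section \<open>Isomorphisms of value algebras and of categories of knowledge content\<close>

lemma Ob_L_cat: "(X, T) \<in> Ob (L_cat \<Theta> \<Phi>) \<longleftrightarrow> X \<in> Gamma0 \<Theta> \<and> T \<subseteq> hcarr (Hal\<Phi> \<Theta> \<Phi>) X"
  by (simp add: L_cat_def Let_def)

lemma sol_singleton:
  assumes "in_variety \<Theta> (mm_alg M)" and "X \<in> Gamma0 \<Theta>" and "U \<in> hcarr (Hal\<Phi> \<Theta> (mm_rels M)) X"
  shows "sol \<Theta> M f X {U} = Val \<Theta> M f X U"
  using R_alg_subset_points[OF assms(1,2), of "Val \<Theta> M f X U" f] assms(3) by (auto simp: sol_eq hcarr_R_alg)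

text \<open>The functor of an informational equivalence maps the object \<open>(X, Val\<^sub>f u) = Ct\<^sub>f (X, {u})\<close> to
  \<open>(X, Val (\<beta> u))\<close>; its object part therefore is a well-defined bijection between the value algebras, and it
  inherits the homomorphism property from \<open>\<beta>\<close>.\<close>

lemma hal_iso_of_K_isomorphism:
  assumes G: "in_variety \<Theta> (mm_alg M\<^sub>1)" "in_variety \<Theta> (mm_alg M\<^sub>2)"
    and \<beta>: "hal_hom \<Theta> (Hal\<Phi> \<Theta> (mm_rels M\<^sub>1)) (Hal\<Phi> \<Theta> (mm_rels M\<^sub>2)) \<beta>"
    and \<beta>': "hal_hom \<Theta> (Hal\<Phi> \<Theta> (mm_rels M\<^sub>2)) (Hal\<Phi> \<Theta> (mm_rels M\<^sub>1)) \<beta>'"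
    and inv: "inverse_functors (K_cat \<Theta> M\<^sub>1 f\<^sub>1) (K_cat \<Theta> M\<^sub>2 f\<^sub>2) \<gamma> \<gamma>'"
    and eq: "ftr_eq (L_cat \<Theta> (mm_rels M\<^sub>1)) (ftr_comp \<gamma> (Ct \<Theta> M\<^sub>1 f\<^sub>1)) (ftr_comp (Ct \<Theta> M\<^sub>2 f\<^sub>2) (lift_hom \<beta>))"
    and eq': "ftr_eq (L_cat \<Theta> (mm_rels M\<^sub>2)) (ftr_comp \<gamma>' (Ct \<Theta> M\<^sub>2 f\<^sub>2)) (ftr_comp (Ct \<Theta> M\<^sub>1 f\<^sub>1) (lift_hom \<beta>'))"
  shows "hal_iso \<Theta> (R_alg \<Theta> M\<^sub>1 f\<^sub>1) (R_alg \<Theta> M\<^sub>2 f\<^sub>2) (\<lambda>X A. snd (fob \<gamma> (X, A)))"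
proof -
  let ?H1 = "Hal\<Phi> \<Theta> (mm_rels M\<^sub>1)" and ?H2 = "Hal\<Phi> \<Theta> (mm_rels M\<^sub>2)"
  let ?\<delta> = "\<lambda>X A. snd (fob \<gamma> (X, A))"
  have \<gamma>: "fob \<gamma> (X, Val \<Theta> M\<^sub>1 f\<^sub>1 X U) = (X, Val \<Theta> M\<^sub>2 f\<^sub>2 X (\<beta> X U))"
    if "X \<in> Gamma0 \<Theta>" "U \<in> hcarr ?H1 X" for X U
  proof -
    have "fob (ftr_comp \<gamma> (Ct \<Theta> M\<^sub>1 f\<^sub>1)) (X, {U}) = fob (ftr_comp (Ct \<Theta> M\<^sub>2 f\<^sub>2) (lift_hom \<beta>)) (X, {U})"
      using eq that Ob_L_cat[of X "{U}"] unfolding ftr_eq_def by blast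
    then show ?thesis
      using sol_singleton[OF G(1) that] sol_singleton[OF G(2) that(1) hal_hom_carr[OF \<beta> that]]
      by (simp add: ftr_comp_def Ct_def lift_hom_def)
  qed
  have \<gamma>': "fob \<gamma>' (X, Val \<Theta> M\<^sub>2 f\<^sub>2 X V) = (X, Val \<Theta> M\<^sub>1 f\<^sub>1 X (\<beta>' X V))"
    if "X \<in> Gamma0 \<Theta>" "V \<in> hcarr ?H2 X" for X V
  proof -
    have "fob (ftr_comp \<gamma>' (Ct \<Theta> M\<^sub>2 f\<^sub>2)) (X, {V}) = fob (ftr_comp (Ct \<Theta> M\<^sub>1 f\<^sub>1) (lift_hom \<beta>')) (X, {V})"
      using eq' that Ob_L_cat[of X "{V}"] unfolding ftr_eq_def by blast
    then show ?thesis
      using sol_singleton[OF G(2) that] sol_singleton[OF G(1) that(1) hal_hom_carr[OF \<beta>' that]]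
      by (simp add: ftr_comp_def Ct_def lift_hom_def)
  qed
  have ob: "(X, Val \<Theta> M f X U) \<in> Ob (K_cat \<Theta> M f)"
    if "in_variety \<Theta> (mm_alg M)" "X \<in> Gamma0 \<Theta>" "U \<in> hcarr (Hal\<Phi> \<Theta> (mm_rels M)) X"
    for X U and M :: "('s, 'o, 'y, 'r) multi_model" and f
    using that sol_singleton[OF that, of f] by (auto simp: K_cat_def Let_def Ob_L_cat intro!: exI[of _ "{U}"])
  have \<gamma>'\<gamma>: "fob \<gamma>' (fob \<gamma> (X, Val \<Theta> M\<^sub>1 f\<^sub>1 X U)) = (X, Val \<Theta> M\<^sub>1 f\<^sub>1 X U)"
    if "X \<in> Gamma0 \<Theta>" "U \<in> hcarr ?H1 X" for X U
    using inv ob[OF G(1) that, of f\<^sub>1] by (simp add: inverse_functors_def ftr_eq_def ftr_comp_def ftr_id_def)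
  have \<gamma>\<gamma>': "fob \<gamma> (fob \<gamma>' (X, Val \<Theta> M\<^sub>2 f\<^sub>2 X V)) = (X, Val \<Theta> M\<^sub>2 f\<^sub>2 X V)"
    if "X \<in> Gamma0 \<Theta>" "V \<in> hcarr ?H2 X" for X V
    using inv ob[OF G(2) that, of f\<^sub>2] by (simp add: inverse_functors_def ftr_eq_def ftr_comp_def ftr_id_def)
  have "hal_hom \<Theta> (R_alg \<Theta> M\<^sub>1 f\<^sub>1) (R_alg \<Theta> M\<^sub>2 f\<^sub>2) ?\<delta>"
    by (rule hal_hom_descend[OF halmos_closed[OF halmos_Hal\<Phi>] Val_hom[OF G(1)]
          hal_hom_comp[OF \<beta> Val_hom[OF G(2)]] hcarr_R_alg]) (simp add: \<gamma>)
  moreover have "bij_betw (?\<delta> X) (hcarr (R_alg \<Theta> M\<^sub>1 f\<^sub>1) X) (hcarr (R_alg \<Theta> M\<^sub>2 f\<^sub>2) X)"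
    if X: "X \<in> Gamma0 \<Theta>" for X
  proof (rule bij_betw_byWitness[where f' = "\<lambda>A. snd (fob \<gamma>' (X, A))"])
    show "\<forall>A\<in>hcarr (R_alg \<Theta> M\<^sub>1 f\<^sub>1) X. snd (fob \<gamma>' (X, ?\<delta> X A)) = A"
      using \<gamma>'\<gamma>[OF X] by (auto simp: hcarr_R_alg \<gamma>[OF X])
    show "\<forall>A\<in>hcarr (R_alg \<Theta> M\<^sub>2 f\<^sub>2) X. ?\<delta> X (snd (fob \<gamma>' (X, A))) = A"
      using \<gamma>\<gamma>'[OF X] by (auto simp: hcarr_R_alg \<gamma>'[OF X])
    show "?\<delta> X ` hcarr (R_alg \<Theta> M\<^sub>1 f\<^sub>1) X \<subseteq> hcarr (R_alg \<Theta> M\<^sub>2 f\<^sub>2) X"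
      using hal_hom_carr[OF \<beta> X] by (auto simp: hcarr_R_alg \<gamma>[OF X])
    show "(\<lambda>A. snd (fob \<gamma>' (X, A))) ` hcarr (R_alg \<Theta> M\<^sub>2 f\<^sub>2) X \<subseteq> hcarr (R_alg \<Theta> M\<^sub>1 f\<^sub>1) X"
      using hal_hom_carr[OF \<beta>' X] by (auto simp: hcarr_R_alg \<gamma>'[OF X])
  qed
  ultimately show ?thesis by (simp add: hal_iso_def)
qed

lemma finite_points:
  assumes G: "finite_alg G" and X: "X \<in> Gamma0 \<Theta>"
  shows "finite (points \<Theta> G X)"
proof (rule finite_imageD)
  let ?r = "\<lambda>\<mu>. restrict (app_var \<Theta> X \<mu>) X"
  have "?r ` points \<Theta> G X \<subseteq> (\<Pi>\<^sub>E x\<in>X. carr G (vsort \<Theta> x))"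
    by (auto simp: points_def app_var_in_carr)
  moreover have "finite (\<Pi>\<^sub>E x\<in>X. carr G (vsort \<Theta> x))"
    using G X by (auto simp: finite_alg_def Gamma0_def intro: finite_PiE)
  ultimately show "finite (?r ` points \<Theta> G X)" by (rule finite_subset)
  show "inj_on ?r (points \<Theta> G X)"
  proof (rule inj_onI)
    fix \<mu> \<nu> assume \<mu>\<nu>: "\<mu> \<in> points \<Theta> G X" "\<nu> \<in> points \<Theta> G X" and eq: "?r \<mu> = ?r \<nu>"
    show "\<mu> = \<nu>" using \<mu>\<nu> by (rule points_eqI) (metis eq restrict_apply')
  qed
qed

lemma hal_hom_Inter:
  assumes G: "in_variety \<Theta> (mm_alg M\<^sub>1)" and \<gamma>: "hal_hom \<Theta> (R_alg \<Theta> M\<^sub>1 f\<^sub>1) (R_alg \<Theta> M\<^sub>2 f\<^sub>2) \<gamma>"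
    and X: "X \<in> Gamma0 \<Theta>" and "finite S" and "S \<subseteq> hcarr (R_alg \<Theta> M\<^sub>1 f\<^sub>1) X"
  shows "points \<Theta> (mm_alg M\<^sub>1) X \<inter> \<Inter>S \<in> hcarr (R_alg \<Theta> M\<^sub>1 f\<^sub>1) X \<and>
    \<gamma> X (points \<Theta> (mm_alg M\<^sub>1) X \<inter> \<Inter>S) = points \<Theta> (mm_alg M\<^sub>2) X \<inter> \<Inter>(\<gamma> X ` S)"
  using assms(4,5)
proof (induction S)
  case empty
  show ?case
    using closed_top[OF closed_ops_R_alg[OF G] X] hal_hom_top[OF \<gamma> X] by (simp add: R_alg_simps)
next
  case (insert A S)
  let ?P = "points \<Theta> (mm_alg M\<^sub>1) X"
  have A: "A \<in> hcarr (R_alg \<Theta> M\<^sub>1 f\<^sub>1) X" and S: "?P \<inter> \<Inter>S \<in> hcarr (R_alg \<Theta> M\<^sub>1 f\<^sub>1) X"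
    and IH: "\<gamma> X (?P \<inter> \<Inter>S) = points \<Theta> (mm_alg M\<^sub>2) X \<inter> \<Inter>(\<gamma> X ` S)"
    using insert by auto
  have "?P \<inter> \<Inter>(insert A S) = A \<inter> (?P \<inter> \<Inter>S)" by blast
  then show ?case
    using closed_meet[OF closed_ops_R_alg[OF G] X A S] hal_hom_meet[OF \<gamma> X A S] IH
    by (auto simp: R_alg_simps)
qed

text \<open>In general the value algebras are closed under finite intersections only.  This is where finiteness of the
  model enters: it makes the intersection that defines \<open>T\<^sup>f\<close> finite for every \<open>T\<close>.\<close>

lemma sol_in_R_alg:
  assumes G: "in_variety \<Theta> (mm_alg M\<^sub>1)" and fin: "finite_alg (mm_alg M\<^sub>1)"
    and \<gamma>: "hal_hom \<Theta> (R_alg \<Theta> M\<^sub>1 f\<^sub>1) (R_alg \<Theta> M\<^sub>2 f\<^sub>2) \<gamma>"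
    and X: "X \<in> Gamma0 \<Theta>" and T: "T \<subseteq> hcarr (Hal\<Phi> \<Theta> (mm_rels M\<^sub>1)) X"
  shows "sol \<Theta> M\<^sub>1 f\<^sub>1 X T \<in> hcarr (R_alg \<Theta> M\<^sub>1 f\<^sub>1) X"
    and "\<gamma> X (sol \<Theta> M\<^sub>1 f\<^sub>1 X T) = points \<Theta> (mm_alg M\<^sub>2) X \<inter> \<Inter>(\<gamma> X ` Val \<Theta> M\<^sub>1 f\<^sub>1 X ` T)"
proof -
  have S: "Val \<Theta> M\<^sub>1 f\<^sub>1 X ` T \<subseteq> hcarr (R_alg \<Theta> M\<^sub>1 f\<^sub>1) X" using T by (auto simp: hcarr_R_alg)
  also have "\<dots> \<subseteq> Pow (points \<Theta> (mm_alg M\<^sub>1) X)" using R_alg_subset_points[OF G X] by blast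
  finally have "finite (Val \<Theta> M\<^sub>1 f\<^sub>1 X ` T)" using finite_points[OF fin X] finite_subset by blast
  from hal_hom_Inter[OF G \<gamma> X this S]
  show "sol \<Theta> M\<^sub>1 f\<^sub>1 X T \<in> hcarr (R_alg \<Theta> M\<^sub>1 f\<^sub>1) X"
    "\<gamma> X (sol \<Theta> M\<^sub>1 f\<^sub>1 X T) = points \<Theta> (mm_alg M\<^sub>2) X \<inter> \<Inter>(\<gamma> X ` Val \<Theta> M\<^sub>1 f\<^sub>1 X ` T)"
    by (simp_all add: sol_eq)
qed

lemma Ob_K_cat:
  assumes G: "in_variety \<Theta> (mm_alg M)" and fin: "finite_alg (mm_alg M)"
  shows "(X, A) \<in> Ob (K_cat \<Theta> M f) \<longleftrightarrow> X \<in> Gamma0 \<Theta> \<and> A \<in> hcarr (R_alg \<Theta> M f) X"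
proof -
  have "(X, A) \<in> Ob (K_cat \<Theta> M f) \<longleftrightarrow>
      X \<in> Gamma0 \<Theta> \<and> (\<exists>T\<subseteq>hcarr (Hal\<Phi> \<Theta> (mm_rels M)) X. A = sol \<Theta> M f X T)"
    by (auto simp: K_cat_def Let_def Ob_L_cat)
  moreover have "(\<exists>T\<subseteq>hcarr (Hal\<Phi> \<Theta> (mm_rels M)) X. A = sol \<Theta> M f X T) \<longleftrightarrow> A \<in> hcarr (R_alg \<Theta> M f) X"
    if X: "X \<in> Gamma0 \<Theta>"
  proof
    assume "A \<in> hcarr (R_alg \<Theta> M f) X"
    then obtain U where "U \<in> hcarr (Hal\<Phi> \<Theta> (mm_rels M)) X" "A = Val \<Theta> M f X U" by (auto simp: hcarr_R_alg)
    then show "\<exists>T\<subseteq>hcarr (Hal\<Phi> \<Theta> (mm_rels M)) X. A = sol \<Theta> M f X T"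
      using sol_singleton[OF G X] by (intro exI[of _ "{U}"]) simp
  qed (use sol_in_R_alg(1)[OF G fin hal_hom_id X] in auto)
  ultimately show ?thesis by blast
qed

lemma mem_Ar_K_cat:
  "k \<in> Ar (K_cat \<Theta> M f) \<longleftrightarrow> (\<exists>X A s Y B. k = ((X, A), pull \<Theta> Y A s, (Y, B)) \<and>
     (X, A) \<in> Ob (K_cat \<Theta> M f) \<and> (Y, B) \<in> Ob (K_cat \<Theta> M f) \<and> s \<in> subs \<Theta> Y X \<and>
     (\<forall>\<nu>\<in>A. comp_hom (W \<Theta> Y) \<nu> s \<in> B))"
  by (simp add: K_cat_def Let_def)

lemma pull_eq_iff:
  assumes A: "A \<subseteq> points \<Theta> G X" and s: "s \<in> subs \<Theta> Y X" "s' \<in> subs \<Theta> Y X"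
  shows "pull \<Theta> Y A s = pull \<Theta> Y A s' \<longleftrightarrow>
    (\<forall>y\<in>Y. A \<subseteq> {\<nu> \<in> points \<Theta> G X. \<nu> (vsort \<Theta> y) (app_var \<Theta> Y s y) = \<nu> (vsort \<Theta> y) (app_var \<Theta> Y s' y)})"
proof -
  have "pull \<Theta> Y A s = pull \<Theta> Y A s' \<longleftrightarrow> (\<forall>\<nu>\<in>A. comp_hom (W \<Theta> Y) \<nu> s = comp_hom (W \<Theta> Y) \<nu> s')"
  proof (intro iffI ballI)
    fix \<nu> assume "pull \<Theta> Y A s = pull \<Theta> Y A s'" and \<nu>: "\<nu> \<in> A"
    then have "pull \<Theta> Y A s \<nu> = pull \<Theta> Y A s' \<nu>" by simp
    then show "comp_hom (W \<Theta> Y) \<nu> s = comp_hom (W \<Theta> Y) \<nu> s'" using \<nu> by (simp add: pull_def)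
  qed (auto simp: pull_def intro: restrict_ext)
  also have "\<dots> \<longleftrightarrow> (\<forall>\<nu>\<in>A. \<forall>y\<in>Y. \<nu> (vsort \<Theta> y) (app_var \<Theta> Y s y) = \<nu> (vsort \<Theta> y) (app_var \<Theta> Y s' y))"
  proof (intro ball_cong refl iffI ballI)
    fix \<nu> y assume "comp_hom (W \<Theta> Y) \<nu> s = comp_hom (W \<Theta> Y) \<nu> s'" "y \<in> Y"
    then show "\<nu> (vsort \<Theta> y) (app_var \<Theta> Y s y) = \<nu> (vsort \<Theta> y) (app_var \<Theta> Y s' y)"
      by (metis app_var_comp_hom)
  next
    fix \<nu> assume \<nu>: "\<nu> \<in> A"
      and eq: "\<forall>y\<in>Y. \<nu> (vsort \<Theta> y) (app_var \<Theta> Y s y) = \<nu> (vsort \<Theta> y) (app_var \<Theta> Y s' y)"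
    have "\<nu> \<in> points \<Theta> G X" using \<nu> A by blast
    from subs_points[OF s(1) this] subs_points[OF s(2) this]
    show "comp_hom (W \<Theta> Y) \<nu> s = comp_hom (W \<Theta> Y) \<nu> s'"
      by (rule points_eqI) (simp add: app_var_comp_hom eq)
  qed
  also have "\<dots> \<longleftrightarrow> (\<forall>y\<in>Y. A \<subseteq> {\<nu> \<in> points \<Theta> G X.
      \<nu> (vsort \<Theta> y) (app_var \<Theta> Y s y) = \<nu> (vsort \<Theta> y) (app_var \<Theta> Y s' y)})"
    using A by blast
  finally show ?thesis .
qed

lemma pull_id: "A \<subseteq> points \<Theta> G X \<Longrightarrow> pull \<Theta> X A (id_hom (W \<Theta> X)) = restrict id A"
  unfolding pull_def points_def by (rule restrict_ext) (auto simp: comp_hom_id)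

lemma pull_compose:
  assumes "t \<in> subs \<Theta> Z Y" and "\<And>\<nu>. \<nu> \<in> A \<Longrightarrow> comp_hom (W \<Theta> Y) \<nu> s \<in> B"
  shows "compose A (pull \<Theta> Z B t) (pull \<Theta> Y A s) = pull \<Theta> Z A (comp_hom (W \<Theta> Z) s t)"
  unfolding compose_def pull_def
  by (rule restrict_ext) (use assms in \<open>simp add: subs_def comp_hom_assoc\<close>)

text \<open>A morphism of knowledge content is a mapping \<open>[s]\<close> that does not remember \<open>s\<close>, so a choice is needed to
  send it to \<open>[s]\<close> on the other side.  For an isomorphism \<open>\<gamma>\<close> of value algebras the result does not depend
  on the choice.\<close>

definition K_ftr :: "('x set \<Rightarrow> ('s, 'o, 'x, 'a) point set \<Rightarrow> ('s, 'o, 'x, 'b) point set) \<Rightarrow>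
    (('s, 'o, 'x, 'a) Kob, ('s, 'o, 'x, 'a) Kar, ('s, 'o, 'x, 'b) Kob, ('s, 'o, 'x, 'b) Kar) ftr" where
  "K_ftr \<gamma> = \<lparr>
     fob = (\<lambda>(X, A). (X, \<gamma> X A)),
     far = (\<lambda>((X, A), g, (Y, B)). ((X, \<gamma> X A), pull \<Theta> Y (\<gamma> X A)
              (SOME s. s \<in> subs \<Theta> Y X \<and> (\<forall>\<nu>\<in>A. comp_hom (W \<Theta> Y) \<nu> s \<in> B) \<and> pull \<Theta> Y A s = g), (Y, \<gamma> Y B))) \<rparr>"

context
  fixes M\<^sub>1 :: "('s, 'o, 'a, 'p) multi_model" and f\<^sub>1 :: "'p \<Rightarrow> 'a list set"
    and M\<^sub>2 :: "('s, 'o, 'b, 'q) multi_model" and f\<^sub>2 :: "'q \<Rightarrow> 'b list set"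
    and \<gamma> :: "'x set \<Rightarrow> ('s, 'o, 'x, 'a) point set \<Rightarrow> ('s, 'o, 'x, 'b) point set"
  assumes G: "in_variety \<Theta> (mm_alg M\<^sub>1)" "in_variety \<Theta> (mm_alg M\<^sub>2)"
    and iso: "hal_iso \<Theta> (R_alg \<Theta> M\<^sub>1 f\<^sub>1) (R_alg \<Theta> M\<^sub>2 f\<^sub>2) \<gamma>"
begin

lemma iso_hom: "hal_hom \<Theta> (R_alg \<Theta> M\<^sub>1 f\<^sub>1) (R_alg \<Theta> M\<^sub>2 f\<^sub>2) \<gamma>"
  using iso by (simp add: hal_iso_def)

lemma iso_subset_iff:
  assumes "X \<in> Gamma0 \<Theta>" and "A \<in> hcarr (R_alg \<Theta> M\<^sub>1 f\<^sub>1) X" and "B \<in> hcarr (R_alg \<Theta> M\<^sub>1 f\<^sub>1) X"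
  shows "\<gamma> X A \<subseteq> \<gamma> X B \<longleftrightarrow> A \<subseteq> B"
proof -
  have "A \<inter> B \<in> hcarr (R_alg \<Theta> M\<^sub>1 f\<^sub>1) X"
    using closed_meet[OF closed_ops_R_alg[OF G(1)] assms] by (simp add: R_alg_simps)
  moreover have "\<gamma> X (A \<inter> B) = \<gamma> X A \<inter> \<gamma> X B"
    using hal_hom_meet[OF iso_hom assms] by (simp add: R_alg_simps)
  moreover have "inj_on (\<gamma> X) (hcarr (R_alg \<Theta> M\<^sub>1 f\<^sub>1) X)"
    using iso assms(1) by (auto simp: hal_iso_def bij_betw_def)
  ultimately have "\<gamma> X A \<inter> \<gamma> X B = \<gamma> X A \<longleftrightarrow> A \<inter> B = A"
    using assms(2) by (metis inj_on_eq_iff)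
  then show ?thesis by (simp only: le_iff_inf)
qed

text \<open>That \<open>s\<close> induces a morphism is the inclusion \<open>A \<subseteq> s\<^sub>* B\<close>, and that two such \<open>s\<close> induce the same
  mapping is a system of inclusions \<open>A \<subseteq> (s y \<equiv> s' y)\<close>; an isomorphism preserves and reflects both.\<close>

lemma iso_arrow_iff:
  assumes X: "X \<in> Gamma0 \<Theta>" and A: "A \<in> hcarr (R_alg \<Theta> M\<^sub>1 f\<^sub>1) X"
    and Y: "Y \<in> Gamma0 \<Theta>" and B: "B \<in> hcarr (R_alg \<Theta> M\<^sub>1 f\<^sub>1) Y" and s: "s \<in> subs \<Theta> Y X"
  shows "(\<forall>\<nu>\<in>\<gamma> X A. comp_hom (W \<Theta> Y) \<nu> s \<in> \<gamma> Y B) \<longleftrightarrow> (\<forall>\<nu>\<in>A. comp_hom (W \<Theta> Y) \<nu> s \<in> B)"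
proof -
  have "A \<subseteq> points \<Theta> (mm_alg M\<^sub>1) X" using R_alg_subset_points[OF G(1) X A] .
  then have "(\<forall>\<nu>\<in>A. comp_hom (W \<Theta> Y) \<nu> s \<in> B) \<longleftrightarrow> A \<subseteq> hsub (R_alg \<Theta> M\<^sub>1 f\<^sub>1) Y X s B"
    by (auto simp: R_alg_simps)
  moreover have "\<gamma> X A \<subseteq> points \<Theta> (mm_alg M\<^sub>2) X"
    using R_alg_subset_points[OF G(2) X hal_hom_carr[OF iso_hom X A]] .
  then have "(\<forall>\<nu>\<in>\<gamma> X A. comp_hom (W \<Theta> Y) \<nu> s \<in> \<gamma> Y B) \<longleftrightarrow> \<gamma> X A \<subseteq> \<gamma> X (hsub (R_alg \<Theta> M\<^sub>1 f\<^sub>1) Y X s B)"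
    unfolding hal_hom_sub[OF iso_hom Y X s B] by (auto simp: R_alg_simps)
  ultimately show ?thesis
    using iso_subset_iff[OF X A closed_sub[OF closed_ops_R_alg[OF G(1)] Y X s B]] by simp
qed

lemma iso_pull_eq_iff:
  assumes X: "X \<in> Gamma0 \<Theta>" and A: "A \<in> hcarr (R_alg \<Theta> M\<^sub>1 f\<^sub>1) X"
    and s: "s \<in> subs \<Theta> Y X" "s' \<in> subs \<Theta> Y X"
  shows "pull \<Theta> Y (\<gamma> X A) s = pull \<Theta> Y (\<gamma> X A) s' \<longleftrightarrow> pull \<Theta> Y A s = pull \<Theta> Y A s'"
proof -
  have "\<gamma> X A \<subseteq> {\<nu> \<in> points \<Theta> (mm_alg M\<^sub>2) X. \<nu> (vsort \<Theta> y) (app_var \<Theta> Y s y) = \<nu> (vsort \<Theta> y) (app_var \<Theta> Y s' y)} \<longleftrightarrow>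
      A \<subseteq> {\<nu> \<in> points \<Theta> (mm_alg M\<^sub>1) X. \<nu> (vsort \<Theta> y) (app_var \<Theta> Y s y) = \<nu> (vsort \<Theta> y) (app_var \<Theta> Y s' y)}"
    if y: "y \<in> Y" for y
  proof -
    have w: "app_var \<Theta> Y s y \<in> carr (W \<Theta> X) (vsort \<Theta> y)" "app_var \<Theta> Y s' y \<in> carr (W \<Theta> X) (vsort \<Theta> y)"
      using s y by (auto simp: subs_def app_var_in_carr)
    show ?thesis
      using iso_subset_iff[OF X A closed_eq[OF closed_ops_R_alg[OF G(1)] X w]] hal_hom_eq[OF iso_hom X w]
      by (simp add: R_alg_simps)
  qed
  then show ?thesis
    unfolding pull_eq_iff[OF R_alg_subset_points[OF G(1) X A] s]
      pull_eq_iff[OF R_alg_subset_points[OF G(2) X hal_hom_carr[OF iso_hom X A]] s] by blast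
qed

lemma far_K_ftr:
  assumes X: "X \<in> Gamma0 \<Theta>" and A: "A \<in> hcarr (R_alg \<Theta> M\<^sub>1 f\<^sub>1) X"
    and s: "s \<in> subs \<Theta> Y X" and AB: "\<forall>\<nu>\<in>A. comp_hom (W \<Theta> Y) \<nu> s \<in> B"
  shows "far (K_ftr \<gamma>) ((X, A), pull \<Theta> Y A s, (Y, B)) = ((X, \<gamma> X A), pull \<Theta> Y (\<gamma> X A) s, (Y, \<gamma> Y B))"
proof -
  let ?P = "\<lambda>t. t \<in> subs \<Theta> Y X \<and> (\<forall>\<nu>\<in>A. comp_hom (W \<Theta> Y) \<nu> t \<in> B) \<and> pull \<Theta> Y A t = pull \<Theta> Y A s"
  have "?P (SOME t. ?P t)" by (rule someI[of ?P s]) (use s AB in simp)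
  then show ?thesis using iso_pull_eq_iff[OF X A _ s] by (simp add: K_ftr_def)
qed

lemma is_functor_K_ftr:
  assumes fin: "finite_alg (mm_alg M\<^sub>1)" "finite_alg (mm_alg M\<^sub>2)"
  shows "is_functor (K_cat \<Theta> M\<^sub>1 f\<^sub>1) (K_cat \<Theta> M\<^sub>2 f\<^sub>2) (K_ftr \<gamma>)"
proof -
  let ?K1 = "K_cat \<Theta> M\<^sub>1 f\<^sub>1" and ?K2 = "K_cat \<Theta> M\<^sub>2 f\<^sub>2" and ?F = "K_ftr \<gamma>"
  have fob: "fob ?F (X, A) = (X, \<gamma> X A)" for X A by (simp add: K_ftr_def)
  have ob: "(X, \<gamma> X A) \<in> Ob ?K2" if "(X, A) \<in> Ob ?K1" for X A
    using that hal_hom_carr[OF iso_hom] by (simp add: Ob_K_cat G fin)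
  have Id: "Id (K_cat \<Theta> M f) (X, A) = ((X, A), restrict id A, (X, A))"
    and Dom: "Dom (K_cat \<Theta> M f) (a, g, b) = a" and Cod: "Cod (K_cat \<Theta> M f) (a, g, b) = b"
    and Comp: "Comp (K_cat \<Theta> M f) (b', h, c) (a, g, b) = (a, compose (snd a) h g, c)"
    for M :: "('s, 'o, 'y, 'r) multi_model" and f X A a g b b' h c
    by (simp_all add: K_cat_def Let_def)
  have id: "far ?F (Id ?K1 (X, A)) = Id ?K2 (X, \<gamma> X A)" if "(X, A) \<in> Ob ?K1" for X A
  proof -
    have X: "X \<in> Gamma0 \<Theta>" and A: "A \<in> hcarr (R_alg \<Theta> M\<^sub>1 f\<^sub>1) X" using that by (simp_all add: Ob_K_cat G fin)
    have "\<forall>\<nu>\<in>A. comp_hom (W \<Theta> X) \<nu> (id_hom (W \<Theta> X)) \<in> A"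
      using R_alg_subset_points[OF G(1) X A] by (auto simp: points_def comp_hom_id)
    from far_K_ftr[OF X A subs_id this] show ?thesis
      using pull_id[OF R_alg_subset_points[OF G(1) X A]]
        pull_id[OF R_alg_subset_points[OF G(2) X hal_hom_carr[OF iso_hom X A]]] by (simp add: Id)
  qed
  have ar: "far ?F k \<in> Ar ?K2 \<and> Dom ?K2 (far ?F k) = fob ?F (Dom ?K1 k) \<and> Cod ?K2 (far ?F k) = fob ?F (Cod ?K1 k)"
    if k: "k \<in> Ar ?K1" for k
  proof -
    obtain X A s Y B where k: "k = ((X, A), pull \<Theta> Y A s, (Y, B))" and XA: "(X, A) \<in> Ob ?K1"
      and YB: "(Y, B) \<in> Ob ?K1" and s: "s \<in> subs \<Theta> Y X" and AB: "\<forall>\<nu>\<in>A. comp_hom (W \<Theta> Y) \<nu> s \<in> B"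
      using k unfolding mem_Ar_K_cat by blast
    have X: "X \<in> Gamma0 \<Theta>" "A \<in> hcarr (R_alg \<Theta> M\<^sub>1 f\<^sub>1) X" and Y: "Y \<in> Gamma0 \<Theta>" "B \<in> hcarr (R_alg \<Theta> M\<^sub>1 f\<^sub>1) Y"
      using XA YB by (simp_all add: Ob_K_cat G fin)
    have far: "far ?F k = ((X, \<gamma> X A), pull \<Theta> Y (\<gamma> X A) s, (Y, \<gamma> Y B))" unfolding k by (rule far_K_ftr[OF X s AB])
    moreover have "\<forall>\<nu>\<in>\<gamma> X A. comp_hom (W \<Theta> Y) \<nu> s \<in> \<gamma> Y B" using iso_arrow_iff[OF X Y s] AB by simp
    then have "far ?F k \<in> Ar ?K2" unfolding far mem_Ar_K_cat using ob[OF XA] ob[OF YB] s by blast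
    ultimately show ?thesis by (simp add: Dom Cod fob k)
  qed
  have comp: "far ?F (Comp ?K1 l k) = Comp ?K2 (far ?F l) (far ?F k)"
    if k: "k \<in> Ar ?K1" and l: "l \<in> Ar ?K1" and lk: "Dom ?K1 l = Cod ?K1 k" for k l
  proof -
    obtain X A s Y B where k: "k = ((X, A), pull \<Theta> Y A s, (Y, B))" and XA: "(X, A) \<in> Ob ?K1"
      and YB: "(Y, B) \<in> Ob ?K1" and s: "s \<in> subs \<Theta> Y X" and AB: "\<forall>\<nu>\<in>A. comp_hom (W \<Theta> Y) \<nu> s \<in> B"
      using k unfolding mem_Ar_K_cat by blast
    obtain Z C t where l: "l = ((Y, B), pull \<Theta> Z B t, (Z, C))" and t: "t \<in> subs \<Theta> Z Y"
      and BC: "\<forall>\<nu>\<in>B. comp_hom (W \<Theta> Z) \<nu> t \<in> C"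
      using l lk unfolding mem_Ar_K_cat by (auto simp: k Dom Cod)
    have X: "X \<in> Gamma0 \<Theta>" "A \<in> hcarr (R_alg \<Theta> M\<^sub>1 f\<^sub>1) X" and Y: "Y \<in> Gamma0 \<Theta>" "B \<in> hcarr (R_alg \<Theta> M\<^sub>1 f\<^sub>1) Y"
      using XA YB by (simp_all add: Ob_K_cat G fin)
    have AB2: "\<forall>\<nu>\<in>\<gamma> X A. comp_hom (W \<Theta> Y) \<nu> s \<in> \<gamma> Y B" using iso_arrow_iff[OF X Y s] AB by simp
    have AC: "\<forall>\<nu>\<in>A. comp_hom (W \<Theta> Z) \<nu> (comp_hom (W \<Theta> Z) s t) \<in> C"
      using AB BC t by (simp add: subs_def comp_hom_assoc)
    have "Comp ?K1 l k = ((X, A), pull \<Theta> Z A (comp_hom (W \<Theta> Z) s t), (Z, C))"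
      using AB by (simp add: k l Comp pull_compose[OF t])
    then have "far ?F (Comp ?K1 l k) = ((X, \<gamma> X A), pull \<Theta> Z (\<gamma> X A) (comp_hom (W \<Theta> Z) s t), (Z, \<gamma> Z C))"
      using far_K_ftr[OF X subs_comp[OF t s] AC] by simp
    also have "\<dots> = Comp ?K2 (far ?F l) (far ?F k)"
      using AB2 far_K_ftr[OF X s AB] far_K_ftr[OF Y t BC] by (simp add: k l Comp pull_compose[OF t])
    finally show ?thesis .
  qed
  show ?thesis
    unfolding is_functor_def using ob id ar comp by (auto simp: fob)
qed

text \<open>\<open>T\<^sup>f\<close> is a finite intersection of values of formulas, and \<open>\<gamma>\<close> preserves finite intersections.\<close>

lemma K_ftr_Ct:
  assumes fin: "finite_alg (mm_alg M\<^sub>1)"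
    and \<beta>: "hal_hom \<Theta> (Hal\<Phi> \<Theta> (mm_rels M\<^sub>1)) (Hal\<Phi> \<Theta> (mm_rels M\<^sub>2)) \<beta>"
    and val: "\<And>X U. X \<in> Gamma0 \<Theta> \<Longrightarrow> U \<in> hcarr (Hal\<Phi> \<Theta> (mm_rels M\<^sub>1)) X \<Longrightarrow>
      Val \<Theta> M\<^sub>2 f\<^sub>2 X (\<beta> X U) = \<gamma> X (Val \<Theta> M\<^sub>1 f\<^sub>1 X U)"
  shows "ftr_eq (L_cat \<Theta> (mm_rels M\<^sub>1)) (ftr_comp (K_ftr \<gamma>) (Ct \<Theta> M\<^sub>1 f\<^sub>1)) (ftr_comp (Ct \<Theta> M\<^sub>2 f\<^sub>2) (lift_hom \<beta>))"
proof -
  let ?H = "Hal\<Phi> \<Theta> (mm_rels M\<^sub>1)"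
  have sol: "sol \<Theta> M\<^sub>2 f\<^sub>2 X (\<beta> X ` T) = \<gamma> X (sol \<Theta> M\<^sub>1 f\<^sub>1 X T)" if X: "X \<in> Gamma0 \<Theta>" and T: "T \<subseteq> hcarr ?H X" for X T
  proof -
    have "Val \<Theta> M\<^sub>2 f\<^sub>2 X ` \<beta> X ` T = \<gamma> X ` Val \<Theta> M\<^sub>1 f\<^sub>1 X ` T"
      unfolding image_image using val[OF X] T by (intro image_cong) auto
    then show ?thesis using sol_in_R_alg(2)[OF G(1) fin iso_hom X T] by (simp add: sol_eq)
  qed
  have "far (K_ftr \<gamma>) (far (Ct \<Theta> M\<^sub>1 f\<^sub>1) k) = far (Ct \<Theta> M\<^sub>2 f\<^sub>2) (far (lift_hom \<beta>) k)"
    if "k \<in> Ar (L_cat \<Theta> (mm_rels M\<^sub>1))" for k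
  proof -
    obtain X T\<^sub>1 s Y T\<^sub>2 where k: "k = ((X, T\<^sub>1), s, (Y, T\<^sub>2))" and X: "X \<in> Gamma0 \<Theta>" "T\<^sub>1 \<subseteq> hcarr ?H X"
      and Y: "Y \<in> Gamma0 \<Theta>" "T\<^sub>2 \<subseteq> hcarr ?H Y" and s: "s \<in> subs \<Theta> X Y" and sT: "\<forall>u\<in>T\<^sub>1. hsub ?H X Y s u \<in> T\<^sub>2"
      using \<open>k \<in> _\<close> by (auto simp: L_cat_def Let_def)
    have "comp_hom (W \<Theta> X) \<nu> s \<in> sol \<Theta> M\<^sub>1 f\<^sub>1 X T\<^sub>1" if \<nu>: "\<nu> \<in> sol \<Theta> M\<^sub>1 f\<^sub>1 Y T\<^sub>2" for \<nu>
    proof -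
      have "comp_hom (W \<Theta> X) \<nu> s \<in> Val \<Theta> M\<^sub>1 f\<^sub>1 X u" if u: "u \<in> T\<^sub>1" for u
      proof -
        have "\<nu> \<in> Val \<Theta> M\<^sub>1 f\<^sub>1 Y (hsub ?H X Y s u)" using \<nu> sT u by (simp add: sol_def)
        then show ?thesis
          using hal_hom_sub[OF Val_hom[OF G(1), of f\<^sub>1] X(1) Y(1) s, of u] X(2) u by (auto simp: R_alg_simps)
      qed
      then show ?thesis using \<nu> subs_points[OF s] by (auto simp: sol_def)
    qed
    then have "far (K_ftr \<gamma>) (far (Ct \<Theta> M\<^sub>1 f\<^sub>1) k) = ((Y, \<gamma> Y (sol \<Theta> M\<^sub>1 f\<^sub>1 Y T\<^sub>2)),
        pull \<Theta> X (\<gamma> Y (sol \<Theta> M\<^sub>1 f\<^sub>1 Y T\<^sub>2)) s, (X, \<gamma> X (sol \<Theta> M\<^sub>1 f\<^sub>1 X T\<^sub>1)))"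
      using far_K_ftr[OF Y(1) sol_in_R_alg(1)[OF G(1) fin iso_hom Y] s] by (simp add: k Ct_def)
    then show ?thesis using sol[OF X] sol[OF Y] by (simp add: k Ct_def lift_hom_def)
  qed
  moreover have "fob (K_ftr \<gamma>) (fob (Ct \<Theta> M\<^sub>1 f\<^sub>1) a) = fob (Ct \<Theta> M\<^sub>2 f\<^sub>2) (fob (lift_hom \<beta>) a)"
    if "a \<in> Ob (L_cat \<Theta> (mm_rels M\<^sub>1))" for a
    using that by (cases a) (simp add: Ob_L_cat Ct_def lift_hom_def K_ftr_def sol)
  ultimately show ?thesis by (simp add: ftr_eq_def ftr_comp_def)
qed

lemma iso_lifts_to_formulas:
  obtains \<beta> where "hal_hom \<Theta> (Hal\<Phi> \<Theta> (mm_rels M\<^sub>1)) (Hal\<Phi> \<Theta> (mm_rels M\<^sub>2)) \<beta>"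
    and "\<And>X U. X \<in> Gamma0 \<Theta> \<Longrightarrow> U \<in> hcarr (Hal\<Phi> \<Theta> (mm_rels M\<^sub>1)) X \<Longrightarrow>
      Val \<Theta> M\<^sub>2 f\<^sub>2 X (\<beta> X U) = \<gamma> X (Val \<Theta> M\<^sub>1 f\<^sub>1 X U)"
  using Hal\<Phi>_projective[OF halmos_Hal\<Phi> Val_hom[OF G(2)] equalityD1[OF hcarr_R_alg]
      hal_hom_comp[OF Val_hom[OF G(1)] iso_hom]] by blast

end

lemma K_ftr_inverse:
  assumes G: "in_variety \<Theta> (mm_alg M\<^sub>1)" "in_variety \<Theta> (mm_alg M\<^sub>2)"
    and fin: "finite_alg (mm_alg M\<^sub>1)"
    and iso: "hal_iso \<Theta> (R_alg \<Theta> M\<^sub>1 f\<^sub>1) (R_alg \<Theta> M\<^sub>2 f\<^sub>2) \<gamma>"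
    and iso': "hal_iso \<Theta> (R_alg \<Theta> M\<^sub>2 f\<^sub>2) (R_alg \<Theta> M\<^sub>1 f\<^sub>1) \<delta>"
    and inv: "\<And>X A. X \<in> Gamma0 \<Theta> \<Longrightarrow> A \<in> hcarr (R_alg \<Theta> M\<^sub>1 f\<^sub>1) X \<Longrightarrow> \<delta> X (\<gamma> X A) = A"
  shows "ftr_eq (K_cat \<Theta> M\<^sub>1 f\<^sub>1) (ftr_comp (K_ftr \<delta>) (K_ftr \<gamma>)) ftr_id"
proof -
  note as = G iso and as' = G(2,1) iso'
  have "far (K_ftr \<delta>) (far (K_ftr \<gamma>) k) = k" if k: "k \<in> Ar (K_cat \<Theta> M\<^sub>1 f\<^sub>1)" for k
  proof -
    obtain X A s Y B where k: "k = ((X, A), pull \<Theta> Y A s, (Y, B))" and X: "X \<in> Gamma0 \<Theta>" "A \<in> hcarr (R_alg \<Theta> M\<^sub>1 f\<^sub>1) X"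
      and Y: "Y \<in> Gamma0 \<Theta>" "B \<in> hcarr (R_alg \<Theta> M\<^sub>1 f\<^sub>1) Y"
      and s: "s \<in> subs \<Theta> Y X" and AB: "\<forall>\<nu>\<in>A. comp_hom (W \<Theta> Y) \<nu> s \<in> B"
      using k unfolding mem_Ar_K_cat Ob_K_cat[OF G(1) fin] by blast
    have "\<forall>\<nu>\<in>\<gamma> X A. comp_hom (W \<Theta> Y) \<nu> s \<in> \<gamma> Y B" using iso_arrow_iff[OF as X Y s] AB by simp
    then show ?thesis
      using far_K_ftr[OF as X s AB] far_K_ftr[OF as' X(1) hal_hom_carr[OF iso_hom[OF as] X] s]
        inv[OF X] inv[OF Y] by (simp add: k)
  qed
  moreover have "fob (K_ftr \<delta>) (fob (K_ftr \<gamma>) a) = a" if "a \<in> Ob (K_cat \<Theta> M\<^sub>1 f\<^sub>1)" for a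
    using that inv by (cases a) (simp add: Ob_K_cat G fin K_ftr_def)
  ultimately show ?thesis by (simp add: ftr_eq_def ftr_comp_def ftr_id_def)
qed

text \<open>No homomorphism of formulas is given here; projectivity supplies one over \<open>\<gamma>\<close> and one over its inverse.
  They need not be inverse to each other.\<close>

lemma K_isomorphism_of_hal_iso:
  assumes G: "in_variety \<Theta> (mm_alg M\<^sub>1)" "in_variety \<Theta> (mm_alg M\<^sub>2)"
    and fin: "finite_alg (mm_alg M\<^sub>1)" "finite_alg (mm_alg M\<^sub>2)"
    and iso: "hal_iso \<Theta> (R_alg \<Theta> M\<^sub>1 f\<^sub>1) (R_alg \<Theta> M\<^sub>2 f\<^sub>2) \<gamma>"
  shows "\<exists>\<beta> \<beta>' F F'.
    hal_hom \<Theta> (Hal\<Phi> \<Theta> (mm_rels M\<^sub>1)) (Hal\<Phi> \<Theta> (mm_rels M\<^sub>2)) \<beta> \<and>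
    hal_hom \<Theta> (Hal\<Phi> \<Theta> (mm_rels M\<^sub>2)) (Hal\<Phi> \<Theta> (mm_rels M\<^sub>1)) \<beta>' \<and>
    inverse_functors (K_cat \<Theta> M\<^sub>1 f\<^sub>1) (K_cat \<Theta> M\<^sub>2 f\<^sub>2) F F' \<and>
    ftr_eq (L_cat \<Theta> (mm_rels M\<^sub>1)) (ftr_comp F (Ct \<Theta> M\<^sub>1 f\<^sub>1)) (ftr_comp (Ct \<Theta> M\<^sub>2 f\<^sub>2) (lift_hom \<beta>)) \<and>
    ftr_eq (L_cat \<Theta> (mm_rels M\<^sub>2)) (ftr_comp F' (Ct \<Theta> M\<^sub>2 f\<^sub>2)) (ftr_comp (Ct \<Theta> M\<^sub>1 f\<^sub>1) (lift_hom \<beta>'))"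
proof -
  define \<delta> where "\<delta> = (\<lambda>X. inv_into (hcarr (R_alg \<Theta> M\<^sub>1 f\<^sub>1) X) (\<gamma> X))"
  have iso': "hal_iso \<Theta> (R_alg \<Theta> M\<^sub>2 f\<^sub>2) (R_alg \<Theta> M\<^sub>1 f\<^sub>1) \<delta>"
    unfolding \<delta>_def by (rule hal_iso_inv[OF closed_ops_R_alg[OF G(1)] iso])
  have bij: "bij_betw (\<gamma> X) (hcarr (R_alg \<Theta> M\<^sub>1 f\<^sub>1) X) (hcarr (R_alg \<Theta> M\<^sub>2 f\<^sub>2) X)" if "X \<in> Gamma0 \<Theta>" for X
    using iso that by (simp add: hal_iso_def)
  note as = G iso and as' = G(2,1) iso'
  obtain \<beta> where \<beta>: "hal_hom \<Theta> (Hal\<Phi> \<Theta> (mm_rels M\<^sub>1)) (Hal\<Phi> \<Theta> (mm_rels M\<^sub>2)) \<beta>"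
    "\<And>X U. X \<in> Gamma0 \<Theta> \<Longrightarrow> U \<in> hcarr (Hal\<Phi> \<Theta> (mm_rels M\<^sub>1)) X \<Longrightarrow>
      Val \<Theta> M\<^sub>2 f\<^sub>2 X (\<beta> X U) = \<gamma> X (Val \<Theta> M\<^sub>1 f\<^sub>1 X U)"
    using iso_lifts_to_formulas[OF as] by metis
  obtain \<beta>' where \<beta>': "hal_hom \<Theta> (Hal\<Phi> \<Theta> (mm_rels M\<^sub>2)) (Hal\<Phi> \<Theta> (mm_rels M\<^sub>1)) \<beta>'"
    "\<And>X U. X \<in> Gamma0 \<Theta> \<Longrightarrow> U \<in> hcarr (Hal\<Phi> \<Theta> (mm_rels M\<^sub>2)) X \<Longrightarrow>
      Val \<Theta> M\<^sub>1 f\<^sub>1 X (\<beta>' X U) = \<delta> X (Val \<Theta> M\<^sub>2 f\<^sub>2 X U)"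
    using iso_lifts_to_formulas[OF as'] by metis
  have "inverse_functors (K_cat \<Theta> M\<^sub>1 f\<^sub>1) (K_cat \<Theta> M\<^sub>2 f\<^sub>2) (K_ftr \<gamma>) (K_ftr \<delta>)"
    unfolding inverse_functors_def
  proof (intro conjI)
    show "ftr_eq (K_cat \<Theta> M\<^sub>1 f\<^sub>1) (ftr_comp (K_ftr \<delta>) (K_ftr \<gamma>)) ftr_id"
      by (rule K_ftr_inverse[OF G fin(1) iso iso']) (simp add: \<delta>_def bij_betw_inv_into_left[OF bij])
    show "ftr_eq (K_cat \<Theta> M\<^sub>2 f\<^sub>2) (ftr_comp (K_ftr \<gamma>) (K_ftr \<delta>)) ftr_id"
      by (rule K_ftr_inverse[OF G(2,1) fin(2) iso' iso]) (simp add: \<delta>_def bij_betw_inv_into_right[OF bij])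
  qed (rule is_functor_K_ftr[OF as fin] is_functor_K_ftr[OF as' fin(2,1)])+
  moreover have
    "ftr_eq (L_cat \<Theta> (mm_rels M\<^sub>1)) (ftr_comp (K_ftr \<gamma>) (Ct \<Theta> M\<^sub>1 f\<^sub>1)) (ftr_comp (Ct \<Theta> M\<^sub>2 f\<^sub>2) (lift_hom \<beta>))"
    by (rule K_ftr_Ct[OF as fin(1) \<beta>])
  moreover have
    "ftr_eq (L_cat \<Theta> (mm_rels M\<^sub>2)) (ftr_comp (K_ftr \<delta>) (Ct \<Theta> M\<^sub>2 f\<^sub>2)) (ftr_comp (Ct \<Theta> M\<^sub>1 f\<^sub>1) (lift_hom \<beta>'))"
    by (rule K_ftr_Ct[OF as' fin(2) \<beta>'])
  ultimately show ?thesis using \<beta>(1) \<beta>'(1) by blast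
qed

end

theorem theorem4:
  fixes \<Theta> :: "('s::finite, 'o, 'x) variety"
    and M\<^sub>1 :: "('s, 'o, 'a, 'p) multi_model"
    and M\<^sub>2 :: "('s, 'o, 'b, 'q) multi_model"
  assumes "wf_variety \<Theta>"
    and "is_multi_model \<Theta> M\<^sub>1" and "is_multi_model \<Theta> M\<^sub>2"
    and "finite_alg (mm_alg M\<^sub>1)" and "finite_alg (mm_alg M\<^sub>2)"
  shows "kb_equivalent \<Theta> M\<^sub>1 M\<^sub>2 \<longleftrightarrow>
    (\<exists>\<alpha>. bij_betw \<alpha> (mm_ints M\<^sub>1) (mm_ints M\<^sub>2) \<and>
       (\<forall>f\<in>mm_ints M\<^sub>1. \<exists>\<gamma>. hal_iso \<Theta> (R_alg \<Theta> M\<^sub>1 f) (R_alg \<Theta> M\<^sub>2 (\<alpha> f)) \<gamma>))"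
proof -
  interpret wf_var \<Theta> by unfold_locales (rule assms(1))
  have G: "in_variety \<Theta> (mm_alg M\<^sub>1)" "in_variety \<Theta> (mm_alg M\<^sub>2)"
    using assms(2,3) by (simp_all add: is_multi_model_def)
  show ?thesis
  proof
    assume "kb_equivalent \<Theta> M\<^sub>1 M\<^sub>2"
    then obtain \<alpha> where \<alpha>: "bij_betw \<alpha> (mm_ints M\<^sub>1) (mm_ints M\<^sub>2)"
      and equiv: "\<forall>f\<in>mm_ints M\<^sub>1. \<exists>\<beta> \<beta>' \<gamma> \<gamma>'.
        hal_hom \<Theta> (Hal\<Phi> \<Theta> (mm_rels M\<^sub>1)) (Hal\<Phi> \<Theta> (mm_rels M\<^sub>2)) \<beta> \<and>
        hal_hom \<Theta> (Hal\<Phi> \<Theta> (mm_rels M\<^sub>2)) (Hal\<Phi> \<Theta> (mm_rels M\<^sub>1)) \<beta>' \<and>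
        inverse_functors (K_cat \<Theta> M\<^sub>1 f) (K_cat \<Theta> M\<^sub>2 (\<alpha> f)) \<gamma> \<gamma>' \<and>
        ftr_eq (L_cat \<Theta> (mm_rels M\<^sub>1))
          (ftr_comp \<gamma> (Ct \<Theta> M\<^sub>1 f)) (ftr_comp (Ct \<Theta> M\<^sub>2 (\<alpha> f)) (lift_hom \<beta>)) \<and>
        ftr_eq (L_cat \<Theta> (mm_rels M\<^sub>2))
          (ftr_comp \<gamma>' (Ct \<Theta> M\<^sub>2 (\<alpha> f))) (ftr_comp (Ct \<Theta> M\<^sub>1 f) (lift_hom \<beta>'))"
      unfolding kb_equivalent_def by (elim exE conjE)
    have "\<exists>\<gamma>. hal_iso \<Theta> (R_alg \<Theta> M\<^sub>1 f) (R_alg \<Theta> M\<^sub>2 (\<alpha> f)) \<gamma>" if "f \<in> mm_ints M\<^sub>1" for f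
      using bspec[OF equiv that] by (elim exE conjE) (rule exI, rule hal_iso_of_K_isomorphism[OF G])
    then show "\<exists>\<alpha>. bij_betw \<alpha> (mm_ints M\<^sub>1) (mm_ints M\<^sub>2) \<and>
       (\<forall>f\<in>mm_ints M\<^sub>1. \<exists>\<gamma>. hal_iso \<Theta> (R_alg \<Theta> M\<^sub>1 f) (R_alg \<Theta> M\<^sub>2 (\<alpha> f)) \<gamma>)"
      using \<alpha> by blast
  next
    assume "\<exists>\<alpha>. bij_betw \<alpha> (mm_ints M\<^sub>1) (mm_ints M\<^sub>2) \<and>
       (\<forall>f\<in>mm_ints M\<^sub>1. \<exists>\<gamma>. hal_iso \<Theta> (R_alg \<Theta> M\<^sub>1 f) (R_alg \<Theta> M\<^sub>2 (\<alpha> f)) \<gamma>)"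
    then obtain \<alpha> where \<alpha>: "bij_betw \<alpha> (mm_ints M\<^sub>1) (mm_ints M\<^sub>2)"
      and iso: "\<forall>f\<in>mm_ints M\<^sub>1. \<exists>\<gamma>. hal_iso \<Theta> (R_alg \<Theta> M\<^sub>1 f) (R_alg \<Theta> M\<^sub>2 (\<alpha> f)) \<gamma>"
      by (elim exE conjE)
    show "kb_equivalent \<Theta> M\<^sub>1 M\<^sub>2"
      unfolding kb_equivalent_def
    proof (intro exI[of _ \<alpha>] conjI ballI \<alpha>)
      fix f assume "f \<in> mm_ints M\<^sub>1"
      with iso obtain \<gamma> where "hal_iso \<Theta> (R_alg \<Theta> M\<^sub>1 f) (R_alg \<Theta> M\<^sub>2 (\<alpha> f)) \<gamma>" by blast
      then show "\<exists>\<beta> \<beta>' \<gamma> \<gamma>'.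
        hal_hom \<Theta> (Hal\<Phi> \<Theta> (mm_rels M\<^sub>1)) (Hal\<Phi> \<Theta> (mm_rels M\<^sub>2)) \<beta> \<and>
        hal_hom \<Theta> (Hal\<Phi> \<Theta> (mm_rels M\<^sub>2)) (Hal\<Phi> \<Theta> (mm_rels M\<^sub>1)) \<beta>' \<and>
        inverse_functors (K_cat \<Theta> M\<^sub>1 f) (K_cat \<Theta> M\<^sub>2 (\<alpha> f)) \<gamma> \<gamma>' \<and>
        ftr_eq (L_cat \<Theta> (mm_rels M\<^sub>1))
          (ftr_comp \<gamma> (Ct \<Theta> M\<^sub>1 f)) (ftr_comp (Ct \<Theta> M\<^sub>2 (\<alpha> f)) (lift_hom \<beta>)) \<and>
        ftr_eq (L_cat \<Theta> (mm_rels M\<^sub>2))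
          (ftr_comp \<gamma>' (Ct \<Theta> M\<^sub>2 (\<alpha> f))) (ftr_comp (Ct \<Theta> M\<^sub>1 f) (lift_hom \<beta>'))"
        by (rule K_isomorphism_of_hal_iso[OF G assms(4,5)])
    qed
  qed
qed

end
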